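(* Let $d\in\{2,3\}$, let $\Omega\subset\mathbb{R}^d$ be a bounded domain with (strong) Lipschitz boundary, $T>0$, $I=(0,T)$, and $\mu_0,m_0>0$ constants. Let $p\in (L^\infty(\Omega))^d$, let $G\in\mathbb{R}^{d\times d}$ be invertible (field free point case), and let $h\in (H^s(I))^d$ with $s>\frac32$ satisfy: (i) $\sup_{t\in[0,T]}|\dot h(t)|^{-1}<\infty$; (ii) $G^{-1}h(t)\in\Omega$ for every $t\in I$, and there is a number $N_h$ such that for every $x\in\Omega$ there exist at most $N_h$ distinct $t\in I$ with $h(t)=Gx$. Let $H(x,t)=Gx-h(t)$ and let $\widetilde F$ be the limit ($\beta\to\infty$) integral operator $$(\widetilde F c)(t)=\int_\Omega c(x)\tilde\kappa(x,t)\,\mathrm{d}x,\qquad \tilde\kappa=\mu_0m_0\,p^t\left(-\frac{HH^t}{|H|^3}+\frac1{|H|}I_d\right)\dot H .$$ Then for any $\epsilon\in(0,\frac14)$ there is a constant $C$ independent of $n$ such that the singular values $\sigma_n$ of $\widetilde F$ (as an operator from $L^2(\Omega)$ to $L^2(I)$, ordered nonincreasingly) satisfy $$\sigma_n\le\begin{cases} C n^{-1+\epsilon}, & d=3,\\ C n^{-\frac14+\epsilon}, & d=2.\end{cases}$$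
   Context: The superscript $t$ on a vector denotes transpose, $|\cdot|$ is the Euclidean norm, $I_d$ is the $d\times d$ identity matrix, and a dot denotes the time derivative, so $\dot H(x,t)=-\dot h(t)$. $H^s(I)$ is the $L^2$-based Sobolev space (Sobolev--Slobodeckij for non-integer $s$). *)

theory Defs
  imports "HOL-Analysis.Analysis"
begin

section \<open>Real \<open>L\<^sup>2\<close> spaces and compact operators between them\<close>

text \<open>
  Elements of \<open>L\<^sup>2(M)\<close> are represented by functions; equality of elements is equality
  almost everywhere, i.e. \<open>l2_norm M (\<lambda>x. f x - g x) = 0\<close>.
\<close>

definition l2_space :: "'a measure \<Rightarrow> ('a \<Rightarrow> real) set" where
  "l2_space M = {f \<in> borel_measurable M. integrable M (\<lambda>x. (f x)\<^sup>2)}"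

definition l2_inner :: "'a measure \<Rightarrow> ('a \<Rightarrow> real) \<Rightarrow> ('a \<Rightarrow> real) \<Rightarrow> real" where
  "l2_inner M f g = (LINT x|M. f x * g x)"

definition l2_norm :: "'a measure \<Rightarrow> ('a \<Rightarrow> real) \<Rightarrow> real" where
  "l2_norm M f = sqrt (l2_inner M f f)"

definition linfty_space :: "'a measure \<Rightarrow> ('a \<Rightarrow> real) set" where
  "linfty_space M = {f \<in> borel_measurable M. \<exists>B. AE x in M. \<bar>f x\<bar> \<le> B}"

definition l2_compact_operator ::
  "'a measure \<Rightarrow> 'b measure \<Rightarrow> (('a \<Rightarrow> real) \<Rightarrow> 'b \<Rightarrow> real) \<Rightarrow> bool" where
  "l2_compact_operator M N A \<longleftrightarrow>
     (\<forall>f\<in>l2_space M. A f \<in> l2_space N) \<and>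
     (\<forall>f\<in>l2_space M. \<forall>g\<in>l2_space M. \<forall>a b.
        AE t in N. A (\<lambda>x. a * f x + b * g x) t = a * A f t + b * A g t) \<and>
     (\<forall>f :: nat \<Rightarrow> 'a \<Rightarrow> real.
        (\<forall>n. f n \<in> l2_space M) \<and> (\<exists>B. \<forall>n. l2_norm M (f n) \<le> B) \<longrightarrow>
        (\<exists>g\<in>l2_space N. \<exists>r. strict_mono r \<and>
           (\<lambda>n. l2_norm N (\<lambda>t. A (f (r n)) t - g t)) \<longlonglongrightarrow> 0))"

section \<open>Singular values\<close>

text \<open>\<open>l2_adjoint M N A g f\<close>: the function \<open>f\<close> is a version of \<open>A\<^sup>* g\<close>.\<close>

definition l2_adjoint ::
  "'a measure \<Rightarrow> 'b measure \<Rightarrow> (('a \<Rightarrow> real) \<Rightarrow> 'b \<Rightarrow> real) \<Rightarrow> ('b \<Rightarrow> real) \<Rightarrow> ('a \<Rightarrow> real) \<Rightarrow> bool"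
  where
  "l2_adjoint M N A g f \<longleftrightarrow>
     f \<in> l2_space M \<and> (\<forall>c\<in>l2_space M. l2_inner N (A c) g = l2_inner M c f)"

text \<open>The eigenspace \<open>{v. A\<^sup>* A v = s\<^sup>2 v}\<close>.\<close>

definition singular_eigenspace ::
  "'a measure \<Rightarrow> 'b measure \<Rightarrow> (('a \<Rightarrow> real) \<Rightarrow> 'b \<Rightarrow> real) \<Rightarrow> real \<Rightarrow> ('a \<Rightarrow> real) set" where
  "singular_eigenspace M N A s =
     {v \<in> l2_space M. l2_adjoint M N A (A v) (\<lambda>x. s\<^sup>2 * v x)}"

definition l2_finite_orthonormal_basis ::
  "'a measure \<Rightarrow> 'i set \<Rightarrow> ('i \<Rightarrow> 'a \<Rightarrow> real) \<Rightarrow> ('a \<Rightarrow> real) set \<Rightarrow> bool" where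
  "l2_finite_orthonormal_basis M J v E \<longleftrightarrow>
     finite J \<and> (\<forall>j\<in>J. v j \<in> E) \<and>
     (\<forall>i\<in>J. \<forall>j\<in>J. l2_inner M (v i) (v j) = (if i = j then 1 else 0)) \<and>
     (\<forall>w\<in>E. AE x in M. w x = (\<Sum>j\<in>J. l2_inner M w (v j) * v j x))"

text \<open>
  The sequence \<open>\<sigma>\<^sub>1 \<ge> \<sigma>\<^sub>2 \<ge> \<dots> \<ge> 0\<close> lists every positive singular value of \<open>A\<close> (square root of
  an eigenvalue of \<open>A\<^sup>* A\<close>) exactly as often as its multiplicity, that is the dimension of the
  eigenspace. If there are only finitely many, the sequence continues with zeros. The value
  \<open>\<sigma> 0\<close> is irrelevant. For a compact operator these conditions determine \<open>\<sigma>\<^sub>1, \<sigma>\<^sub>2, \<dots>\<close>.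
\<close>

definition singular_value_sequence ::
  "'a measure \<Rightarrow> 'b measure \<Rightarrow> (('a \<Rightarrow> real) \<Rightarrow> 'b \<Rightarrow> real) \<Rightarrow> (nat \<Rightarrow> real) \<Rightarrow> bool" where
  "singular_value_sequence M N A \<sigma> \<longleftrightarrow>
     (\<forall>n\<ge>1. 0 \<le> \<sigma> n \<and> \<sigma> (Suc n) \<le> \<sigma> n) \<and>
     (\<forall>s>0. \<exists>v. l2_finite_orthonormal_basis M {n. 1 \<le> n \<and> \<sigma> n = s} v
                  (singular_eigenspace M N A s))"

section \<open>Sobolev--Slobodeckij spaces on an open subset of the real line\<close>

definition test_function :: "real set \<Rightarrow> (real \<Rightarrow> real) \<Rightarrow> bool" where
  "test_function U \<phi> \<longleftrightarrow>
     (\<forall>k x. (deriv ^^ k) \<phi> field_differentiable at x) \<and>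
     compact (closure {x. \<phi> x \<noteq> 0}) \<and> closure {x. \<phi> x \<noteq> 0} \<subseteq> U"

definition weak_derivative ::
  "real set \<Rightarrow> nat \<Rightarrow> (real \<Rightarrow> real) \<Rightarrow> (real \<Rightarrow> real) \<Rightarrow> bool" where
  "weak_derivative U k f g \<longleftrightarrow>
     (\<forall>\<phi>. test_function U \<phi> \<longrightarrow>
        (LINT x|lebesgue_on U. f x * (deriv ^^ k) \<phi> x) =
        (-1) ^ k * (LINT x|lebesgue_on U. g x * \<phi> x))"

text \<open>
  For \<open>s = k + \<theta>\<close> with \<open>k\<close> a natural number and \<open>0 \<le> \<theta> < 1\<close>: all weak derivatives up to
  order \<open>k\<close> are in \<open>L\<^sup>2\<close>, and if \<open>\<theta> > 0\<close> the Slobodeckij seminorm of the \<open>k\<close>-th one is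
  finite. Only meaningful for \<open>s \<ge> 0\<close>.
\<close>

definition sobolev_space :: "real \<Rightarrow> real set \<Rightarrow> (real \<Rightarrow> real) set" where
  "sobolev_space s U = {f \<in> l2_space (lebesgue_on U).
     \<exists>D. (\<forall>j\<le>nat \<lfloor>s\<rfloor>. D j \<in> l2_space (lebesgue_on U) \<and> weak_derivative U j f (D j)) \<and>
         (frac s > 0 \<longrightarrow>
           (\<integral>\<^sup>+ x. (\<integral>\<^sup>+ y. ennreal ((D (nat \<lfloor>s\<rfloor>) x - D (nat \<lfloor>s\<rfloor>) y)\<^sup>2
                                / \<bar>x - y\<bar> powr (1 + 2 * frac s))
              \<partial>lebesgue_on U) \<partial>lebesgue_on U) < \<infinity>)}"

section \<open>Lipschitz domains\<close>

text \<open>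
  Strong Lipschitz boundary: near each boundary point, \<open>\<Omega>\<close> is, in a suitable Cartesian
  coordinate system, the set above the graph of a Lipschitz function. Here \<open>\<nu>\<close> is the
  vertical direction and \<open>\<gamma>\<close> a function on the hyperplane orthogonal to \<open>\<nu>\<close>.
\<close>

definition strong_lipschitz_boundary :: "'a::euclidean_space set \<Rightarrow> bool" where
  "strong_lipschitz_boundary \<Omega> \<longleftrightarrow>
     (\<forall>z\<in>frontier \<Omega>. \<exists>U \<nu> L. \<exists>\<gamma> :: 'a \<Rightarrow> real.
        open U \<and> z \<in> U \<and> norm \<nu> = 1 \<and> L-lipschitz_on {y. y \<bullet> \<nu> = 0} \<gamma> \<and>
        \<Omega> \<inter> U = {x \<in> U. x \<bullet> \<nu> > \<gamma> (x - (x \<bullet> \<nu>) *\<^sub>R \<nu>)})"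

definition bounded_lipschitz_domain :: "'a::euclidean_space set \<Rightarrow> bool" where
  "bounded_lipschitz_domain \<Omega> \<longleftrightarrow>
     open \<Omega> \<and> connected \<Omega> \<and> \<Omega> \<noteq> {} \<and> bounded \<Omega> \<and> strong_lipschitz_boundary \<Omega>"

section \<open>The limit operator\<close>

text \<open>Time derivative on \<open>[0,T]\<close>, one-sided at the end points.\<close>

definition time_deriv :: "real \<Rightarrow> (real \<Rightarrow> 'a::real_normed_vector) \<Rightarrow> real \<Rightarrow> 'a" where
  "time_deriv T f t = vector_derivative f (at t within {0..T})"

definition outer_prod :: "real ^ 'n \<Rightarrow> real ^ 'n \<Rightarrow> real ^ 'n ^ 'n" where
  "outer_prod a b = (\<chi> i j. a $ i * b $ j)"

definition mag_field ::
  "real ^ 'n ^ 'n \<Rightarrow> (real \<Rightarrow> real ^ 'n) \<Rightarrow> real ^ 'n \<Rightarrow> real \<Rightarrow> real ^ 'n" where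
  "mag_field G h x t = G *v x - h t"

text \<open>
  For \<open>t\<close> fixed, the kernel takes the conventional value \<open>0\<close> at the single point \<open>x\<close> with
  \<open>mag_field G h x t = 0\<close>, which is irrelevant to the integral.
\<close>

definition limit_kernel ::
  "real \<Rightarrow> real \<Rightarrow> real \<Rightarrow> (real ^ 'n \<Rightarrow> real ^ 'n) \<Rightarrow> real ^ 'n ^ 'n \<Rightarrow> (real \<Rightarrow> real ^ 'n) \<Rightarrow>
   real ^ 'n \<Rightarrow> real \<Rightarrow> real" where
  "limit_kernel T \<mu>\<^sub>0 m\<^sub>0 p G h x t =
     (let H = mag_field G h x t; H' = time_deriv T (mag_field G h x) t in
      \<mu>\<^sub>0 * m\<^sub>0 *
      (p x \<bullet> ((- ((1 / norm H ^ 3) *\<^sub>R outer_prod H H) + (1 / norm H) *\<^sub>R mat 1) *v H')))"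

definition limit_operator ::
  "(real ^ 'n) set \<Rightarrow> real \<Rightarrow> real \<Rightarrow> real \<Rightarrow> (real ^ 'n \<Rightarrow> real ^ 'n) \<Rightarrow> real ^ 'n ^ 'n \<Rightarrow>
   (real \<Rightarrow> real ^ 'n) \<Rightarrow> (real ^ 'n \<Rightarrow> real) \<Rightarrow> real \<Rightarrow> real" where
  "limit_operator \<Omega> T \<mu>\<^sub>0 m\<^sub>0 p G h c t =
     (LINT x|lebesgue_on \<Omega>. c x * limit_kernel T \<mu>\<^sub>0 m\<^sub>0 p G h x t)"

end

theory Submission
  imports Defs "HOL-Complex_Analysis.Great_Picard"
begin

text \<open>
  Write \<open>Fc = \<Sum>\<^sub>j g\<^sub>j U\<^sub>j c\<close> with bounded functions \<open>g\<^sub>j\<close> (multiples of the components of \<open>h'\<close>) and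
  integral operators \<open>U\<^sub>j\<close> whose kernels are homogeneous of degree \<open>-1\<close> in \<open>H\<close>. With
  \<open>\<rho> = |H|\<close> these kernels satisfy the Hoelder estimate
  \<open>|\<kappa>(x,t) - \<kappa>(x,\<tau>)| \<le> K |t - \<tau>|\<^sup>\<theta> (\<rho>(x,t)\<^sup>-\<^sup>1\<^sup>-\<^sup>\<theta> + \<rho>(x,\<tau>)\<^sup>-\<^sup>1\<^sup>-\<^sup>\<theta>)\<close>, and the operator with kernel
  \<open>\<rho>\<^sup>-\<^sup>1\<^sup>-\<^sup>\<theta>\<close> is bounded on \<open>L\<^sup>2\<close> by Schur's test as soon as \<open>2(1 + \<theta>) < d + 1\<close>: one splits
  \<open>2(1 + \<theta>) = a + b\<close> with \<open>a < d\<close> (integrability in \<open>x\<close>) and \<open>b < 1\<close> (integrability in \<open>t\<close> along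
  a regular \<open>C\<^sup>1\<close> curve). Hence \<open>U\<^sub>j c\<close> differs from its means over \<open>n\<close> equal subintervals by
  \<open>O(n\<^sup>-\<^sup>\<theta>)\<close>. Since the \<open>g\<^sub>j\<close> are not smoothed, the approximation of \<open>F\<close> has rank \<open>d n\<close>, and
  \<open>\<sigma>\<^sub>d\<^sub>n\<^sub>+\<^sub>1 = O(n\<^sup>-\<^sup>\<theta>)\<close> by the minimum principle. The choices are \<open>\<theta> = 1 - \<epsilon>\<close> for \<open>d = 3\<close>
  and \<open>\<theta> = 1/4\<close> for \<open>d = 2\<close>.

  The existence of the singular value sequence needs no spectral theorem: the same argument bounds
  the number of orthonormal eigenvectors with eigenvalue at least \<open>r\<close>, so the positive
  singular values can be enumerated in decreasing order.
\<close>

section \<open>\<open>L\<^sup>2\<close> spaces as function spaces\<close>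

text \<open>The obstacle is the low regularity of \<open>h'\<close>: for \<open>s\<close> close to
  3/2 it is only Hoelder continuous with a small exponent, so the full kernel need not be Hoelder
  continuous in time with exponent \<open>\<theta>\<close>. The factor depending on
  \<open>G x - h t\<close> is, since \<open>h\<close> is Lipschitz; hence the components of
  \<open>h'\<close> stay outside as bounded multipliers, and means are taken of the
  \<open>U j c\<close> alone. The approximation is not stated as a finite rank operator but as an
  inequality: the norm of \<open>A f\<close> is at most \<open>K n^-\<theta>\<close> times the norm
  of \<open>f\<close>, plus a multiple of the absolute values of finitely many linear functionals of
  \<open>f\<close>. This one form serves for the eigenvalue bound (work on the common kernel of the
  functionals), for boundedness (\<open>n = 1\<close>) and for compactness (let all functionals
  converge along a subsequence). Classical differentiability of \<open>h\<close> up to the end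
  points is extracted from the weak derivatives by comparing difference quotients over nested
  intervals. Together with the lower bound for the speed it makes the curve expand distances on
  short time intervals, which is the source of integrability in \<open>t\<close>.\<close>

lemma l2_spaceD:
  assumes "f \<in> l2_space M"
  shows "f \<in> borel_measurable M" "integrable M (\<lambda>x. (f x)\<^sup>2)"
  using assms by (auto simp: l2_space_def)

lemma l2_mult_integrable:
  assumes "f \<in> l2_space M" "g \<in> l2_space M"
  shows "integrable M (\<lambda>x. f x * g x)"
proof (rule Bochner_Integration.integrable_bound)
  note [measurable] = l2_spaceD(1)[OF assms(1)] l2_spaceD(1)[OF assms(2)]
  show "integrable M (\<lambda>x. (f x)\<^sup>2 + (g x)\<^sup>2)"
    using assms by (auto dest: l2_spaceD)
  show "(\<lambda>x. f x * g x) \<in> borel_measurable M" by measurable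
  have "\<bar>f x * g x\<bar> \<le> (f x)\<^sup>2 + (g x)\<^sup>2" for x
  proof -
    have "2 * (\<bar>f x\<bar> * \<bar>g x\<bar>) \<le> (f x)\<^sup>2 + (g x)\<^sup>2"
      using sum_squares_bound[of "\<bar>f x\<bar>" "\<bar>g x\<bar>"] by simp
    moreover have "0 \<le> \<bar>f x\<bar> * \<bar>g x\<bar>" by simp
    ultimately show ?thesis unfolding abs_mult by linarith
  qed
  then show "AE x in M. norm (f x * g x) \<le> norm ((f x)\<^sup>2 + (g x)\<^sup>2)" by simp
qed

lemma l2_add:
  assumes "f \<in> l2_space M" "g \<in> l2_space M"
  shows "(\<lambda>x. f x + g x) \<in> l2_space M"
proof -
  note [measurable] = l2_spaceD(1)[OF assms(1)] l2_spaceD(1)[OF assms(2)]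
  have "integrable M (\<lambda>x. (f x)\<^sup>2 + (g x)\<^sup>2 + 2 * (f x * g x))"
    using assms by (intro Bochner_Integration.integrable_add integrable_mult_right l2_mult_integrable)
      (auto dest: l2_spaceD)
  then have "integrable M (\<lambda>x. (f x + g x)\<^sup>2)"
    by (simp add: power2_sum mult.assoc)
  then show ?thesis by (simp add: l2_space_def)
qed

lemma l2_scale:
  assumes "f \<in> l2_space M"
  shows "(\<lambda>x. c * f x) \<in> l2_space M"
  using assms by (auto simp: l2_space_def power_mult_distrib)

lemma l2_lincomb:
  assumes "f \<in> l2_space M" "g \<in> l2_space M"
  shows "(\<lambda>x. a * f x + b * g x) \<in> l2_space M"
  by (intro l2_add l2_scale assms)

lemma l2_diff:
  assumes "f \<in> l2_space M" "g \<in> l2_space M"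
  shows "(\<lambda>x. f x - g x) \<in> l2_space M"
  using l2_lincomb[OF assms, of 1 "-1"] by simp

lemma l2_sum:
  assumes "\<And>i. i \<in> I \<Longrightarrow> f i \<in> l2_space M"
  shows "(\<lambda>x. \<Sum>i\<in>I. f i x) \<in> l2_space M"
  using assms
proof (induction I rule: infinite_finite_induct)
  case (insert i I)
  then show ?case using l2_add[of "f i" M "\<lambda>x. \<Sum>i\<in>I. f i x"] by simp
qed (simp_all add: l2_space_def)

lemma l2_inner_commute: "l2_inner M f g = l2_inner M g f"
  by (simp add: l2_inner_def mult.commute)

lemma l2_inner_sum_left:
  assumes "\<And>i. i \<in> I \<Longrightarrow> f i \<in> l2_space M" "g \<in> l2_space M"
  shows "l2_inner M (\<lambda>x. \<Sum>i\<in>I. c i * f i x) g = (\<Sum>i\<in>I. c i * l2_inner M (f i) g)"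
proof -
  have "l2_inner M (\<lambda>x. \<Sum>i\<in>I. c i * f i x) g = (LINT x|M. (\<Sum>i\<in>I. c i * (f i x * g x)))"
    by (simp add: l2_inner_def sum_distrib_right mult.assoc)
  also have "\<dots> = (\<Sum>i\<in>I. LINT x|M. c i * (f i x * g x))"
    by (intro Bochner_Integration.integral_sum integrable_mult_right l2_mult_integrable assms)
  finally show ?thesis by (simp add: l2_inner_def)
qed

lemma l2_inner_lincomb_left:
  assumes "f \<in> l2_space M" "g \<in> l2_space M" "k \<in> l2_space M"
  shows "l2_inner M (\<lambda>x. a * f x + b * g x) k = a * l2_inner M f k + b * l2_inner M g k"
  using l2_mult_integrable[OF assms(1,3)] l2_mult_integrable[OF assms(2,3)]
  by (simp add: l2_inner_def distrib_right mult.assoc)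

lemma l2_inner_lincomb_right:
  assumes "f \<in> l2_space M" "g \<in> l2_space M" "k \<in> l2_space M"
  shows "l2_inner M k (\<lambda>x. a * f x + b * g x) = a * l2_inner M k f + b * l2_inner M k g"
  using l2_inner_lincomb_left[OF assms] by (simp add: l2_inner_commute)

lemma l2_inner_scale_right: "l2_inner M f (\<lambda>x. c * g x) = c * l2_inner M f g"
proof -
  have "l2_inner M f (\<lambda>x. c * g x) = (LINT x|M. c * (f x * g x))"
    unfolding l2_inner_def by (simp only: mult.left_commute)
  then show ?thesis by (simp add: l2_inner_def)
qed

lemma l2_inner_cong_AE:
  assumes "AE x in M. f x = f' x" "g \<in> borel_measurable M" "f \<in> borel_measurable M" "f' \<in> borel_measurable M"
  shows "l2_inner M f g = l2_inner M f' g"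
  unfolding l2_inner_def using assms by (intro integral_cong_AE) auto

lemma l2_norm_nonneg [simp]: "0 \<le> l2_norm M f"
  by (simp add: l2_norm_def l2_inner_def)

lemma l2_norm_square: "(l2_norm M f)\<^sup>2 = (LINT x|M. (f x)\<^sup>2)"
  by (simp add: l2_norm_def l2_inner_def power2_eq_square)

lemma l2_norm_eq_sqrt: "l2_norm M f = sqrt (LINT x|M. (f x)\<^sup>2)"
  by (simp add: l2_norm_def l2_inner_def power2_eq_square)

lemma l2_inner_self: "l2_inner M f f = (l2_norm M f)\<^sup>2"
  by (simp add: l2_norm_def l2_inner_def)

lemma l2_norm_nn_integral:
  assumes "f \<in> l2_space M"
  shows "(\<integral>\<^sup>+x. ennreal ((f x)\<^sup>2) \<partial>M) = ennreal ((l2_norm M f)\<^sup>2)"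
  using l2_spaceD[OF assms] by (subst nn_integral_eq_integral) (auto simp: l2_norm_square)

lemma l2_space_nn_integral:
  assumes "f \<in> borel_measurable M" "(\<integral>\<^sup>+x. ennreal ((f x)\<^sup>2) \<partial>M) \<le> ennreal (B\<^sup>2)" "0 \<le> B"
  shows "f \<in> l2_space M" "l2_norm M f \<le> B"
proof -
  have "integrable M (\<lambda>x. (f x)\<^sup>2)"
    using assms by (intro integrableI_nonneg) (auto intro: le_less_trans)
  then show f: "f \<in> l2_space M" using assms by (simp add: l2_space_def)
  show "l2_norm M f \<le> B"
    using assms l2_norm_nn_integral[OF f] power2_le_imp_le by (simp add: )
qed

lemma l2_norm_scale: "l2_norm M (\<lambda>x. c * f x) = \<bar>c\<bar> * l2_norm M f"
  by (simp add: l2_norm_eq_sqrt power_mult_distrib real_sqrt_mult)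

lemma l2_Cauchy_Schwarz:
  assumes "f \<in> l2_space M" "g \<in> l2_space M"
  shows "\<bar>l2_inner M f g\<bar> \<le> l2_norm M f * l2_norm M g"
proof -
  let ?a = "l2_inner M f f" and ?b = "l2_inner M f g" and ?c = "l2_inner M g g"
  have q: "0 \<le> ?a + 2 * t * ?b + t\<^sup>2 * ?c" for t
  proof -
    have "0 \<le> l2_inner M (\<lambda>x. 1 * f x + t * g x) (\<lambda>x. 1 * f x + t * g x)"
      by (simp add: l2_inner_def)
    also have "\<dots> = ?a + 2 * t * ?b + t\<^sup>2 * ?c"
      by (subst l2_inner_lincomb_left, (intro l2_lincomb assms)+)
         (subst l2_inner_lincomb_right, (intro l2_lincomb assms)+,
          subst l2_inner_lincomb_right, (intro l2_lincomb assms)+,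
          simp add: l2_inner_commute[of M g f] algebra_simps power2_eq_square)
    finally show ?thesis .
  qed
  have a: "0 \<le> ?a" and c: "0 \<le> ?c" by (simp_all add: l2_inner_def)
  have "?b\<^sup>2 \<le> ?a * ?c"
  proof (cases "?c = 0")
    case True
    have "?b = 0"
    proof (rule ccontr)
      assume "?b \<noteq> 0"
      \<comment> \<open>With \<open>?c = 0\<close> the quadratic is affine in \<open>t\<close>, and
        this \<open>t\<close> gives it the value -1.\<close>
      then show False using q[of "- (?a + 1) / (2 * ?b)"] a True by (simp add: field_simps)
    qed
    then show ?thesis using True by simp
  next
    case False
    then show ?thesis using q[of "- ?b / ?c"] c by (simp add: field_simps power2_eq_square)
  qed
  then have "sqrt (?b\<^sup>2) \<le> sqrt (?a * ?c)" by (rule real_sqrt_le_mono)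
  then show ?thesis by (simp add: l2_norm_def real_sqrt_mult)
qed

lemma l2_norm_triangle:
  assumes "f \<in> l2_space M" "g \<in> l2_space M"
  shows "l2_norm M (\<lambda>x. f x + g x) \<le> l2_norm M f + l2_norm M g"
proof (rule power2_le_imp_le)
  have "(l2_norm M (\<lambda>x. f x + g x))\<^sup>2 = (LINT x|M. ((f x)\<^sup>2 + (g x)\<^sup>2) + 2 * (f x * g x))"
    unfolding l2_norm_square by (rule Bochner_Integration.integral_cong) (simp_all add: power2_sum)
  also have "\<dots> = (l2_norm M f)\<^sup>2 + (l2_norm M g)\<^sup>2 + 2 * l2_inner M f g"
    using l2_spaceD(2)[OF assms(1)] l2_spaceD(2)[OF assms(2)] l2_mult_integrable[OF assms]
    by (simp add: l2_norm_square l2_inner_def)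
  also have "\<dots> \<le> (l2_norm M f + l2_norm M g)\<^sup>2"
    using l2_Cauchy_Schwarz[OF assms] by (simp add: power2_sum mult.assoc)
  finally show "(l2_norm M (\<lambda>x. f x + g x))\<^sup>2 \<le> (l2_norm M f + l2_norm M g)\<^sup>2" .
qed simp

lemma l2_norm_cong_AE:
  assumes "AE x in M. f x = g x" "f \<in> borel_measurable M" "g \<in> borel_measurable M"
  shows "l2_norm M f = l2_norm M g"
  unfolding l2_norm_eq_sqrt using assms by (intro arg_cong[of _ _ sqrt] integral_cong_AE) auto

lemma l2_norm_eq_0_AE:
  assumes "f \<in> l2_space M" "l2_norm M f = 0"
  shows "AE x in M. f x = 0"
proof -
  have "(LINT x|M. (f x)\<^sup>2) = 0" using assms by (simp add: l2_norm_eq_sqrt)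
  then show ?thesis
    using integral_nonneg_eq_0_iff_AE[OF l2_spaceD(2)[OF assms(1)]] by simp
qed

lemma (in finite_measure) l2_const: "(\<lambda>x. c) \<in> l2_space M"
  by (simp add: l2_space_def)

lemma (in finite_measure) integral_abs_le_l2_norm:
  assumes "f \<in> l2_space M"
  shows "integrable M f" "(LINT x|M. \<bar>f x\<bar>) \<le> sqrt (measure M (space M)) * l2_norm M f"
proof -
  show "integrable M f"
    using square_integrable_imp_integrable l2_spaceD[OF assms] by blast
  have a: "(\<lambda>x. \<bar>f x\<bar>) \<in> l2_space M" using assms by (auto simp: l2_space_def)
  have n: "l2_norm M (\<lambda>x. \<bar>f x\<bar>) = l2_norm M f" by (simp add: l2_norm_eq_sqrt)
  have "l2_norm M (\<lambda>_. 1) = sqrt (measure M (space M))" by (simp add: l2_norm_eq_sqrt)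
  then show "(LINT x|M. \<bar>f x\<bar>) \<le> sqrt (measure M (space M)) * l2_norm M f"
    using l2_Cauchy_Schwarz[OF a l2_const[of 1]] n by (simp add: l2_inner_def mult.commute)
qed

section \<open>Completeness of square integrable functions over a finite measure\<close>

lemma subsequence_summable_gaps:
  fixes d :: "nat \<Rightarrow> nat \<Rightarrow> real"
  assumes "\<And>e. e > 0 \<Longrightarrow> \<exists>K. \<forall>i\<ge>K. \<forall>j\<ge>K. d i j < e"
  obtains r where "strict_mono (r :: nat \<Rightarrow> nat)" "\<And>k. d (r (Suc k)) (r k) < (1/2)^k"
proof -
  have "\<exists>K. \<forall>i\<ge>K. \<forall>j\<ge>K. d i j < (1/2)^k" for k :: nat
    by (rule assms) simp
  then obtain K where K: "\<And>k i j. i \<ge> K k \<Longrightarrow> j \<ge> K k \<Longrightarrow> d i j < (1/2)^k" by metis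
  \<comment> \<open>\<open>K\<close> need not be increasing, so each index is taken beyond both its
    predecessor and the next threshold; this gives monotonicity and \<open>r k \<ge> K k\<close>
    together.\<close>
  define r where "r = rec_nat (K 0) (\<lambda>k m. Suc (max m (K (Suc k))))"
  have r: "r 0 = K 0" "\<And>k. r (Suc k) = Suc (max (r k) (K (Suc k)))" by (simp_all add: r_def)
  have "strict_mono r" by (rule strict_monoI_Suc) (simp add: r)
  moreover have ge: "r k \<ge> K k" for k by (cases k) (simp_all add: r)
  have "d (r (Suc k)) (r k) < (1/2)^k" for k
    using ge[of k] strict_mono_mono[OF \<open>strict_mono r\<close>] by (intro K) (auto simp: r)
  ultimately show ?thesis by (rule that)
qed

text \<open>Riesz-Fischer. Finiteness of the measure turns the summable \<open>L^2\<close> gaps of a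
  subsequence into summable \<open>L^1\<close> gaps, so the telescoping series converges absolutely
  almost everywhere.\<close>

theorem (in finite_measure) l2_complete:
  assumes f: "\<And>n. f n \<in> l2_space M"
    and cauchy: "\<And>e. e > 0 \<Longrightarrow> \<exists>K. \<forall>i\<ge>K. \<forall>j\<ge>K. l2_norm M (\<lambda>x. f i x - f j x) < e"
  obtains g where "g \<in> l2_space M" "(\<lambda>n. l2_norm M (\<lambda>x. f n x - g x)) \<longlonglongrightarrow> 0"
proof -
  note [measurable] = l2_spaceD(1)[OF f]
  obtain r where r: "strict_mono r"
    and gap: "\<And>k. l2_norm M (\<lambda>x. f (r (Suc k)) x - f (r k) x) < (1/2)^k"
    using subsequence_summable_gaps[OF cauchy] by blast
  define D where "D k x = \<bar>f (r (Suc k)) x - f (r k) x\<bar>" for k x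
  define C where "C = sqrt (measure M (space M))"
  have [measurable]: "D k \<in> borel_measurable M" for k unfolding D_def by measurable
  have D: "(\<integral>\<^sup>+x. ennreal (D k x) \<partial>M) \<le> ennreal (C * (1/2)^k)" for k
  proof -
    have d: "(\<lambda>x. f (r (Suc k)) x - f (r k) x) \<in> l2_space M" by (intro l2_diff f)
    have "(\<integral>\<^sup>+x. ennreal (D k x) \<partial>M) = ennreal (LINT x|M. D k x)"
      using integral_abs_le_l2_norm(1)[OF d] by (intro nn_integral_eq_integral) (auto simp: D_def)
    also have "\<dots> \<le> ennreal (C * (1/2)^k)"
      using order_trans[OF integral_abs_le_l2_norm(2)[OF d] mult_left_mono[OF less_imp_le[OF gap[of k]]]]
      by (simp add: D_def C_def)
    finally show ?thesis .
  qed
  have "(\<integral>\<^sup>+x. (\<Sum>k. ennreal (D k x)) \<partial>M) = (\<Sum>k. \<integral>\<^sup>+x. ennreal (D k x) \<partial>M)"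
    by (rule nn_integral_suminf) measurable
  also have "\<dots> \<le> (\<Sum>k. ennreal (C * (1/2)^k))" by (intro suminf_le D) auto
  also have "\<dots> = ennreal (\<Sum>k. C * (1/2)^k)"
    by (intro suminf_ennreal2 summable_mult) (auto simp: C_def)
  also have "\<dots> < \<infinity>" by simp
  finally have "AE x in M. (\<Sum>k. ennreal (D k x)) \<noteq> \<infinity>"
    by (intro nn_integral_noteq_infinite) auto
  then have conv: "AE x in M. (\<lambda>k. f (r k) x) \<longlonglongrightarrow> lim (\<lambda>k. f (r k) x)"
  proof eventually_elim
    case (elim x)
    have "summable (\<lambda>k. D k x)" by (rule summable_suminf_not_top) (use elim in \<open>auto simp: D_def\<close>)
    then have "summable (\<lambda>k. f (r (Suc k)) x - f (r k) x)"
      unfolding D_def by (rule summable_rabs_cancel)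
    then have "convergent (\<lambda>k. f (r k) x - f (r 0) x)"
      unfolding summable_iff_convergent sum_lessThan_telescope[of "\<lambda>k. f (r k) x"] .
    then have "convergent (\<lambda>k. f (r k) x - f (r 0) x + f (r 0) x)"
      by (intro convergent_add convergent_const)
    then have "convergent (\<lambda>k. f (r k) x)" by simp
    then show ?case by (simp add: convergent_LIMSEQ_iff)
  qed
  define g where "g x = lim (\<lambda>k. f (r k) x)" for x
  have [measurable]: "g \<in> borel_measurable M" unfolding g_def by measurable
  \<comment> \<open>Fatou along the subsequence with \<open>n\<close> fixed. The estimate holds for
    every \<open>n \<ge> K\<close> and not just for \<open>n\<close> in the subsequence, so the
    whole sequence converges.\<close>
  have bound: "(\<integral>\<^sup>+x. ennreal ((f n x - g x)\<^sup>2) \<partial>M) \<le> ennreal (e\<^sup>2)"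
    if "e > 0" "\<forall>i\<ge>K. \<forall>j\<ge>K. l2_norm M (\<lambda>x. f i x - f j x) < e" "n \<ge> K" for n e K
  proof -
    have "(\<integral>\<^sup>+x. ennreal ((f n x - g x)\<^sup>2) \<partial>M)
        = (\<integral>\<^sup>+x. liminf (\<lambda>k. ennreal ((f n x - f (r k) x)\<^sup>2)) \<partial>M)"
    proof (rule nn_integral_cong_AE, use conv in eventually_elim)
      case (elim x)
      then have "(\<lambda>k. ennreal ((f n x - f (r k) x)\<^sup>2)) \<longlonglongrightarrow> ennreal ((f n x - g x)\<^sup>2)"
        unfolding g_def by (intro tendsto_ennrealI tendsto_intros)
      then show ?case using lim_imp_Liminf trivial_limit_sequentially by fastforce
    qed
    also have "\<dots> \<le> liminf (\<lambda>k. \<integral>\<^sup>+x. ennreal ((f n x - f (r k) x)\<^sup>2) \<partial>M)"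
      by (rule nn_integral_liminf) measurable
    also have "\<dots> \<le> ennreal (e\<^sup>2)"
    proof -
      have "eventually (\<lambda>k. (\<integral>\<^sup>+x. ennreal ((f n x - f (r k) x)\<^sup>2) \<partial>M) \<le> ennreal (e\<^sup>2)) sequentially"
        unfolding eventually_sequentially
      proof (intro exI[of _ K] allI impI)
        fix k assume "k \<ge> K"
        then have "r k \<ge> K" using seq_suble[OF r, of k] by linarith
        then show "(\<integral>\<^sup>+x. ennreal ((f n x - f (r k) x)\<^sup>2) \<partial>M) \<le> ennreal (e\<^sup>2)"
          using that by (subst l2_norm_nn_integral) (auto intro!: l2_diff f ennreal_leI power_mono less_imp_le)
      qed
      then have "liminf (\<lambda>k. \<integral>\<^sup>+x. ennreal ((f n x - f (r k) x)\<^sup>2) \<partial>M) \<le> liminf (\<lambda>k. ennreal (e\<^sup>2))"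
        by (rule Liminf_mono)
      then show ?thesis by (simp add: Liminf_const)
    qed
    finally show ?thesis .
  qed
  have diff: "(\<lambda>x. f n x - g x) \<in> l2_space M" "l2_norm M (\<lambda>x. f n x - g x) \<le> e"
    if "e > 0" "\<forall>i\<ge>K. \<forall>j\<ge>K. l2_norm M (\<lambda>x. f i x - f j x) < e" "n \<ge> K" for n e K
    using l2_space_nn_integral[OF _ bound[OF that]] that by auto
  obtain K where "\<forall>i\<ge>K. \<forall>j\<ge>K. l2_norm M (\<lambda>x. f i x - f j x) < 1" using cauchy[of 1] by auto
  then have "(\<lambda>x. f K x - (f K x - g x)) \<in> l2_space M"
    by (intro l2_diff f diff(1)[of 1 K]) auto
  then have "g \<in> l2_space M" by simp
  moreover have "(\<lambda>n. l2_norm M (\<lambda>x. f n x - g x)) \<longlonglongrightarrow> 0"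
  proof (rule LIMSEQ_I)
    fix e :: real assume "e > 0"
    then obtain K where "\<forall>i\<ge>K. \<forall>j\<ge>K. l2_norm M (\<lambda>x. f i x - f j x) < e/2" using cauchy[of "e/2"] by auto
    then have "\<forall>n\<ge>K. norm (l2_norm M (\<lambda>x. f n x - g x) - 0) < e"
      using diff(2)[of "e/2" K] \<open>e > 0\<close> by fastforce
    then show "\<exists>no. \<forall>n\<ge>no. norm (l2_norm M (\<lambda>x. f n x - g x) - 0) < e" by blast
  qed
  ultimately show ?thesis by (rule that)
qed

section \<open>Eigenspaces of approximable operators\<close>

lemma underdetermined_system_nontrivial_solution:
  fixes a :: "nat \<Rightarrow> 'i \<Rightarrow> real"
  assumes "finite I" "m < card I"
  shows "\<exists>c. (\<exists>i\<in>I. c i \<noteq> 0) \<and> (\<forall>j<m. (\<Sum>i\<in>I. c i * a j i) = 0)"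
  using assms
proof (induction m arbitrary: I a)
  case 0
  then show ?case by (intro exI[of _ "\<lambda>_. 1"]) (auto simp: card_gt_0_iff)
next
  case (Suc m)
  show ?case
  proof (cases "\<forall>i\<in>I. a m i = 0")
    case True
    obtain c where "\<exists>i\<in>I. c i \<noteq> 0" "\<forall>j<m. (\<Sum>i\<in>I. c i * a j i) = 0"
      using Suc.IH[of I a] Suc.prems by auto
    with True show ?thesis by (intro exI[of _ c]) (auto simp: less_Suc_eq)
  next
    case False
    then obtain k where k: "k \<in> I" "a m k \<noteq> 0" by blast
    \<comment> \<open>Equation \<open>m\<close> is solved for the unknown \<open>k\<close> and
      substituted into the others. The reduced row \<open>m\<close> vanishes identically, and
      \<open>e\<close> below restores the eliminated unknown.\<close>
    define b where "b j i = a j i - a j k * a m i / a m k" for j i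
    have "m < card (I - {k})" using Suc.prems k by simp
    then obtain c where c: "\<exists>i\<in>I - {k}. c i \<noteq> 0" "\<And>j. j < m \<Longrightarrow> (\<Sum>i\<in>I - {k}. c i * b j i) = 0"
      using Suc.IH[of "I - {k}" b] Suc.prems by auto
    define e where "e i = (if i = k then - (\<Sum>i\<in>I - {k}. c i * a m i) / a m k else c i)" for i
    have split: "(\<Sum>i\<in>I. e i * a j i) = e k * a j k + (\<Sum>i\<in>I - {k}. c i * a j i)" for j
      using k Suc.prems by (subst sum.remove[of _ k]) (auto simp: e_def intro!: sum.cong)
    have "(\<Sum>i\<in>I - {k}. c i * b j i)
        = (\<Sum>i\<in>I - {k}. c i * a j i) - a j k / a m k * (\<Sum>i\<in>I - {k}. c i * a m i)" for j
      by (simp add: b_def right_diff_distrib sum_subtractf sum_distrib_left mult_ac)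
    then have "(\<Sum>i\<in>I. e i * a j i) = (\<Sum>i\<in>I - {k}. c i * b j i)" for j
      unfolding split by (simp add: e_def)
    moreover have "(\<Sum>i\<in>I - {k}. c i * b m i) = 0" using k by (simp add: b_def)
    ultimately have "\<forall>j<Suc m. (\<Sum>i\<in>I. e i * a j i) = 0"
      using c(2) by (auto simp: less_Suc_eq)
    moreover have "\<exists>i\<in>I. e i \<noteq> 0" using c(1) by (auto simp: e_def)
    ultimately show ?thesis by blast
  qed
qed

section \<open>Orthonormal systems and eigenspaces of an abstract operator\<close>

definition l2_orthonormal :: "'a measure \<Rightarrow> 'i set \<Rightarrow> ('i \<Rightarrow> 'a \<Rightarrow> real) \<Rightarrow> bool" where
  "l2_orthonormal M I v \<longleftrightarrow>
     (\<forall>i\<in>I. \<forall>j\<in>I. l2_inner M (v i) (v j) = (if i = j then 1 else 0))"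

lemma l2_orthonormal_norm_sum:
  assumes "finite I" "\<And>i. i \<in> I \<Longrightarrow> v i \<in> l2_space M" "l2_orthonormal M I v"
  shows "(l2_norm M (\<lambda>x. \<Sum>i\<in>I. c i * v i x))\<^sup>2 = (\<Sum>i\<in>I. (c i)\<^sup>2)"
    and "j \<in> I \<Longrightarrow> l2_inner M (\<lambda>x. \<Sum>i\<in>I. c i * v i x) (v j) = c j"
proof -
  let ?f = "\<lambda>x. \<Sum>i\<in>I. c i * v i x"
  have f: "?f \<in> l2_space M" by (intro l2_sum l2_scale assms)
  have inner: "l2_inner M ?f (v j) = c j" if "j \<in> I" for j
  proof -
    have "l2_inner M ?f (v j) = (\<Sum>i\<in>I. c i * l2_inner M (v i) (v j))"
      using assms that by (intro l2_inner_sum_left) auto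
    also have "\<dots> = (\<Sum>i\<in>I. if i = j then c i else 0)"
      using assms(3) that by (intro sum.cong) (auto simp: l2_orthonormal_def)
    finally show ?thesis using assms(1) that by simp
  qed
  then show "j \<in> I \<Longrightarrow> l2_inner M ?f (v j) = c j" .
  have "(l2_norm M ?f)\<^sup>2 = l2_inner M ?f ?f" by (simp add: l2_inner_self)
  also have "\<dots> = (\<Sum>i\<in>I. c i * l2_inner M (v i) ?f)"
    using assms f by (intro l2_inner_sum_left) auto
  also have "\<dots> = (\<Sum>i\<in>I. (c i)\<^sup>2)"
    using inner by (intro sum.cong) (auto simp: l2_inner_commute[of M _ ?f] power2_eq_square)
  finally show "(l2_norm M ?f)\<^sup>2 = (\<Sum>i\<in>I. (c i)\<^sup>2)" .
qed

text \<open>Linearity is asked for only almost everywhere: an integral operator is additive only at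
  times where the integrals concerned converge, since a divergent integral has the default value 0.
  Finiteness of \<open>N\<close> gives access to \<open>l2_complete\<close>.\<close>

locale l2_operator = N: finite_measure N
  for M :: "'a measure" and N :: "'b measure" and A :: "('a \<Rightarrow> real) \<Rightarrow> 'b \<Rightarrow> real" +
  assumes A_l2: "f \<in> l2_space M \<Longrightarrow> A f \<in> l2_space N"
    and A_lincomb: "f \<in> l2_space M \<Longrightarrow> g \<in> l2_space M \<Longrightarrow>
      AE t in N. A (\<lambda>x. a * f x + b * g x) t = a * A f t + b * A g t"
begin

abbreviation "E \<equiv> singular_eigenspace M N A"

lemma A_sum:
  assumes "finite I" "\<And>i. i \<in> I \<Longrightarrow> v i \<in> l2_space M"
  shows "AE t in N. A (\<lambda>x. \<Sum>i\<in>I. c i * v i x) t = (\<Sum>i\<in>I. c i * A (v i) t)"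
  using assms
proof (induction I rule: finite_induct)
  case empty
  have "(\<lambda>x. 0) \<in> l2_space M" by (simp add: l2_space_def)
  from A_lincomb[OF this this, of 0 0] show ?case by simp
next
  case (insert i I)
  let ?f = "\<lambda>x. \<Sum>i\<in>I. c i * v i x"
  have f: "?f \<in> l2_space M" using insert by (intro l2_sum l2_scale) auto
  have v: "v i \<in> l2_space M" using insert by simp
  have IH: "AE t in N. A ?f t = (\<Sum>i\<in>I. c i * A (v i) t)" using insert by simp
  show ?case using A_lincomb[OF v f, of "c i" 1] IH by eventually_elim (use insert in simp)
qed

lemma A_diff_norm:
  assumes "f \<in> l2_space M" "g \<in> l2_space M"
  shows "l2_norm N (\<lambda>t. A f t - A g t) = l2_norm N (A (\<lambda>x. f x - g x))"
proof (rule l2_norm_cong_AE)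
  show "AE t in N. A f t - A g t = A (\<lambda>x. f x - g x) t"
    using A_lincomb[OF assms, of 1 "-1"] by eventually_elim simp
qed (use assms in \<open>auto intro!: l2_spaceD(1)[OF l2_diff] l2_spaceD(1)[OF A_l2] l2_diff A_l2\<close>)

lemma A_lincomb_inner:
  assumes "f \<in> l2_space M" "g \<in> l2_space M" "k \<in> l2_space N"
  shows "l2_inner N (A (\<lambda>x. a * f x + b * g x)) k = l2_inner N (\<lambda>t. a * A f t + b * A g t) k"
  using assms by (intro l2_inner_cong_AE A_lincomb) (auto intro!: l2_spaceD(1) l2_lincomb A_l2)

lemma E_l2: "v \<in> E s \<Longrightarrow> v \<in> l2_space M"
  by (simp add: singular_eigenspace_def)

lemma E_inner:
  assumes "v \<in> E s" "f \<in> l2_space M"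
  shows "l2_inner N (A f) (A v) = s\<^sup>2 * l2_inner M f v"
  using assms by (simp add: singular_eigenspace_def l2_adjoint_def l2_inner_scale_right)

lemma E_I:
  assumes "v \<in> l2_space M"
    and "\<And>f. f \<in> l2_space M \<Longrightarrow> l2_inner N (A f) (A v) = s\<^sup>2 * l2_inner M f v"
  shows "v \<in> E s"
  using assms l2_scale[OF assms(1), of "s\<^sup>2"]
  by (simp add: singular_eigenspace_def l2_adjoint_def l2_inner_scale_right)

lemma E_lincomb:
  assumes "v \<in> E s" "w \<in> E s"
  shows "(\<lambda>x. a * v x + b * w x) \<in> E s"
proof (rule E_I)
  have v: "v \<in> l2_space M" "w \<in> l2_space M" using assms by (auto intro: E_l2)
  show "(\<lambda>x. a * v x + b * w x) \<in> l2_space M" by (intro l2_lincomb v)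
  fix f assume f: "f \<in> l2_space M"
  have "l2_inner N (A f) (A (\<lambda>x. a * v x + b * w x)) = l2_inner N (A (\<lambda>x. a * v x + b * w x)) (A f)"
    by (rule l2_inner_commute)
  also have "\<dots> = a * l2_inner N (A v) (A f) + b * l2_inner N (A w) (A f)"
    unfolding A_lincomb_inner[OF v A_l2[OF f]] by (intro l2_inner_lincomb_left A_l2 v f)
  also have "\<dots> = s\<^sup>2 * (a * l2_inner M f v + b * l2_inner M f w)"
    using E_inner[OF assms(1) f] E_inner[OF assms(2) f]
    by (simp add: l2_inner_commute[of N _ "A f"] algebra_simps)
  also have "\<dots> = s\<^sup>2 * l2_inner M f (\<lambda>x. a * v x + b * w x)"
    by (simp add: l2_inner_lincomb_right[OF v f])
  finally show "l2_inner N (A f) (A (\<lambda>x. a * v x + b * w x)) = s\<^sup>2 * l2_inner M f (\<lambda>x. a * v x + b * w x)" .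
qed

lemma E_sum:
  assumes "finite I" "\<And>i. i \<in> I \<Longrightarrow> v i \<in> E s"
  shows "(\<lambda>x. \<Sum>i\<in>I. c i * v i x) \<in> E s"
  using assms
proof (induction I rule: finite_induct)
  case empty
  have "(\<lambda>x. 0) \<in> l2_space M" by (simp add: l2_space_def)
  moreover from this have "AE t in N. A (\<lambda>x. 0) t = 0" using A_lincomb[of "\<lambda>x. 0" "\<lambda>x. 0" 0 0] by simp
  then have "l2_inner N (A f) (A (\<lambda>x. 0)) = 0" for f
    unfolding l2_inner_def by (intro integral_eq_zero_AE) auto
  ultimately show ?case by (intro E_I) (auto simp: l2_inner_def)
next
  case (insert i I)
  then have "(\<lambda>x. c i * v i x + 1 * (\<Sum>i\<in>I. c i * v i x)) \<in> E s" by (intro E_lincomb) auto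
  then show ?case using insert by simp
qed

lemma E_orthogonal:
  assumes "v \<in> E s" "w \<in> E r" "s > 0" "r > 0" "s \<noteq> r"
  shows "l2_inner M v w = 0"
proof -
  have "r\<^sup>2 * l2_inner M v w = s\<^sup>2 * l2_inner M v w"
    using E_inner[OF assms(1) E_l2[OF assms(2)]] E_inner[OF assms(2) E_l2[OF assms(1)]]
      l2_inner_commute[of N "A v" "A w"] l2_inner_commute[of M v w] by metis
  moreover have "r\<^sup>2 \<noteq> s\<^sup>2" using assms by (simp add: power2_eq_iff)
  ultimately show ?thesis by simp
qed

text \<open>The minimum principle on the span of eigenvectors, which gives the lower half of Eckart--Young.\<close>

lemma E_norm_lower_bound:
  assumes "finite I" "l2_orthonormal M I v" "\<And>i. i \<in> I \<Longrightarrow> v i \<in> E (s i)"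
    and "\<And>i. i \<in> I \<Longrightarrow> r \<le> s i" "0 \<le> r"
  shows "r * l2_norm M (\<lambda>x. \<Sum>i\<in>I. c i * v i x) \<le> l2_norm N (A (\<lambda>x. \<Sum>i\<in>I. c i * v i x))"
proof (rule power2_le_imp_le)
  let ?f = "\<lambda>x. \<Sum>i\<in>I. c i * v i x"
  have v: "v i \<in> l2_space M" if "i \<in> I" for i using assms(3) that by (auto intro: E_l2)
  have f: "?f \<in> l2_space M" by (intro l2_sum l2_scale v)
  have "(r * l2_norm M ?f)\<^sup>2 = (\<Sum>i\<in>I. r\<^sup>2 * (c i)\<^sup>2)"
    using l2_orthonormal_norm_sum(1)[OF assms(1) v assms(2)] by (simp add: power_mult_distrib sum_distrib_left)
  also have "\<dots> \<le> (\<Sum>i\<in>I. (s i)\<^sup>2 * (c i)\<^sup>2)"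
    using assms by (intro sum_mono mult_right_mono power_mono) auto
  also have "\<dots> = (\<Sum>i\<in>I. c i * l2_inner N (A (v i)) (A ?f))"
  proof (rule sum.cong)
    fix i assume i: "i \<in> I"
    have "l2_inner N (A (v i)) (A ?f) = l2_inner N (A ?f) (A (v i))" by (rule l2_inner_commute)
    also have "\<dots> = (s i)\<^sup>2 * c i"
      using E_inner[OF assms(3)[OF i] f] l2_orthonormal_norm_sum(2)[OF assms(1) v assms(2) i] by simp
    finally show "(s i)\<^sup>2 * (c i)\<^sup>2 = c i * l2_inner N (A (v i)) (A ?f)" by (simp add: power2_eq_square)
  qed simp
  also have "\<dots> = l2_inner N (\<lambda>t. \<Sum>i\<in>I. c i * A (v i) t) (A ?f)"
    by (intro l2_inner_sum_left[symmetric] A_l2 v f)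
  also have "\<dots> = l2_inner N (A ?f) (A ?f)"
    using A_sum[OF assms(1) v] by (intro l2_inner_cong_AE[symmetric])
      (auto intro!: l2_spaceD(1) l2_sum l2_scale A_l2 v)
  finally show "(r * l2_norm M ?f)\<^sup>2 \<le> (l2_norm N (A ?f))\<^sup>2" by (simp add: l2_inner_self)
qed simp

end

text \<open>In particular \<open>A\<close> has norm at most \<open>K n^-\<theta>\<close> on the
  common kernel of \<open>d * n\<close> bounded functionals. The constant \<open>B\<close> may
  depend on \<open>n\<close> in any way, as it does not influence the rate; it bounds the
  functionals and at the same time multiplies their sum.\<close>

locale approximable_operator = l2_operator +
  fixes d :: nat and K \<theta> :: real
  assumes d_pos: "1 \<le> d" and K_nonneg: "0 \<le> K" and theta_pos: "0 < \<theta>"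
    and approx: "1 \<le> n \<Longrightarrow> \<exists>l B. 0 \<le> B \<and>
      (\<forall>i<d*n. \<forall>f\<in>l2_space M. \<forall>g\<in>l2_space M. \<forall>a b.
          l i (\<lambda>x. a * f x + b * g x) = a * l i f + b * l i g) \<and>
      (\<forall>i<d*n. \<forall>f\<in>l2_space M. \<bar>l i f\<bar> \<le> B * l2_norm M f) \<and>
      (\<forall>f\<in>l2_space M. l2_norm N (A f) \<le>
          K * real n powr (-\<theta>) * l2_norm M f + B * (\<Sum>i<d*n. \<bar>l i f\<bar>))"
begin

section \<open>Counting orthonormal eigenvectors\<close>

lemma A_bounded: "\<exists>B\<ge>0. \<forall>f\<in>l2_space M. l2_norm N (A f) \<le> B * l2_norm M f"
proof -
  obtain l B where B: "0 \<le> B" "\<And>i f. i < d \<Longrightarrow> f \<in> l2_space M \<Longrightarrow> \<bar>l i f\<bar> \<le> B * l2_norm M f"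
    "\<And>f. f \<in> l2_space M \<Longrightarrow> l2_norm N (A f) \<le> K * l2_norm M f + B * (\<Sum>i<d. \<bar>l i f\<bar>)"
    using approx[of 1] by (simp only: order_refl simp_thms mult_1_right of_nat_1 powr_one_eq_one) metis
  have "l2_norm N (A f) \<le> (K + B * (d * B)) * l2_norm M f" if f: "f \<in> l2_space M" for f
  proof -
    have "(\<Sum>i<d. \<bar>l i f\<bar>) \<le> (\<Sum>i<d. B * l2_norm M f)" using B f by (intro sum_mono) auto
    then have "B * (\<Sum>i<d. \<bar>l i f\<bar>) \<le> B * (d * (B * l2_norm M f))" using B by (intro mult_left_mono) auto
    then show ?thesis using B(3)[OF f] by (simp add: algebra_simps)
  qed
  then show ?thesis using B K_nonneg by (intro exI[of _ "K + B * (d * B)"]) auto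
qed

text \<open>More than \<open>d * n\<close> eigenvectors span a space too large for the functionals,
  so some nonzero combination is annihilated by all of them. On it \<open>A\<close> stretches by at
  least \<open>r\<close> and by at most \<open>K n^-\<theta>\<close>.\<close>

lemma orthonormal_eigenvectors_bound_aux:
  assumes n: "1 \<le> n" "d * n < card I" and I: "finite I"
    and v: "l2_orthonormal M I v" "\<And>i. i \<in> I \<Longrightarrow> v i \<in> E (s i)"
    and s: "\<And>i. i \<in> I \<Longrightarrow> r \<le> s i" "0 \<le> r"
  shows "r \<le> K * real n powr (-\<theta>)"
proof -
  from approx[OF n(1)] obtain l B
    where l0: "\<forall>i<d*n. \<forall>f\<in>l2_space M. \<forall>g\<in>l2_space M. \<forall>a b.
          l i (\<lambda>x. a * f x + b * g x) = a * l i f + b * l i g"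
      and B0: "\<forall>f\<in>l2_space M. l2_norm N (A f) \<le>
          K * real n powr (-\<theta>) * l2_norm M f + B * (\<Sum>i<d*n. \<bar>l i f\<bar>)"
    by (elim exE conjE) (rule that)
  have l: "l i (\<lambda>x. a * f x + b * g x) = a * l i f + b * l i g"
    if "i < d * n" "f \<in> l2_space M" "g \<in> l2_space M" for i f g a b
    using l0 that by simp
  have B: "l2_norm N (A f) \<le> K * real n powr (-\<theta>) * l2_norm M f + B * (\<Sum>i<d*n. \<bar>l i f\<bar>)"
    if "f \<in> l2_space M" for f using B0 that by simp
  have vl: "v i \<in> l2_space M" if "i \<in> I" for i using v(2) that by (auto intro: E_l2)
  obtain c where c: "\<exists>i\<in>I. c i \<noteq> 0" "\<And>j. j < d * n \<Longrightarrow> (\<Sum>i\<in>I. c i * l j (v i)) = 0"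
    using underdetermined_system_nontrivial_solution[OF I n(2), of "\<lambda>j i. l j (v i)"] by auto
  have l_sum: "l j (\<lambda>x. \<Sum>i\<in>J. c i * v i x) = (\<Sum>i\<in>J. c i * l j (v i))"
    if j: "j < d * n" and J: "finite J" "J \<subseteq> I" for j J
    using J
  proof (induction J rule: finite_induct)
    case empty
    have "(\<lambda>x. 0) \<in> l2_space M" by (simp add: l2_space_def)
    from l[OF j this this, of 0 0] show ?case by simp
  next
    case (insert i J)
    have "(\<lambda>x. \<Sum>i\<in>J. c i * v i x) \<in> l2_space M" "v i \<in> l2_space M"
      using insert by (auto intro!: l2_sum l2_scale vl)
    then show ?case using insert l[OF j, of "v i" "\<lambda>x. \<Sum>i\<in>J. c i * v i x" "c i" 1] by simp
  qed
  let ?f = "\<lambda>x. \<Sum>i\<in>I. c i * v i x"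
  have f: "?f \<in> l2_space M" by (intro l2_sum l2_scale vl)
  have "l2_norm N (A ?f) \<le> K * real n powr (-\<theta>) * l2_norm M ?f"
    using B[OF f] l_sum[OF _ I order_refl] c(2) by simp
  moreover have "r * l2_norm M ?f \<le> l2_norm N (A ?f)"
    by (rule E_norm_lower_bound[OF I v s])
  moreover have "l2_norm M ?f > 0"
  proof -
    obtain i where "i \<in> I" "c i \<noteq> 0" using c by blast
    then have "0 < (\<Sum>i\<in>I. (c i)\<^sup>2)" using I by (intro sum_pos2[of _ i]) auto
    then have "0 < (l2_norm M ?f)\<^sup>2" using l2_orthonormal_norm_sum(1)[OF I vl v(1)] by simp
    then show ?thesis by (simp add: zero_less_power2 less_le)
  qed
  ultimately have "r * l2_norm M ?f \<le> (K * real n powr (-\<theta>)) * l2_norm M ?f" by linarith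
  with \<open>l2_norm M ?f > 0\<close> show ?thesis by (simp only: mult_le_cancel_right_pos)
qed

lemma orthonormal_eigenvectors_bound:
  obtains C where "0 \<le> C"
    and "\<And>(I::'i set) v s r. finite I \<Longrightarrow> I \<noteq> {} \<Longrightarrow> l2_orthonormal M I v \<Longrightarrow>
      (\<And>i. i \<in> I \<Longrightarrow> v i \<in> E (s i)) \<Longrightarrow> (\<And>i. i \<in> I \<Longrightarrow> r \<le> s i) \<Longrightarrow> 0 \<le> r \<Longrightarrow>
      r \<le> C * real (card I) powr (-\<theta>)"
proof -
  obtain B where B: "B \<ge> 0" "\<And>f. f \<in> l2_space M \<Longrightarrow> l2_norm N (A f) \<le> B * l2_norm M f"
    using A_bounded by blast
  \<comment> \<open>The factor \<open>(2 * d) powr \<theta>\<close> converts \<open>n\<close> to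
    \<open>card I\<close>: the largest \<open>n\<close> with \<open>d * n < card I\<close> satisfies
    \<open>card I \<le> 2 * d * n\<close>. If \<open>card I \<le> d\<close>, there is no such
    \<open>n \<ge> 1\<close>, and the operator bound \<open>B\<close> takes over.\<close>
  define C where "C = (K + B) * real (2 * d) powr \<theta>"
  have "r \<le> C * real (card I) powr (-\<theta>)"
    if I: "finite I" "I \<noteq> {}" and v: "l2_orthonormal M I v" "\<And>i. i \<in> I \<Longrightarrow> v i \<in> E (s i)"
      and s: "\<And>i. i \<in> I \<Longrightarrow> r \<le> s i" "0 \<le> r" for I :: "'i set" and v s r
  proof (cases "card I \<le> d")
    case True
    obtain i where i: "i \<in> I" using I by blast
    have card: "card I > 0" using I by (simp add: card_gt_0_iff)
    have vi: "v i \<in> l2_space M" using v(2) i by (auto intro: E_l2)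
    have "l2_norm M (v i) = 1" using v(1) i by (simp add: l2_orthonormal_def l2_norm_def)
    then have "r \<le> l2_norm N (A (v i))"
      using E_norm_lower_bound[of "{i}" v s r "\<lambda>_. 1"] v s i by (auto simp: l2_orthonormal_def)
    also have "\<dots> \<le> B" using B(2)[OF vi] \<open>l2_norm M (v i) = 1\<close> by simp
    also have "\<dots> \<le> (K + B) * 1" using K_nonneg by simp
    also have "\<dots> \<le> (K + B) * (real (2 * d) / real (card I)) powr \<theta>"
      using True card K_nonneg B(1) theta_pos by (intro mult_left_mono ge_one_powr_ge_zero) auto
    also have "\<dots> = C * real (card I) powr (-\<theta>)"
      using card by (simp add: C_def powr_divide powr_minus_divide)
    finally show ?thesis .
  next
    case False
    define n where "n = (card I - 1) div d"
    have n: "1 \<le> n"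
    proof -
      have "d div d \<le> (card I - 1) div d" using False by (intro div_le_mono) auto
      then show ?thesis using d_pos by (simp add: n_def)
    qed
    have "d * n \<le> card I - 1" by (simp add: n_def)
    then have lt: "d * n < card I" using False by simp
    have "card I - 1 < d * Suc n"
      unfolding n_def using d_pos by (metis dividend_less_times_div less_eq_Suc_le mult_Suc_right One_nat_def)
    then have "card I \<le> d * Suc n" by simp
    also have "\<dots> \<le> d * (2 * n)" using n by (intro mult_le_mono2) auto
    finally have "card I \<le> 2 * d * n" by simp
    then have le: "real (card I) / real (2 * d) \<le> real n"
      using d_pos by (simp add: divide_le_eq flip: of_nat_mult) (simp add: mult_ac)
    have "r \<le> K * real n powr (-\<theta>)"
      by (rule orthonormal_eigenvectors_bound_aux[OF n lt I(1) v s])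
    also have "\<dots> \<le> (K + B) * real n powr (-\<theta>)" using B(1) by (intro mult_right_mono) auto
    also have "\<dots> \<le> (K + B) * (real (card I) / real (2 * d)) powr (-\<theta>)"
      using le theta_pos B(1) K_nonneg False d_pos by (intro mult_left_mono powr_mono2') auto
    also have "\<dots> = C * real (card I) powr (-\<theta>)"
      using False d_pos by (simp add: C_def powr_divide powr_minus_divide)
    finally show ?thesis .
  qed
  moreover have "0 \<le> C" using B K_nonneg by (simp add: C_def)
  ultimately show ?thesis using that by blast
qed

end

text \<open>Here \<open>m s\<close> is the multiplicity of \<open>s > 0\<close> in a multiset of reals.\<close>

lemma ex_decreasing_enumeration:
  fixes m :: "real \<Rightarrow> nat"
  assumes fin: "\<And>e. e > 0 \<Longrightarrow> finite {s. e \<le> s \<and> m s > 0}"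
  obtains \<sigma> :: "nat \<Rightarrow> real" where "\<And>n. 1 \<le> n \<Longrightarrow> 0 \<le> \<sigma> n \<and> \<sigma> (Suc n) \<le> \<sigma> n"
    and "\<And>s. s > 0 \<Longrightarrow> finite {n. 1 \<le> n \<and> \<sigma> n = s} \<and> card {n. 1 \<le> n \<and> \<sigma> n = s} = m s"
proof -
  \<comment> \<open>\<open>c x\<close> counts the elements that are at least \<open>x\<close>, and
    \<open>\<sigma>\<close> is its generalised inverse: \<open>\<sigma> n\<close> is the largest
    positive \<open>x\<close> with \<open>n \<le> c x\<close>. The 0 inserted into
    \<open>X n\<close> produces the trailing zeros.\<close>
  define c where "c x = (\<Sum>s\<in>{s. x \<le> s \<and> m s > 0}. m s)" for x
  define X where "X n = insert 0 {x. x > 0 \<and> n \<le> c x}" for n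
  define \<sigma> where "\<sigma> n = Sup (X n)" for n
  have anti: "c y \<le> c x" if "0 < x" "x \<le> y" for x y
    unfolding c_def using that fin by (intro sum_mono2) auto
  obtain b where b: "\<And>x. x > b \<Longrightarrow> c x = 0" "b \<ge> 1"
  proof -
    let ?S = "{s. 1 \<le> s \<and> m s > 0}"
    have "finite ?S" by (rule fin) simp
    then have "c x = 0" if "x > Max (insert 1 ?S)" for x
    proof -
      have m: "s \<le> Max (insert 1 ?S)" if "s \<in> insert 1 ?S" for s
        using that \<open>finite ?S\<close> by (intro Max_ge) auto
      have "\<not> (x \<le> s \<and> m s > 0)" for s
      proof
        assume "x \<le> s \<and> m s > 0"
        then show False using that m[of 1] m[of s] by simp
      qed
      then have "{s. x \<le> s \<and> m s > 0} = {}" by blast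
      then show ?thesis unfolding c_def by simp
    qed
    moreover have "Max (insert 1 ?S) \<ge> 1" using \<open>finite ?S\<close> by (intro Max_ge) auto
    ultimately show ?thesis using that by blast
  qed
  have bdd: "bdd_above (X n)" if "1 \<le> n" for n
  proof (rule bdd_aboveI)
    show "x \<le> b" if "x \<in> X n" for x
      using that b \<open>1 \<le> n\<close> unfolding X_def by (cases "x > b") auto
  qed
  have nonneg: "0 \<le> \<sigma> n" if "1 \<le> n" for n
    unfolding \<sigma>_def by (intro cSup_upper bdd that) (simp add: X_def)
  have le_iff: "s \<le> \<sigma> n \<longleftrightarrow> n \<le> c s" if s: "s > 0" and n: "1 \<le> n" for s n
  proof
    assume "n \<le> c s"
    then show "s \<le> \<sigma> n" unfolding \<sigma>_def using s by (intro cSup_upper bdd n) (simp add: X_def)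
  next
    assume le: "s \<le> \<sigma> n"
    show "n \<le> c s"
    proof (rule ccontr)
      assume neg: "\<not> n \<le> c s"
      let ?S = "{r. s / 2 \<le> r \<and> m r > 0} \<inter> {r. r < s}"
      \<comment> \<open>\<open>t\<close> is the largest element in \<open>[s / 2, s)\<close>, or
        \<open>s / 2\<close> if there is none, so \<open>c\<close> is constant on
        \<open>{t<..s}\<close>. By this left continuity of \<open>c\<close> the supremum is
        attained.\<close>
      define t where "t = Max (insert (s / 2) ?S)"
      have f: "finite ?S" using fin[of "s / 2"] s by simp
      have t: "t < s" "t > 0" unfolding t_def using f s by (auto simp: Max_gr_iff)
      have c: "c x = c s" if "t < x" "x \<le> s" for x
      proof -
        have "{r. x \<le> r \<and> m r > 0} = {r. s \<le> r \<and> m r > 0}"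
        proof (intro set_eqI iffI)
          fix r assume r: "r \<in> {r. x \<le> r \<and> m r > 0}"
          have "s \<le> r"
          proof (rule ccontr)
            assume "\<not> s \<le> r"
            moreover have "s / 2 \<le> t" unfolding t_def using f by (intro Max_ge) auto
            ultimately have "r \<in> ?S" using r that by auto
            then have "r \<le> t" unfolding t_def using f by (intro Max_ge) auto
            with r that show False by auto
          qed
          with r show "r \<in> {r. s \<le> r \<and> m r > 0}" by simp
        qed (use that in auto)
        then show ?thesis by (simp add: c_def)
      qed
      have "x \<le> t" if "x \<in> X n" for x
      proof (rule ccontr)
        assume "\<not> x \<le> t"
        then have x: "n \<le> c x" "t < x" "x > 0" using that t unfolding X_def by auto
        show False
        proof (cases "x \<le> s")
          case True
          with x have "c x = c s" by (intro c)
          with x neg show False by linarith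
        next
          case False
          with s have "c x \<le> c s" by (intro anti) auto
          with x neg show False by linarith
        qed
      qed
      then have "\<sigma> n \<le> t" unfolding \<sigma>_def by (intro cSup_least) (auto simp: X_def)
      with le t show False by simp
    qed
  qed
  have fib: "{n. 1 \<le> n \<and> \<sigma> n = s} = {c s - m s<..c s}" if s: "s > 0" for s
  proof -
    let ?S = "{r. s \<le> r \<and> m r > 0} - {s}"
    \<comment> \<open>Right of \<open>s\<close> and up to the next larger element, \<open>c\<close>
      has already dropped by the multiplicity of \<open>s\<close>. The value \<open>s + 1\<close>
      keeps the minimum defined if there is no larger element.\<close>
    define t where "t = Min (insert (s + 1) ?S)"
    have f: "finite ?S" using fin[of s] s by simp
    have t: "s < t" unfolding t_def using f by (auto simp: Min_gr_iff)
    have c: "c x = c s - m s" if "s < x" "x \<le> t" for x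
    proof -
      have "{r. x \<le> r \<and> m r > 0} = ?S"
      proof (intro set_eqI iffI)
        fix r assume r: "r \<in> ?S"
        then have "t \<le> r" unfolding t_def using f by (intro Min_le) auto
        with r that show "r \<in> {r. x \<le> r \<and> m r > 0}" by auto
      qed (use that in auto)
      moreover have "c s = m s + (\<Sum>r\<in>?S. m r)"
      proof (cases "m s > 0")
        case True
        then show ?thesis unfolding c_def using fin[OF s] by (subst sum.remove[of _ s]) auto
      next
        case False
        then have "{r. s \<le> r \<and> m r > 0} = ?S" by auto
        then show ?thesis using False unfolding c_def by simp
      qed
      ultimately show ?thesis by (simp add: c_def)
    qed
    have gt_iff: "\<sigma> n > s \<longleftrightarrow> n \<le> c s - m s" if n: "1 \<le> n" for n
    proof
      assume gt: "\<sigma> n > s"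
      have "min t (\<sigma> n) \<le> \<sigma> n" "0 < min t (\<sigma> n)" using s t gt by auto
      then have "n \<le> c (min t (\<sigma> n))" using le_iff n by blast
      then show "n \<le> c s - m s" using c[of "min t (\<sigma> n)"] t gt by simp
    next
      assume "n \<le> c s - m s"
      then show "\<sigma> n > s" using c[of t] t le_iff[of t n] s n by auto
    qed
    show ?thesis
    proof (rule set_eqI)
      fix n
      have "(1 \<le> n \<and> \<sigma> n = s) \<longleftrightarrow> (1 \<le> n \<and> s \<le> \<sigma> n \<and> \<not> \<sigma> n > s)" by auto
      also have "\<dots> \<longleftrightarrow> (1 \<le> n \<and> n \<le> c s \<and> \<not> n \<le> c s - m s)"
        using le_iff[OF s, of n] gt_iff[of n] by blast
      also have "\<dots> \<longleftrightarrow> n \<in> {c s - m s<..c s}" by auto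
      finally show "n \<in> {n. 1 \<le> n \<and> \<sigma> n = s} \<longleftrightarrow> n \<in> {c s - m s<..c s}" by simp
    qed
  qed
  have "m s \<le> c s" if "s > 0" for s
  proof (cases "m s > 0")
    case True
    then show ?thesis unfolding c_def using fin[OF that] by (intro member_le_sum) auto
  qed simp
  moreover have "\<sigma> (Suc n) \<le> \<sigma> n" if "1 \<le> n" for n
    unfolding \<sigma>_def using bdd[OF that] by (intro cSup_subset_mono) (auto simp: X_def)
  ultimately show ?thesis using that[of \<sigma>] nonneg fib by simp
qed

lemma l2_normalize_AE_zero:
  assumes "f \<in> l2_space M" "\<not> (AE x in M. f x = 0)"
  shows "l2_norm M f > 0"
  using l2_norm_eq_0_AE[OF assms(1)] assms(2) by (metis l2_norm_nonneg order_le_less)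

section \<open>Existence and decay of singular values, and compactness\<close>

context approximable_operator
begin

text \<open>The decay estimate solved for the number of eigenvectors. With a constant
  \<open>s\<close> it bounds a multiplicity; with distinct values it bounds the number of singular
  values that are at least \<open>r\<close>.\<close>

lemma card_orthonormal_eigenvectors:
  assumes "r > 0"
  obtains B :: nat where "\<And>(I::'i set) v s. finite I \<Longrightarrow> l2_orthonormal M I v \<Longrightarrow>
      (\<And>i. i \<in> I \<Longrightarrow> v i \<in> E (s i)) \<Longrightarrow> (\<And>i. i \<in> I \<Longrightarrow> r \<le> s i) \<Longrightarrow> card I \<le> B"
proof -
  obtain C where C: "0 \<le> C"
    "\<And>(I::'i set) v s r. finite I \<Longrightarrow> I \<noteq> {} \<Longrightarrow> l2_orthonormal M I v \<Longrightarrow>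
      (\<And>i. i \<in> I \<Longrightarrow> v i \<in> E (s i)) \<Longrightarrow> (\<And>i. i \<in> I \<Longrightarrow> r \<le> s i) \<Longrightarrow> 0 \<le> r \<Longrightarrow>
      r \<le> C * real (card I) powr (-\<theta>)"
    using orthonormal_eigenvectors_bound[where 'i = 'i] by blast
  have "card I \<le> nat \<lceil>(C / r) powr (1 / \<theta>)\<rceil>"
    if I: "finite I" "l2_orthonormal M I v" "\<And>i. i \<in> I \<Longrightarrow> v i \<in> E (s i)" "\<And>i. i \<in> I \<Longrightarrow> r \<le> s i"
    for I :: "'i set" and v s
  proof (cases "I = {}")
    case False
    then have card: "real (card I) > 0" using I(1) by (simp add: card_gt_0_iff)
    have "r \<le> C * real (card I) powr (-\<theta>)" using C(2)[OF I(1) False I(2-4)] assms by simp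
    then have "real (card I) powr \<theta> \<le> C / r"
      using assms card by (simp add: powr_minus_divide field_simps)
    then have "(real (card I) powr \<theta>) powr (1 / \<theta>) \<le> (C / r) powr (1 / \<theta>)"
      using theta_pos by (intro powr_mono2) auto
    then show ?thesis using theta_pos card by (simp add: powr_powr) linarith
  qed simp
  then show ?thesis using that by blast
qed

text \<open>The sizes of orthonormal families in the eigenspace are bounded, so there is one of
  maximal size. It is a basis: otherwise the residual of some \<open>w\<close>, divided by its norm,
  would extend it.\<close>

lemma eigenspace_basis:
  assumes s: "s > 0"
  obtains m :: nat and v where "l2_finite_orthonormal_basis M {..<m} v (E s)"
proof -
  obtain B where B: "\<And>(I::nat set) v s'. finite I \<Longrightarrow> l2_orthonormal M I v \<Longrightarrow>
      (\<And>i. i \<in> I \<Longrightarrow> v i \<in> E (s' i)) \<Longrightarrow> (\<And>i. i \<in> I \<Longrightarrow> s \<le> s' i) \<Longrightarrow> card I \<le> B"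
    using card_orthonormal_eigenvectors[where 'i = nat, OF s] by blast
  define P where "P m \<longleftrightarrow> (\<exists>v. l2_orthonormal M {..<m} v \<and> (\<forall>i<m. v i \<in> E s))" for m :: nat
  have bound: "m \<le> B" if Pm: "P m" for m
  proof -
    obtain v where v: "l2_orthonormal M {..<m} v" "\<forall>i<m. v i \<in> E s" using Pm P_def by blast
    then show ?thesis using B[of "{..<m}" v "\<lambda>_. s"] by simp
  qed
  have "P 0" by (simp add: P_def l2_orthonormal_def)
  define m where "m = (GREATEST m. P m)"
  have "P m" unfolding m_def by (rule GreatestI_nat[where P = P, OF \<open>P 0\<close>]) (use bound in blast)
  have max: "k \<le> m" if "P k" for k
    unfolding m_def by (rule Greatest_le_nat[where P = P, OF that]) (use bound in blast)
  obtain v where v: "l2_orthonormal M {..<m} v" "\<And>i. i < m \<Longrightarrow> v i \<in> E s"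
    using \<open>P m\<close> P_def by blast
  have "AE x in M. w x = (\<Sum>j<m. l2_inner M w (v j) * v j x)" if w: "w \<in> E s" for w
  proof (rule ccontr)
    assume not: "\<not> ?thesis"
    let ?p = "\<lambda>x. \<Sum>j<m. l2_inner M w (v j) * v j x"
    let ?u = "\<lambda>x. 1 * w x + (- 1) * ?p x"
    have p: "?p \<in> E s" by (intro E_sum v) auto
    have uE: "?u \<in> E s" by (intro E_lincomb w p)
    have u: "?u \<in> l2_space M" by (rule E_l2[OF uE])
    have "\<not> (AE x in M. ?u x = 0)" using not by simp
    then have pos: "l2_norm M ?u > 0" by (rule l2_normalize_AE_zero[OF u])
    have orth: "l2_inner M ?u (v j) = 0" if "j < m" for j
    proof -
      have "l2_inner M ?u (v j) = 1 * l2_inner M w (v j) + (-1) * l2_inner M ?p (v j)"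
        using E_l2[OF w] E_l2[OF p] E_l2[OF v(2)[OF that]] by (rule l2_inner_lincomb_left)
      also have "l2_inner M ?p (v j) = l2_inner M w (v j)"
        by (rule l2_orthonormal_norm_sum(2)[OF _ _ v(1)]) (use v E_l2 that in auto)
      finally show ?thesis by simp
    qed
    let ?c = "1 / l2_norm M ?u"
    define e where "e x = ?c * ?u x" for x
    have eE: "e \<in> E s"
    proof -
      have "(\<lambda>x. ?c * ?u x + 0 * ?u x) \<in> E s" by (rule E_lincomb[OF uE uE])
      moreover have "(\<lambda>x. ?c * ?u x + 0 * ?u x) = e" by (simp add: e_def fun_eq_iff)
      ultimately show ?thesis by simp
    qed
    have "l2_norm M e = 1"
      using l2_norm_scale[of M ?c ?u] pos by (simp add: e_def[abs_def])
    then have ee: "l2_inner M e e = 1" by (simp add: l2_inner_self)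
    have ev: "l2_inner M (v j) e = 0" if "j < m" for j
      using l2_inner_scale_right[of M "v j" ?c ?u] orth[OF that] l2_inner_commute[of M "v j" ?u]
      by (simp add: e_def[abs_def])
    have ve: "l2_inner M e (v j) = 0" if "j < m" for j
      using ev[OF that] l2_inner_commute[of M e "v j"] by simp
    have "l2_orthonormal M {..<Suc m} (v(m := e))"
      using v(1) ee ev ve unfolding l2_orthonormal_def by (auto simp: less_Suc_eq)
    moreover have "\<forall>i<Suc m. (v(m := e)) i \<in> E s" using v eE by (auto simp: less_Suc_eq)
    ultimately have "P (Suc m)" unfolding P_def by blast
    then show False using max[of "Suc m"] by simp
  qed
  then have "l2_finite_orthonormal_basis M {..<m} v (E s)"
    using v by (auto simp: l2_finite_orthonormal_basis_def l2_orthonormal_def)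
  then show ?thesis by (rule that)
qed

text \<open>The multiplicities are the dimensions of the eigenspaces. Only finitely many values are
  at least \<open>e > 0\<close>: one unit vector from each eigenspace gives an orthonormal family,
  whose size is bounded. The bases are then transported to the index sets of the enumeration by
  bijections.\<close>

lemma ex_singular_value_sequence: "\<exists>\<sigma>. singular_value_sequence M N A \<sigma>"
proof -
  have "\<forall>s. \<exists>(m::nat) v. s > 0 \<longrightarrow> l2_finite_orthonormal_basis M {..<m} v (E s)"
    using eigenspace_basis by metis
  then obtain m :: "real \<Rightarrow> nat" and v
    where basis: "\<And>s. s > 0 \<Longrightarrow> l2_finite_orthonormal_basis M {..<m s} (v s) (E s)"
    by metis
  have "finite {s. e \<le> s \<and> m s > 0}" if e: "e > 0" for e
  proof (rule ccontr)
    assume inf: "infinite {s. e \<le> s \<and> m s > 0}"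
    obtain B where B: "\<And>(I::real set) v s. finite I \<Longrightarrow> l2_orthonormal M I v \<Longrightarrow>
      (\<And>i. i \<in> I \<Longrightarrow> v i \<in> E (s i)) \<Longrightarrow> (\<And>i. i \<in> I \<Longrightarrow> e \<le> s i) \<Longrightarrow> card I \<le> B"
      using card_orthonormal_eigenvectors[where 'i = real, OF e] by blast
    obtain I where I: "finite I" "card I = Suc B" "I \<subseteq> {s. e \<le> s \<and> m s > 0}"
      using infinite_arbitrarily_large[OF inf] by blast
    have v0: "v s 0 \<in> E s" "l2_inner M (v s 0) (v s 0) = 1" if "s \<in> I" for s
      using basis[of s] I that e by (auto simp: l2_finite_orthonormal_basis_def)
    have "l2_orthonormal M I (\<lambda>s. v s 0)"
      unfolding l2_orthonormal_def
    proof (intro ballI)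
      fix i j assume ij: "i \<in> I" "j \<in> I"
      then have "i > 0" "j > 0" using I e by auto
      then show "l2_inner M (v i 0) (v j 0) = (if i = j then 1 else 0)"
        using v0 ij E_orthogonal[of "v i 0" i "v j 0" j] by auto
    qed
    then have "card I \<le> B" using I v0 by (intro B[of I "\<lambda>s. v s 0" "\<lambda>s. s"]) auto
    with I show False by simp
  qed
  then obtain \<sigma> :: "nat \<Rightarrow> real" where \<sigma>: "\<And>n. 1 \<le> n \<Longrightarrow> 0 \<le> \<sigma> n \<and> \<sigma> (Suc n) \<le> \<sigma> n"
    and fib: "\<And>s. s > 0 \<Longrightarrow> finite {n. 1 \<le> n \<and> \<sigma> n = s} \<and> card {n. 1 \<le> n \<and> \<sigma> n = s} = m s"
    using ex_decreasing_enumeration[of m] by blast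
  have "\<exists>w. l2_finite_orthonormal_basis M {n. 1 \<le> n \<and> \<sigma> n = s} w (E s)" if s: "s > 0" for s
  proof -
    let ?J = "{n. 1 \<le> n \<and> \<sigma> n = s}"
    have "finite ?J" "card ?J = card {..<m s}" using fib[OF s] by auto
    then obtain f where f: "bij_betw f ?J {..<m s}" using finite_same_card_bij by blast
    have fJ: "f j < m s" if "j \<in> ?J" for j using bij_betwE[OF f] that by auto
    have inj: "f i = f j \<longleftrightarrow> i = j" if "i \<in> ?J" "j \<in> ?J" for i j
      using inj_on_eq_iff[OF bij_betw_imp_inj_on[OF f] that] .
    have "(\<Sum>j\<in>?J. l2_inner M w (v s (f j)) * v s (f j) x) = (\<Sum>j<m s. l2_inner M w (v s j) * v s j x)"
      for w x by (rule sum.reindex_bij_betw[OF f])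
    then have "l2_finite_orthonormal_basis M ?J (\<lambda>j. v s (f j)) (E s)"
      using basis[OF s] \<open>finite ?J\<close> fJ inj unfolding l2_finite_orthonormal_basis_def by auto
    then show ?thesis by blast
  qed
  then show ?thesis using \<sigma> by (auto simp: singular_value_sequence_def)
qed

text \<open>The vectors \<open>w k\<close> with \<open>k \<le> n\<close> form an orthonormal family
  of size \<open>n\<close> whose singular values are all at least \<open>\<sigma> n\<close>: equal
  values draw from one basis, different values from orthogonal eigenspaces.\<close>

lemma singular_value_decay:
  obtains C where "\<And>\<sigma> n. singular_value_sequence M N A \<sigma> \<Longrightarrow> 1 \<le> n \<Longrightarrow> \<sigma> n \<le> C * real n powr (-\<theta>)"
proof -
  obtain C where C: "0 \<le> C"
    "\<And>(I::nat set) v s r. finite I \<Longrightarrow> I \<noteq> {} \<Longrightarrow> l2_orthonormal M I v \<Longrightarrow>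
      (\<And>i. i \<in> I \<Longrightarrow> v i \<in> E (s i)) \<Longrightarrow> (\<And>i. i \<in> I \<Longrightarrow> r \<le> s i) \<Longrightarrow> 0 \<le> r \<Longrightarrow>
      r \<le> C * real (card I) powr (-\<theta>)"
    using orthonormal_eigenvectors_bound[where 'i = nat] by blast
  have "\<sigma> n \<le> C * real n powr (-\<theta>)"
    if sv: "singular_value_sequence M N A \<sigma>" and n: "1 \<le> n" for \<sigma> n
  proof (cases "\<sigma> n > 0")
    case False
    then have "\<sigma> n \<le> 0" by simp
    also have "0 \<le> C * real n powr (-\<theta>)" using C by simp
    finally show ?thesis .
  next
    case True
    have mono: "\<sigma> n \<le> \<sigma> k" if "1 \<le> k" "k \<le> n" for k
      using that(2,1)
    proof (induction rule: inc_induct)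
      case (step i)
      then show ?case using sv by (force simp: singular_value_sequence_def)
    qed simp
    have "\<exists>v. \<forall>s>0. l2_finite_orthonormal_basis M {n. 1 \<le> n \<and> \<sigma> n = s} (v s) (E s)"
      using sv unfolding singular_value_sequence_def by metis
    then obtain v where
      basis: "\<And>s. s > 0 \<Longrightarrow> l2_finite_orthonormal_basis M {n. 1 \<le> n \<and> \<sigma> n = s} (v s) (E s)"
      by blast
    define w where "w k = v (\<sigma> k) k" for k
    have pos: "\<sigma> k > 0" if "k \<in> {1..n}" for k using mono[of k] True that by auto
    have wE: "w k \<in> E (\<sigma> k)" if "k \<in> {1..n}" for k
      using basis[OF pos[OF that]] that unfolding l2_finite_orthonormal_basis_def w_def by auto
    have "l2_orthonormal M {1..n} w"
      unfolding l2_orthonormal_def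
    proof (intro ballI)
      fix i j assume ij: "i \<in> {1..n}" "j \<in> {1..n}"
      show "l2_inner M (w i) (w j) = (if i = j then 1 else 0)"
      proof (cases "\<sigma> i = \<sigma> j")
        case True
        then show ?thesis using basis[OF pos[OF ij(1)]] ij
          unfolding l2_finite_orthonormal_basis_def w_def by auto
      next
        case False
        then show ?thesis using E_orthogonal[OF wE[OF ij(1)] wE[OF ij(2)] pos[OF ij(1)] pos[OF ij(2)]] by auto
      qed
    qed
    then have "\<sigma> n \<le> C * real (card {1..n}) powr (-\<theta>)"
      using wE mono n True by (intro C(2)[of "{1..n}" w \<sigma>]) auto
    then show ?thesis by simp
  qed
  then show ?thesis using that by blast
qed

text \<open>A diagonal selection makes all the countably many functionals, for all \<open>n\<close>,
  converge along one subsequence. The images are then Cauchy: \<open>n\<close> is fixed first to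
  make the \<open>K n^-\<theta>\<close> part small, after which only finitely many functionals
  remain.\<close>

lemma compact_operator: "l2_compact_operator M N A"
  unfolding l2_compact_operator_def
proof (intro conjI ballI allI impI)
  show "A f \<in> l2_space N" if "f \<in> l2_space M" for f using A_l2[OF that] .
  show "AE t in N. A (\<lambda>x. a * f x + b * g x) t = a * A f t + b * A g t"
    if "f \<in> l2_space M" "g \<in> l2_space M" for f g a b using A_lincomb[OF that] .
  fix f :: "nat \<Rightarrow> 'a \<Rightarrow> real"
  assume "(\<forall>n. f n \<in> l2_space M) \<and> (\<exists>B. \<forall>n. l2_norm M (f n) \<le> B)"
  then obtain R where f: "\<And>n. f n \<in> l2_space M" and R: "\<And>n. l2_norm M (f n) \<le> R" by blast
  have R0: "0 \<le> R" using R[of 0] l2_norm_nonneg[of M "f 0"] by linarith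
  have "\<forall>n. \<exists>l B. 0 \<le> B \<and>
      (\<forall>i<d*Suc n. \<forall>f\<in>l2_space M. \<forall>g\<in>l2_space M. \<forall>a b.
          l i (\<lambda>x. a * f x + b * g x) = a * l i f + b * l i g) \<and>
      (\<forall>i<d*Suc n. \<forall>f\<in>l2_space M. \<bar>l i f\<bar> \<le> B * l2_norm M f) \<and>
      (\<forall>f\<in>l2_space M. l2_norm N (A f) \<le>
          K * real (Suc n) powr (-\<theta>) * l2_norm M f + B * (\<Sum>i<d*Suc n. \<bar>l i f\<bar>))"
    by (intro allI approx) simp
  from choice[OF this] obtain l where "\<forall>n. \<exists>B. 0 \<le> B \<and>
      (\<forall>i<d*Suc n. \<forall>f\<in>l2_space M. \<forall>g\<in>l2_space M. \<forall>a b.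
          l n i (\<lambda>x. a * f x + b * g x) = a * l n i f + b * l n i g) \<and>
      (\<forall>i<d*Suc n. \<forall>f\<in>l2_space M. \<bar>l n i f\<bar> \<le> B * l2_norm M f) \<and>
      (\<forall>f\<in>l2_space M. l2_norm N (A f) \<le>
          K * real (Suc n) powr (-\<theta>) * l2_norm M f + B * (\<Sum>i<d*Suc n. \<bar>l n i f\<bar>))" ..
  from choice[OF this] obtain B where all: "\<forall>n. 0 \<le> B n \<and>
      (\<forall>i<d*Suc n. \<forall>f\<in>l2_space M. \<forall>g\<in>l2_space M. \<forall>a b.
          l n i (\<lambda>x. a * f x + b * g x) = a * l n i f + b * l n i g) \<and>
      (\<forall>i<d*Suc n. \<forall>f\<in>l2_space M. \<bar>l n i f\<bar> \<le> B n * l2_norm M f) \<and>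
      (\<forall>f\<in>l2_space M. l2_norm N (A f) \<le>
          K * real (Suc n) powr (-\<theta>) * l2_norm M f + B n * (\<Sum>i<d*Suc n. \<bar>l n i f\<bar>))" ..
  have B0: "0 \<le> B n" for n using all by blast
  have l: "l n i (\<lambda>x. a * f x + b * g x) = a * l n i f + b * l n i g"
    if "i < d * Suc n" "f \<in> l2_space M" "g \<in> l2_space M" for n i f g a b using all that by blast
  have lB: "\<bar>l n i f\<bar> \<le> B n * l2_norm M f" if "i < d * Suc n" "f \<in> l2_space M" for n i f
    using all that by blast
  have AB: "l2_norm N (A f) \<le>
          K * real (Suc n) powr (-\<theta>) * l2_norm M f + B n * (\<Sum>i<d*Suc n. \<bar>l n i f\<bar>)"
    if "f \<in> l2_space M" for n f using all that by blast
  define S where "S = (SIGMA n:UNIV. {..<d * Suc n})"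
  \<comment> \<open>Scaled so that all values lie in \<open>[-1, 1]\<close>, as the selection
    principle asks for a common bound; the 1 in the denominator excludes division by zero.\<close>
  define F where "F k p = l (fst p) (snd p) (f k) / (B (fst p) * R + 1)" for k p
  have den: "B n * R + 1 > 0" for n using B0[of n] R0 by (simp add: add_nonneg_pos)
  have F: "norm (F k p) \<le> 1" if "p \<in> S" for k p
  proof -
    have "\<bar>l (fst p) (snd p) (f k)\<bar> \<le> B (fst p) * l2_norm M (f k)"
      using that f by (intro lB) (auto simp: S_def)
    also have "\<dots> \<le> B (fst p) * R" using R B0 by (intro mult_left_mono) auto
    finally show ?thesis using den[of "fst p"] by (simp add: F_def divide_le_eq abs_divide)
  qed
  then obtain r where r: "strict_mono (r :: nat \<Rightarrow> nat)"
    and conv: "\<And>p. p \<in> S \<Longrightarrow> \<exists>x. (\<lambda>k. F (r k) p) \<longlonglongrightarrow> x"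
    using function_convergent_subsequence[of S F 1, OF countableI_type F] by blast
  have lconv: "Cauchy (\<lambda>k. l n i (f (r k)))" if i: "i < d * Suc n" for n i
  proof -
    obtain x where "(\<lambda>k. F (r k) (n, i)) \<longlonglongrightarrow> x" using conv[of "(n, i)"] i by (auto simp: S_def)
    then have "(\<lambda>k. (B n * R + 1) * F (r k) (n, i)) \<longlonglongrightarrow> (B n * R + 1) * x" by (intro tendsto_intros)
    then have "(\<lambda>k. l n i (f (r k))) \<longlonglongrightarrow> (B n * R + 1) * x"
      using den[of n] by (simp add: F_def)
    then show ?thesis by (rule LIMSEQ_imp_Cauchy)
  qed
  have "\<exists>k0. \<forall>i\<ge>k0. \<forall>j\<ge>k0. l2_norm N (\<lambda>x. A (f (r i)) x - A (f (r j)) x) < e" if e: "e > 0" for e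
  proof -
    have "(\<lambda>n. K * real (Suc n) powr (-\<theta>) * (2 * R)) \<longlonglongrightarrow> K * 0 * (2 * R)"
      using theta_pos by (intro tendsto_intros tendsto_neg_powr filterlim_compose[OF filterlim_real_sequentially filterlim_Suc]) auto
    then have "\<forall>\<^sub>F n in sequentially. K * real (Suc n) powr (-\<theta>) * (2 * R) < e / 2"
      using e by (intro order_tendstoD(2)) auto
    then obtain n where n: "K * real (Suc n) powr (-\<theta>) * (2 * R) < e / 2"
      unfolding eventually_sequentially by blast
    let ?m = "d * Suc n"
    define b q where "b = B n + 1" and "q = real ?m + 1"
    \<comment> \<open>The budget is \<open>e / 2\<close> for the part with \<open>K\<close> and
      \<open>e / 4\<close> for the functionals, which number less than \<open>q\<close> and carry a
      weight below \<open>b\<close>.\<close>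
    define \<eta> where "\<eta> = e / (4 * b * q)"
    have bq: "b > 0" "q > 0" using B0[of n] unfolding b_def q_def by (auto intro: add_nonneg_pos)
    then have \<eta>: "\<eta> > 0" using e by (simp add: \<eta>_def)
    have "\<exists>k0. \<forall>i<?m. \<forall>k\<ge>k0. \<forall>j\<ge>k0. \<bar>l n i (f (r k)) - l n i (f (r j))\<bar> < \<eta>"
    proof -
      have "\<forall>i. \<exists>k0. i < ?m \<longrightarrow> (\<forall>k\<ge>k0. \<forall>j\<ge>k0. \<bar>l n i (f (r k)) - l n i (f (r j))\<bar> < \<eta>)"
      proof
        fix i
        show "\<exists>k0. i < ?m \<longrightarrow> (\<forall>k\<ge>k0. \<forall>j\<ge>k0. \<bar>l n i (f (r k)) - l n i (f (r j))\<bar> < \<eta>)"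
          using CauchyD[OF lconv[of i n] \<eta>] by (cases "i < ?m") auto
      qed
      from choice[OF this] obtain k0 where k0: "\<And>i k j. i < ?m \<Longrightarrow> k \<ge> k0 i \<Longrightarrow> j \<ge> k0 i \<Longrightarrow>
        \<bar>l n i (f (r k)) - l n i (f (r j))\<bar> < \<eta>" by blast
      have "k0 i \<le> Max (k0 ` {..<?m})" if "i < ?m" for i using that by (intro Max_ge) auto
      then show ?thesis using k0 by (intro exI[of _ "Max (k0 ` {..<?m})"]) (meson order_trans)
    qed
    then obtain k0 where k0: "\<And>i k j. i < ?m \<Longrightarrow> k \<ge> k0 \<Longrightarrow> j \<ge> k0 \<Longrightarrow>
        \<bar>l n i (f (r k)) - l n i (f (r j))\<bar> < \<eta>" by blast
    have "l2_norm N (\<lambda>x. A (f (r k)) x - A (f (r j)) x) < e" if kj: "k \<ge> k0" "j \<ge> k0" for k j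
    proof -
      let ?g = "\<lambda>x. f (r k) x - f (r j) x"
      have g: "?g \<in> l2_space M" by (intro l2_diff f)
      have lg: "l n i ?g = l n i (f (r k)) - l n i (f (r j))" if "i < ?m" for i
        using l[OF that f f, of 1 "r k" "-1" "r j"] by simp
      have "l2_norm M ?g \<le> l2_norm M (f (r k)) + l2_norm M (\<lambda>x. (-1) * f (r j) x)"
        using l2_norm_triangle[OF f[of "r k"] l2_scale[OF f[of "r j"], of "-1"]] by simp
      also have "\<dots> \<le> 2 * R" using R[of "r k"] R[of "r j"] unfolding l2_norm_scale by simp
      finally have gR: "l2_norm M ?g \<le> 2 * R" .
      have "(\<Sum>i<?m. \<bar>l n i ?g\<bar>) \<le> (\<Sum>i<?m. \<eta>)"
        using k0 kj lg by (intro sum_mono) (simp add: less_imp_le)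
      also have "\<dots> \<le> q * \<eta>" using \<eta> by (simp add: q_def algebra_simps)
      finally have "B n * (\<Sum>i<?m. \<bar>l n i ?g\<bar>) \<le> b * (q * \<eta>)"
        using B0[of n] \<eta> bq by (intro mult_mono) (auto simp: sum_nonneg b_def)
      also have "\<dots> = e / 4" using bq by (simp add: \<eta>_def)
      finally have 1: "B n * (\<Sum>i<?m. \<bar>l n i ?g\<bar>) \<le> e / 4" .
      have 2: "K * real (Suc n) powr (-\<theta>) * l2_norm M ?g \<le> K * real (Suc n) powr (-\<theta>) * (2 * R)"
        using gR K_nonneg by (intro mult_left_mono) auto
      have "l2_norm N (A ?g) < e" using AB[OF g, of n] 1 2 n e by linarith
      then show ?thesis using A_diff_norm[OF f f] by simp
    qed
    then show ?thesis by blast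
  qed
  from N.l2_complete[OF A_l2[OF f] this]
  obtain g where "g \<in> l2_space N" "(\<lambda>n. l2_norm N (\<lambda>t. A (f (r n)) t - g t)) \<longlonglongrightarrow> 0" by blast
  then show "\<exists>g\<in>l2_space N. \<exists>r. strict_mono r \<and>
           (\<lambda>n. l2_norm N (\<lambda>t. A (f (r n)) t - g t)) \<longlonglongrightarrow> 0"
    using r by blast
qed

end

section \<open>Weakly singular integral operators\<close>

lemma l2_indicator:
  assumes "J \<in> sets N" "emeasure N J < \<infinity>"
  shows "indicator J \<in> l2_space N"
proof -
  have "(\<lambda>t. (indicator J t :: real)\<^sup>2) = indicator J" by (auto split: split_indicator)
  moreover have "integrable N (indicator J :: 'a \<Rightarrow> real)"
    using assms by (simp add: integrable_real_indicator)
  ultimately show ?thesis using assms by (simp add: l2_space_def)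
qed

section \<open>Approximation by means over subintervals\<close>

lemma power2_sum3_le: "(x + y + z)\<^sup>2 \<le> 3 * (x\<^sup>2 + y\<^sup>2 + z\<^sup>2)" for x y z :: real
proof -
  have "0 \<le> (x - y)\<^sup>2 + (y - z)\<^sup>2 + (x - z)\<^sup>2" by simp
  then show ?thesis by (simp add: power2_eq_square algebra_simps)
qed

text \<open>Averaging \<open>osc\<close> over \<open>\<tau>\<close> in \<open>J\<close> bounds the
  distance of \<open>u t\<close> from its mean by \<open>D\<close> times the sum of
  \<open>v t\<close> and the mean of \<open>v\<close>. Squaring three terms costs the factor 3, and
  by Cauchy-Schwarz the mean of \<open>v\<close> contributes no more than \<open>v\<close> itself,
  whence the 6. \<open>P\<close> singles out the times at which the pointwise estimate is
  available.\<close>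

lemma l2_oscillation_bound:
  fixes u v :: "'b \<Rightarrow> real"
  assumes J: "J \<in> sets N" "emeasure N J = ennreal \<delta>" "\<delta> > 0"
    and u: "u \<in> l2_space N" and v: "v \<in> l2_space N" "\<And>t. 0 \<le> v t"
    and good: "AE t in N. P t" and D: "0 \<le> D"
    and osc: "\<And>t \<tau>. P t \<Longrightarrow> P \<tau> \<Longrightarrow> t \<in> J \<Longrightarrow> \<tau> \<in> J \<Longrightarrow> \<bar>u t - u \<tau>\<bar> \<le> D * (v t + v \<tau>)"
  shows "(LINT t|N. indicator J t * (u t)\<^sup>2)
    \<le> 3 / \<delta> * (LINT t|N. indicator J t * u t)\<^sup>2 + 6 * D\<^sup>2 * (LINT t|N. indicator J t * (v t)\<^sup>2)"
proof -
  have fin: "emeasure N J < \<infinity>" using J by simp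
  have ind: "indicator J \<in> l2_space N" by (rule l2_indicator[OF J(1) fin])
  have mJ: "measure N J = \<delta>" using J by (simp add: measure_def)
  have iJ: "integrable N (\<lambda>t. indicator J t :: real)" using J fin by (simp add: integrable_real_indicator)
  have iu: "integrable N (\<lambda>t. indicator J t * u t)" and iv: "integrable N (\<lambda>t. indicator J t * v t)"
    by (intro l2_mult_integrable ind u v)+
  have iu2: "integrable N (\<lambda>t. indicator J t * (u t)\<^sup>2)" and iv2: "integrable N (\<lambda>t. indicator J t * (v t)\<^sup>2)"
    using integrable_mult_indicator[OF J(1) l2_spaceD(2)[OF u]]
      integrable_mult_indicator[OF J(1) l2_spaceD(2)[OF v(1)]] by simp_all
  define m a where "m = (LINT t|N. indicator J t * u t) / \<delta>"
    and "a = (LINT t|N. indicator J t * v t) / \<delta>"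
  have pw: "\<bar>u t\<bar> \<le> \<bar>m\<bar> + D * v t + D * a" if t: "P t" "t \<in> J" for t
  proof -
    have i1: "integrable N (\<lambda>\<tau>. u t * indicator J \<tau>)" using iJ by simp
    have i2: "integrable N (\<lambda>\<tau>. D * v t * indicator J \<tau> + D * (indicator J \<tau> * v \<tau>))"
      using iJ iv by simp
    have "\<delta> * u t - \<delta> * m = (LINT \<tau>|N. u t * indicator J \<tau> - indicator J \<tau> * u \<tau>)"
      using i1 iu J(3) mJ J(1) fin by (simp add: m_def)
    also have "\<bar>\<dots>\<bar> \<le> (LINT \<tau>|N. \<bar>u t * indicator J \<tau> - indicator J \<tau> * u \<tau>\<bar>)"
      by (rule integral_abs_bound)
    also have "\<dots> \<le> (LINT \<tau>|N. D * v t * indicator J \<tau> + D * (indicator J \<tau> * v \<tau>))"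
    proof (rule integral_mono_AE)
      show "integrable N (\<lambda>\<tau>. \<bar>u t * indicator J \<tau> - indicator J \<tau> * u \<tau>\<bar>)" using i1 iu by simp
      show "AE \<tau> in N. \<bar>u t * indicator J \<tau> - indicator J \<tau> * u \<tau>\<bar>
          \<le> D * v t * indicator J \<tau> + D * (indicator J \<tau> * v \<tau>)"
        using good
      proof eventually_elim
        case (elim \<tau>)
        then show ?case using osc[OF t(1) elim t(2)] by (auto split: split_indicator simp: distrib_left)
      qed
    qed (fact i2)
    also have "\<dots> = \<delta> * (D * v t + D * a)"
      using iJ iv J(3) mJ J(1) fin by (simp add: a_def algebra_simps)
    finally have "\<delta> * \<bar>u t - m\<bar> \<le> \<delta> * (D * v t + D * a)"
      using J(3) by (simp add: abs_mult flip: right_diff_distrib)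
    then have "\<bar>u t - m\<bar> \<le> D * v t + D * a" using J(3) by simp
    then show ?thesis by linarith
  qed
  have "(LINT t|N. indicator J t * (u t)\<^sup>2)
      \<le> (LINT t|N. 3 * (m\<^sup>2 + D\<^sup>2 * a\<^sup>2) * indicator J t + 3 * D\<^sup>2 * (indicator J t * (v t)\<^sup>2))"
  proof (rule integral_mono_AE[OF iu2])
    show "integrable N (\<lambda>t. 3 * (m\<^sup>2 + D\<^sup>2 * a\<^sup>2) * indicator J t + 3 * D\<^sup>2 * (indicator J t * (v t)\<^sup>2))"
      using iJ iv2 by simp
    show "AE t in N. indicator J t * (u t)\<^sup>2
        \<le> 3 * (m\<^sup>2 + D\<^sup>2 * a\<^sup>2) * indicator J t + 3 * D\<^sup>2 * (indicator J t * (v t)\<^sup>2)"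
      using good
    proof eventually_elim
      case (elim t)
      show ?case
      proof (cases "t \<in> J")
        case True
        have "(u t)\<^sup>2 = \<bar>u t\<bar>\<^sup>2" by simp
        also have "\<dots> \<le> (\<bar>m\<bar> + D * v t + D * a)\<^sup>2" by (intro power_mono pw elim True) simp
        also have "\<dots> \<le> 3 * (m\<^sup>2 + (D * v t)\<^sup>2 + (D * a)\<^sup>2)"
          using power2_sum3_le[of "\<bar>m\<bar>"] by simp
        finally show ?thesis using True by (simp add: power_mult_distrib algebra_simps)
      qed simp
    qed
  qed
  also have "\<dots> = 3 * (m\<^sup>2 + D\<^sup>2 * a\<^sup>2) * \<delta> + 3 * D\<^sup>2 * (LINT t|N. indicator J t * (v t)\<^sup>2)"
    using iJ iv2 mJ J(1) fin by simp
  also have "\<dots> = 3 * \<delta> * m\<^sup>2 + 3 * D\<^sup>2 * (\<delta> * a\<^sup>2) + 3 * D\<^sup>2 * (LINT t|N. indicator J t * (v t)\<^sup>2)"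
    by (simp add: algebra_simps)
  also have "\<dots> \<le> 3 * \<delta> * m\<^sup>2 + 3 * D\<^sup>2 * (LINT t|N. indicator J t * (v t)\<^sup>2)
      + 3 * D\<^sup>2 * (LINT t|N. indicator J t * (v t)\<^sup>2)"
  proof -
    have vJ: "(\<lambda>t. indicator J t * v t) \<in> l2_space N"
    proof -
      have "(\<lambda>t. (indicator J t * v t)\<^sup>2) = (\<lambda>t. indicator J t * (v t)\<^sup>2)"
        by (auto split: split_indicator)
      then show ?thesis using iv2 iv by (simp add: l2_space_def)
    qed
    have "(l2_inner N (indicator J) (\<lambda>t. indicator J t * v t))\<^sup>2
        \<le> (l2_norm N (indicator J))\<^sup>2 * (l2_norm N (\<lambda>t. indicator J t * v t))\<^sup>2"
      using power_mono[OF l2_Cauchy_Schwarz[OF ind vJ], of 2] by (simp add: power_mult_distrib)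
    moreover have "l2_inner N (indicator J) (\<lambda>t. indicator J t * v t) = \<delta> * a"
    proof -
      have "(\<lambda>t. indicator J t * (indicator J t * v t)) = (\<lambda>t. indicator J t * v t)"
        by (auto split: split_indicator)
      then show ?thesis unfolding l2_inner_def a_def using J(3) by simp
    qed
    moreover have "(l2_norm N (indicator J))\<^sup>2 = \<delta>"
    proof -
      have "(\<lambda>t. (indicator J t :: real)\<^sup>2) = indicator J" by (auto split: split_indicator)
      then show ?thesis unfolding l2_norm_square using mJ J(1) fin by simp
    qed
    moreover have "(l2_norm N (\<lambda>t. indicator J t * v t))\<^sup>2 = (LINT t|N. indicator J t * (v t)\<^sup>2)"
      unfolding l2_norm_square by (rule Bochner_Integration.integral_cong) (auto split: split_indicator)
    ultimately have "(\<delta> * a)\<^sup>2 \<le> \<delta> * (LINT t|N. indicator J t * (v t)\<^sup>2)" by simp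
    then have "\<delta> * a\<^sup>2 \<le> (LINT t|N. indicator J t * (v t)\<^sup>2)"
      using J(3) by (simp add: power2_eq_square mult_ac)
    then show ?thesis using D by (intro add_right_mono add_left_mono mult_left_mono) auto
  qed
  finally show ?thesis using J(3) by (simp add: m_def power_divide power2_eq_square)
qed

abbreviation "subint T n k \<equiv> {T * real k / real n <..< T * real (Suc k) / real n}"

lemma AE_subint_partition:
  assumes "0 < T" "1 \<le> n"
  shows "AE t in lebesgue_on {0<..<T}. (\<Sum>k<n. indicator (subint T n k) t) = (1 :: real)"
proof -
  let ?X = "(\<lambda>k. T * real k / real n) ` {..n}"
  have "?X \<in> null_sets lebesgue" by (intro finite_imp_null_set_lborel null_sets_completionI) simp
  then have "AE t in lebesgue. t \<notin> ?X" by (rule AE_not_in)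
  moreover have "(\<Sum>k<n. indicator (subint T n k) t) = (1 :: real)" if t: "t \<in> {0<..<T}" "t \<notin> ?X" for t
  proof -
    define k where "k = nat \<lfloor>t * real n / T\<rfloor>"
    have fl: "real k \<le> t * real n / T" "t * real n / T < real k + 1"
      using t assms unfolding k_def by (simp_all add: of_nat_nat)
    have "real k < real n"
    proof -
      have "t * real n / T < real n" using t assms by (simp add: field_simps)
      with fl show ?thesis by linarith
    qed
    then have kn: "k < n" by simp
    have "T * real k / real n \<noteq> t" using t(2) kn by auto
    then have tk: "t \<in> subint T n k" using fl assms by (simp add: field_simps less_le)
    have uniq: "j = k" if "t \<in> subint T n j" for j
    proof -
      have "T * real k < T * real (Suc j)" "T * real j < T * real (Suc k)"
        using that tk assms by (auto simp: field_simps intro: less_trans)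
      then have "k < Suc j" "j < Suc k" using assms by auto
      then show ?thesis by simp
    qed
    have "(\<Sum>j<n. indicator (subint T n j) t) = (\<Sum>j<n. if j = k then 1 else (0 :: real))"
    proof (rule sum.cong)
      show "indicator (subint T n j) t = (if j = k then 1 else (0 :: real))" for j
      proof (cases "j = k")
        case True
        have "indicator (subint T n j) t = (1 :: real)"
          unfolding True by (rule indicator_simps(1)[OF tk])
        then show ?thesis using True by simp
      next
        case False
        then have "t \<notin> subint T n j" using uniq by blast
        then have "indicator (subint T n j) t = (0 :: real)" by (rule indicator_simps(2))
        then show ?thesis using False by simp
      qed
    qed simp
    then show ?thesis using kn by simp
  qed
  ultimately show ?thesis by (subst AE_restrict_space_iff) (auto elim!: eventually_mono)
qed

lemma sum_power2_le_power2_sum: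
  fixes f :: "'i \<Rightarrow> real"
  assumes "\<And>i. i \<in> I \<Longrightarrow> 0 \<le> f i"
  shows "(\<Sum>i\<in>I. (f i)\<^sup>2) \<le> (\<Sum>i\<in>I. f i)\<^sup>2"
  using assms
proof (induction I rule: infinite_finite_induct)
  case (insert i I)
  then have "0 \<le> 2 * f i * (\<Sum>i\<in>I. f i)" by (simp add: sum_nonneg)
  with insert show ?case by (simp add: power2_sum)
qed simp_all

text \<open>The oscillation bound summed over the subintervals, with \<open>D\<close> the power
  \<open>\<theta>\<close> of their length. The sum of the squared means is replaced by the square of
  the sum of their absolute values, the form in which \<open>approximable_operator\<close> expects
  the functionals.\<close>

lemma l2_piecewise_mean_bound:
  fixes u v :: "real \<Rightarrow> real"
  assumes T: "0 < T" and n: "1 \<le> n" and N: "N = lebesgue_on {0<..<T}"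
    and u: "u \<in> l2_space N" and v: "v \<in> l2_space N" "\<And>t. 0 \<le> v t"
    and good: "AE t in N. P t" and th: "0 < \<theta>"
    and osc: "\<And>t \<tau>. P t \<Longrightarrow> P \<tau> \<Longrightarrow> t \<in> {0<..<T} \<Longrightarrow> \<tau> \<in> {0<..<T} \<Longrightarrow>
      \<bar>u t - u \<tau>\<bar> \<le> \<bar>t - \<tau>\<bar> powr \<theta> * (v t + v \<tau>)"
  shows "l2_norm N u \<le> 3 * (T / real n) powr \<theta> * l2_norm N v
    + sqrt (3 * real n / T) * (\<Sum>k<n. \<bar>LINT t|N. indicator (subint T n k) t * u t\<bar>)"
proof -
  define J where "J = subint T n"
  define \<delta> where "\<delta> = T / real n"
  define l where "l k = (LINT t|N. indicator (J k) t * u t)" for k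
  have \<delta>: "\<delta> > 0" using T n by (simp add: \<delta>_def)
  have step: "T * real (Suc k) / real n = T * real k / real n + \<delta>" for k
    by (simp add: \<delta>_def distrib_left add_divide_distrib)
  have J_sub: "J k \<subseteq> {0<..<T}" if "k < n" for k
  proof -
    have "T * real (Suc k) \<le> T * real n" using that T by (intro mult_left_mono) auto
    then have "T * real (Suc k) / real n \<le> T" using n by (simp add: divide_le_eq)
    moreover have "0 \<le> T * real k / real n" using T by simp
    ultimately show ?thesis unfolding J_def by fastforce
  qed
  have J_sets: "J k \<in> sets N" if "k < n" for k
    using J_sub[OF that] unfolding N J_def by (auto simp: sets_restrict_space_iff)
  have J_measure: "emeasure N (J k) = ennreal \<delta>" if "k < n" for k
  proof -
    have "emeasure N (J k) = emeasure lebesgue (J k)"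
      unfolding N by (rule emeasure_restrict_space) (use J_sub[OF that] in auto)
    also have "\<dots> = ennreal (T * real (Suc k) / real n - T * real k / real n)"
      unfolding J_def using T by (simp add: emeasure_lborel_Ioo divide_right_mono)
    also have "\<dots> = ennreal \<delta>" unfolding step by simp
    finally show ?thesis .
  qed
  have split: "(LINT t|N. f t) = (\<Sum>k<n. LINT t|N. indicator (J k) t * f t)" if f: "integrable N f" for f :: "real \<Rightarrow> real"
  proof -
    have i: "integrable N (\<lambda>t. indicator (J k) t * f t)" if "k < n" for k
      using integrable_mult_indicator[OF J_sets[OF that] f] by simp
    have "(LINT t|N. f t) = (LINT t|N. (\<Sum>k<n. indicator (J k) t * f t))"
    proof (rule integral_cong_AE)
      show "AE t in N. f t = (\<Sum>k<n. indicator (J k) t * f t)"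
        using AE_subint_partition[OF T n] unfolding N J_def
        by eventually_elim (simp flip: sum_distrib_right)
      show "f \<in> borel_measurable N" by (rule borel_measurable_integrable[OF f])
      show "(\<lambda>t. \<Sum>k<n. indicator (J k) t * f t) \<in> borel_measurable N"
        by (rule borel_measurable_sum, rule borel_measurable_integrable, rule i) simp
    qed
    also have "\<dots> = (\<Sum>k<n. LINT t|N. indicator (J k) t * f t)"
      using i by (intro Bochner_Integration.integral_sum) auto
    finally show ?thesis .
  qed
  have le: "(LINT t|N. indicator (J k) t * (u t)\<^sup>2)
      \<le> 3 / \<delta> * (l k)\<^sup>2 + 6 * (\<delta> powr \<theta>)\<^sup>2 * (LINT t|N. indicator (J k) t * (v t)\<^sup>2)" if k: "k < n" for k
    unfolding l_def
  proof (rule l2_oscillation_bound[OF J_sets[OF k] J_measure[OF k] \<delta> u v good])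
    fix t \<tau> assume "P t" "P \<tau>" and tJ: "t \<in> J k" "\<tau> \<in> J k"
    then have "\<bar>u t - u \<tau>\<bar> \<le> \<bar>t - \<tau>\<bar> powr \<theta> * (v t + v \<tau>)" using J_sub[OF k] by (intro osc) auto
    also have "\<dots> \<le> \<delta> powr \<theta> * (v t + v \<tau>)"
    proof (intro mult_right_mono powr_mono2)
      show "\<bar>t - \<tau>\<bar> \<le> \<delta>" using tJ unfolding J_def step by auto
    qed (use th v(2) in auto)
    finally show "\<bar>u t - u \<tau>\<bar> \<le> \<delta> powr \<theta> * (v t + v \<tau>)" .
  qed simp
  have "(l2_norm N u)\<^sup>2 = (\<Sum>k<n. LINT t|N. indicator (J k) t * (u t)\<^sup>2)"
    unfolding l2_norm_square by (rule split) (rule l2_spaceD(2)[OF u])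
  also have "\<dots> \<le> (\<Sum>k<n. 3 / \<delta> * (l k)\<^sup>2 + 6 * (\<delta> powr \<theta>)\<^sup>2 * (LINT t|N. indicator (J k) t * (v t)\<^sup>2))"
    by (intro sum_mono le) simp
  also have "\<dots> = 3 / \<delta> * (\<Sum>k<n. (l k)\<^sup>2) + 6 * (\<delta> powr \<theta>)\<^sup>2 * (l2_norm N v)\<^sup>2"
    using split[OF l2_spaceD(2)[OF v(1)]]
    by (simp add: sum.distrib sum_distrib_left l2_norm_square)
  also have "\<dots> \<le> (sqrt (3 / \<delta>) * (\<Sum>k<n. \<bar>l k\<bar>))\<^sup>2 + (3 * \<delta> powr \<theta> * l2_norm N v)\<^sup>2"
  proof (rule add_mono)
    have "(\<Sum>k<n. \<bar>l k\<bar>\<^sup>2) \<le> (\<Sum>k<n. \<bar>l k\<bar>)\<^sup>2"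
      by (rule sum_power2_le_power2_sum) simp
    then have "3 / \<delta> * (\<Sum>k<n. (l k)\<^sup>2) \<le> 3 / \<delta> * (\<Sum>k<n. \<bar>l k\<bar>)\<^sup>2"
      using \<delta> by (intro mult_left_mono) auto
    then show "3 / \<delta> * (\<Sum>k<n. (l k)\<^sup>2) \<le> (sqrt (3 / \<delta>) * (\<Sum>k<n. \<bar>l k\<bar>))\<^sup>2"
      using \<delta> by (simp add: power_mult_distrib)
  qed (simp add: power_mult_distrib mult_right_mono)
  also have "\<dots> \<le> (3 * \<delta> powr \<theta> * l2_norm N v + sqrt (3 / \<delta>) * (\<Sum>k<n. \<bar>l k\<bar>))\<^sup>2"
    using \<delta> by (simp add: power2_sum sum_nonneg)
  finally have "l2_norm N u \<le> 3 * \<delta> powr \<theta> * l2_norm N v + sqrt (3 / \<delta>) * (\<Sum>k<n. \<bar>l k\<bar>)"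
    by (rule power2_le_imp_le) (use \<delta> in \<open>auto intro!: add_nonneg_nonneg mult_nonneg_nonneg sum_nonneg\<close>)
  then show ?thesis by (simp add: \<delta>_def l_def J_def)
qed

text \<open>One weight \<open>w\<close> dominates both the size of the kernels and their Hoelder
  quotients, so a single bound for the operator with kernel \<open>w\<close> does all the work. The
  index \<open>j\<close> separates the bounded functions \<open>g j\<close> of time from the kernels
  that are regular in time.\<close>

locale weakly_singular_kernels = M: finite_measure M
  for M :: "'a measure" +
  fixes T \<theta> W L :: real and \<kappa> :: "'n::finite \<Rightarrow> 'a \<Rightarrow> real \<Rightarrow> real" and w :: "'a \<Rightarrow> real \<Rightarrow> real"
    and g :: "'n \<Rightarrow> real \<Rightarrow> real"
  assumes T_pos: "0 < T" and theta: "0 < \<theta>" and W_nonneg: "0 \<le> W" and L_nonneg: "0 \<le> L"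
    and measurable_kernel: "(\<lambda>(x, t). \<kappa> j x t) \<in> borel_measurable (M \<Otimes>\<^sub>M lebesgue_on {0<..<T})"
    and measurable_weight: "(\<lambda>(x, t). w x t) \<in> borel_measurable (M \<Otimes>\<^sub>M lebesgue_on {0<..<T})"
    and weight_nonneg: "0 \<le> w x t"
    and kernel_le: "AE x in M. \<forall>t\<in>{0<..<T}. \<bar>\<kappa> j x t\<bar> \<le> w x t"
    and kernel_diff_le: "AE x in M. \<forall>t\<in>{0<..<T}. \<forall>\<tau>\<in>{0<..<T}.
      \<bar>\<kappa> j x t - \<kappa> j x \<tau>\<bar> \<le> \<bar>t - \<tau>\<bar> powr \<theta> * (w x t + w x \<tau>)"
    and weight_bounded: "c \<in> l2_space M \<Longrightarrow>
      (\<integral>\<^sup>+t. (\<integral>\<^sup>+x. ennreal (\<bar>c x\<bar> * w x t) \<partial>M)\<^sup>2 \<partial>lebesgue_on {0<..<T}) \<le> ennreal ((W * l2_norm M c)\<^sup>2)"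
    and measurable_g: "g j \<in> borel_measurable (lebesgue_on {0<..<T})"
    and g_le: "t \<in> {0<..<T} \<Longrightarrow> \<bar>g j t\<bar> \<le> L"
begin

abbreviation "N \<equiv> lebesgue_on {0<..<T}"

text \<open>At good times the integrals of \<open>c\<close> against all the kernels converge
  absolutely, so linearity and the pointwise estimates hold there exactly; at other times the
  default value 0 of a divergent integral could spoil them.\<close>

definition "good c t \<longleftrightarrow> t \<in> {0<..<T} \<and> integrable M (\<lambda>x. \<bar>c x\<bar> * w x t)"
definition "v c t = (LINT x|M. \<bar>c x\<bar> * w x t)"
definition "U j c t = (LINT x|M. c x * \<kappa> j x t)"
definition "A c t = (LINT x|M. c x * (\<Sum>j\<in>UNIV. g j t * \<kappa> j x t))"

sublocale N: finite_measure N
  by (rule finite_measure_lebesgue_on) simp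

lemma measurable_swap:
  assumes "(\<lambda>(x, t). f x t) \<in> borel_measurable (M \<Otimes>\<^sub>M N)"
  shows "(\<lambda>(t, x). f x t) \<in> borel_measurable (N \<Otimes>\<^sub>M M)"
  using measurable_compose[OF measurable_pair_swap' assms] by (simp add: case_prod_unfold)

lemma measurable_section:
  assumes "(\<lambda>(x, t). f x t) \<in> borel_measurable (M \<Otimes>\<^sub>M N)" "t \<in> {0<..<T}"
  shows "(\<lambda>x. f x t) \<in> borel_measurable M"
proof -
  have "(\<lambda>x. (x, t)) \<in> measurable M (M \<Otimes>\<^sub>M N)" using assms(2) by (intro measurable_Pair) auto
  from measurable_compose[OF this assms(1)] show ?thesis by simp
qed

lemma measurable_mult_left:
  fixes c :: "'a \<Rightarrow> real"
  assumes "c \<in> borel_measurable M" "(\<lambda>(x, t). f x t) \<in> borel_measurable (M \<Otimes>\<^sub>M N)"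
  shows "(\<lambda>(x, t). c x * f x t) \<in> borel_measurable (M \<Otimes>\<^sub>M N)"
proof -
  have "(\<lambda>z. c (fst z)) \<in> borel_measurable (M \<Otimes>\<^sub>M N)"
    using measurable_compose[OF measurable_fst assms(1)] .
  from borel_measurable_times[OF this assms(2)] show ?thesis by (simp add: case_prod_unfold)
qed

lemma measurable_integral:
  fixes f :: "'a \<Rightarrow> real \<Rightarrow> real"
  assumes "(\<lambda>(x, t). f x t) \<in> borel_measurable (M \<Otimes>\<^sub>M N)"
  shows "(\<lambda>t. LINT x|M. f x t) \<in> borel_measurable N"
  using M.borel_measurable_lebesgue_integral[of "\<lambda>t x. f x t" N] measurable_swap[OF assms] by simp

lemma AE_good:
  assumes "c \<in> l2_space M"
  shows "AE t in N. good c t"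
proof -
  note c = l2_spaceD(1)[OF assms]
  have abs_c: "(\<lambda>x. \<bar>c x\<bar>) \<in> borel_measurable M" using c by measurable
  have meas: "(\<lambda>(x, t). \<bar>c x\<bar> * w x t) \<in> borel_measurable (M \<Otimes>\<^sub>M N)"
    by (rule measurable_mult_left[OF abs_c measurable_weight])
  have "(\<lambda>(t, x). ennreal (\<bar>c x\<bar> * w x t)) \<in> borel_measurable (N \<Otimes>\<^sub>M M)"
    using measurable_swap[OF meas] by (simp add: case_prod_unfold)
  then have "(\<lambda>t. \<integral>\<^sup>+x. ennreal (\<bar>c x\<bar> * w x t) \<partial>M) \<in> borel_measurable N"
    using M.borel_measurable_nn_integral[of "\<lambda>t x. ennreal (\<bar>c x\<bar> * w x t)" N] by simp
  then have "(\<lambda>t. (\<integral>\<^sup>+x. ennreal (\<bar>c x\<bar> * w x t) \<partial>M)\<^sup>2) \<in> borel_measurable N" by simp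
  moreover have "(\<integral>\<^sup>+t. (\<integral>\<^sup>+x. ennreal (\<bar>c x\<bar> * w x t) \<partial>M)\<^sup>2 \<partial>N) \<noteq> \<infinity>"
    using weight_bounded[OF assms] by (auto simp: top_unique)
  ultimately have "AE t in N. (\<integral>\<^sup>+x. ennreal (\<bar>c x\<bar> * w x t) \<partial>M)\<^sup>2 \<noteq> \<infinity>"
    by (rule nn_integral_noteq_infinite)
  moreover have "AE t in N. t \<in> {0<..<T}" by (rule AE_I2) simp
  ultimately show ?thesis
  proof eventually_elim
    case (elim t)
    then have "(\<integral>\<^sup>+x. ennreal (\<bar>c x\<bar> * w x t) \<partial>M) < \<infinity>"
      by (auto simp: power2_eq_square ennreal_mult_eq_top_iff less_top)
    then have "integrable M (\<lambda>x. \<bar>c x\<bar> * w x t)"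
      using measurable_section[OF meas elim(2)] weight_nonneg by (intro integrableI_nonneg) auto
    with elim show ?case by (simp add: good_def)
  qed
qed

lemma v_nonneg: "0 \<le> v c t"
  unfolding v_def using weight_nonneg by (intro Bochner_Integration.integral_nonneg) auto

lemma v_l2:
  assumes "c \<in> l2_space M"
  shows "v c \<in> l2_space N" "l2_norm N (v c) \<le> W * l2_norm M c"
proof -
  have abs_c: "(\<lambda>x. \<bar>c x\<bar>) \<in> borel_measurable M" using l2_spaceD(1)[OF assms] by measurable
  have "v c \<in> borel_measurable N"
    using measurable_integral[OF measurable_mult_left[OF abs_c measurable_weight]]
    by (simp add: v_def[abs_def])
  moreover have "(\<integral>\<^sup>+t. ennreal ((v c t)\<^sup>2) \<partial>N)
      = (\<integral>\<^sup>+t. (\<integral>\<^sup>+x. ennreal (\<bar>c x\<bar> * w x t) \<partial>M)\<^sup>2 \<partial>N)"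
  proof (rule nn_integral_cong_AE, use AE_good[OF assms] in eventually_elim)
    case (elim t)
    then have "(\<integral>\<^sup>+x. ennreal (\<bar>c x\<bar> * w x t) \<partial>M) = ennreal (v c t)"
      unfolding good_def v_def using weight_nonneg by (intro nn_integral_eq_integral) auto
    then show ?case using v_nonneg by (simp add: ennreal_power)
  qed
  ultimately show "v c \<in> l2_space N" "l2_norm N (v c) \<le> W * l2_norm M c"
    using weight_bounded[OF assms] W_nonneg l2_space_nn_integral[of "v c" N "W * l2_norm M c"] by auto
qed

lemma good_integrable:
  assumes "c \<in> l2_space M" "good c t"
  shows "integrable M (\<lambda>x. c x * \<kappa> j x t)"
proof (rule Bochner_Integration.integrable_bound)
  show "integrable M (\<lambda>x. \<bar>c x\<bar> * w x t)" using assms by (simp add: good_def)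
  have t: "t \<in> {0<..<T}" using assms by (simp add: good_def)
  show "(\<lambda>x. c x * \<kappa> j x t) \<in> borel_measurable M"
    by (rule measurable_section[OF measurable_mult_left[OF l2_spaceD(1)[OF assms(1)] measurable_kernel] t])
  show "AE x in M. norm (c x * \<kappa> j x t) \<le> norm (\<bar>c x\<bar> * w x t)"
    using kernel_le[of j] t weight_nonneg by (auto simp: abs_mult mult_left_mono elim!: eventually_mono)
qed

lemma good_integrable_total:
  assumes "c \<in> l2_space M" "good c t"
  shows "integrable M (\<lambda>x. c x * (\<Sum>j\<in>UNIV. g j t * \<kappa> j x t))"
    and "A c t = (\<Sum>j\<in>UNIV. g j t * U j c t)"
proof -
  have i: "integrable M (\<lambda>x. g j t * (c x * \<kappa> j x t))" for j
    using good_integrable[OF assms] by simp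
  have eq: "c x * (\<Sum>j\<in>UNIV. g j t * \<kappa> j x t) = (\<Sum>j\<in>UNIV. g j t * (c x * \<kappa> j x t))" for x
    by (simp add: sum_distrib_left mult_ac)
  show "integrable M (\<lambda>x. c x * (\<Sum>j\<in>UNIV. g j t * \<kappa> j x t))"
    unfolding eq using i by (intro Bochner_Integration.integrable_sum)
  show "A c t = (\<Sum>j\<in>UNIV. g j t * U j c t)"
    unfolding A_def eq U_def using i by (subst Bochner_Integration.integral_sum) auto
qed

lemma U_lincomb:
  assumes "f \<in> l2_space M" "h \<in> l2_space M" "good f t" "good h t"
  shows "U j (\<lambda>x. a * f x + b * h x) t = a * U j f t + b * U j h t"
  using good_integrable[OF assms(1,3), of j] good_integrable[OF assms(2,4), of j]
  by (simp add: U_def distrib_right mult.assoc)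

lemma U_le:
  assumes "c \<in> l2_space M" "good c t"
  shows "\<bar>U j c t\<bar> \<le> v c t"
proof -
  have t: "t \<in> {0<..<T}" and i: "integrable M (\<lambda>x. \<bar>c x\<bar> * w x t)" using assms by (auto simp: good_def)
  have "\<bar>U j c t\<bar> \<le> (LINT x|M. \<bar>c x * \<kappa> j x t\<bar>)" unfolding U_def by (rule integral_abs_bound)
  also have "\<dots> \<le> v c t"
    unfolding v_def
  proof (rule integral_mono_AE)
    show "integrable M (\<lambda>x. \<bar>c x * \<kappa> j x t\<bar>)" by (intro integrable_abs good_integrable assms)
    show "AE x in M. \<bar>c x * \<kappa> j x t\<bar> \<le> \<bar>c x\<bar> * w x t"
      using kernel_le[of j] t by (auto simp: abs_mult mult_left_mono elim!: eventually_mono)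
  qed (fact i)
  finally show ?thesis .
qed

lemma U_diff_le:
  assumes c: "c \<in> l2_space M" and good: "good c t" "good c \<tau>"
  shows "\<bar>U j c t - U j c \<tau>\<bar> \<le> \<bar>t - \<tau>\<bar> powr \<theta> * (v c t + v c \<tau>)"
proof -
  let ?p = "\<bar>t - \<tau>\<bar> powr \<theta>"
  have t: "t \<in> {0<..<T}" "\<tau> \<in> {0<..<T}"
    and i: "integrable M (\<lambda>x. \<bar>c x\<bar> * w x t)" "integrable M (\<lambda>x. \<bar>c x\<bar> * w x \<tau>)"
    using good by (auto simp: good_def)
  have "U j c t - U j c \<tau> = (LINT x|M. c x * \<kappa> j x t - c x * \<kappa> j x \<tau>)"
    unfolding U_def using good_integrable[OF c good(1), of j] good_integrable[OF c good(2), of j] by simp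
  also have "\<bar>\<dots>\<bar> \<le> (LINT x|M. \<bar>c x * \<kappa> j x t - c x * \<kappa> j x \<tau>\<bar>)" by (rule integral_abs_bound)
  also have "\<dots> \<le> (LINT x|M. ?p * (\<bar>c x\<bar> * w x t + \<bar>c x\<bar> * w x \<tau>))"
  proof (rule integral_mono_AE)
    show "integrable M (\<lambda>x. \<bar>c x * \<kappa> j x t - c x * \<kappa> j x \<tau>\<bar>)"
      using good_integrable[OF c good(1), of j] good_integrable[OF c good(2), of j] by simp
    show "integrable M (\<lambda>x. ?p * (\<bar>c x\<bar> * w x t + \<bar>c x\<bar> * w x \<tau>))" using i by simp
    show "AE x in M. \<bar>c x * \<kappa> j x t - c x * \<kappa> j x \<tau>\<bar> \<le> ?p * (\<bar>c x\<bar> * w x t + \<bar>c x\<bar> * w x \<tau>)"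
      using kernel_diff_le[of j]
    proof eventually_elim
      case (elim x)
      then have "\<bar>c x\<bar> * \<bar>\<kappa> j x t - \<kappa> j x \<tau>\<bar> \<le> \<bar>c x\<bar> * (?p * (w x t + w x \<tau>))"
        using t by (intro mult_left_mono) auto
      moreover have "\<bar>c x * \<kappa> j x t - c x * \<kappa> j x \<tau>\<bar> = \<bar>c x\<bar> * \<bar>\<kappa> j x t - \<kappa> j x \<tau>\<bar>"
        by (simp only: right_diff_distrib[symmetric] abs_mult)
      moreover have "\<bar>c x\<bar> * (?p * (w x t + w x \<tau>)) = ?p * (\<bar>c x\<bar> * w x t + \<bar>c x\<bar> * w x \<tau>)"
        by (simp only: distrib_left mult.left_commute)
      ultimately show ?case by simp
    qed
  qed
  also have "\<dots> = ?p * (v c t + v c \<tau>)" using i by (simp add: v_def)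
  finally show ?thesis .
qed

lemma U_l2:
  assumes "c \<in> l2_space M"
  shows "U j c \<in> l2_space N" "l2_norm N (U j c) \<le> W * l2_norm M c"
proof -
  have meas: "U j c \<in> borel_measurable N"
    using measurable_integral[OF measurable_mult_left[OF l2_spaceD(1)[OF assms] measurable_kernel[of j]]]
    by (simp add: U_def[abs_def])
  have "(\<integral>\<^sup>+t. ennreal ((U j c t)\<^sup>2) \<partial>N) \<le> (\<integral>\<^sup>+t. ennreal ((v c t)\<^sup>2) \<partial>N)"
    using AE_good[OF assms] by (intro nn_integral_mono_AE)
      (auto simp: abs_le_square_iff[symmetric] v_nonneg intro!: ennreal_leI U_le[OF assms] elim!: eventually_mono)
  also have "\<dots> \<le> ennreal ((W * l2_norm M c)\<^sup>2)"
    using v_l2[OF assms] by (subst l2_norm_nn_integral) (auto intro!: ennreal_leI power_mono)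
  finally show "U j c \<in> l2_space N" "l2_norm N (U j c) \<le> W * l2_norm M c"
    using W_nonneg l2_space_nn_integral[OF meas, of "W * l2_norm M c"] by auto
qed

lemma A_measurable:
  assumes "c \<in> l2_space M"
  shows "A c \<in> borel_measurable N"
proof -
  have "(\<lambda>z. \<Sum>j\<in>UNIV. g j (snd z) * (case z of (x, t) \<Rightarrow> \<kappa> j x t)) \<in> borel_measurable (M \<Otimes>\<^sub>M N)"
    by (intro borel_measurable_sum borel_measurable_times measurable_kernel
        measurable_compose[OF measurable_snd measurable_g])
  then have "(\<lambda>(x, t). \<Sum>j\<in>UNIV. g j t * \<kappa> j x t) \<in> borel_measurable (M \<Otimes>\<^sub>M N)"
    by (simp add: case_prod_unfold)
  from measurable_integral[OF measurable_mult_left[OF l2_spaceD(1)[OF assms] this]]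
  show ?thesis by (simp add: A_def[abs_def])
qed

text \<open>The bounds \<open>B j\<close> are left open: with the norms themselves the lemma shows
  that \<open>A c\<close> is square integrable, with the mean estimates it yields the
  approximation.\<close>

lemma A_bound:
  assumes c: "c \<in> l2_space M" and B: "\<And>j. l2_norm N (U j c) \<le> B j"
  shows "A c \<in> l2_space N" "l2_norm N (A c) \<le> L * (\<Sum>j\<in>UNIV. B j)"
proof -
  have AE: "AE t in N. A c t = (\<Sum>j\<in>UNIV. g j t * U j c t)"
    using AE_good[OF c] by eventually_elim (rule good_integrable_total(2)[OF c])
  have gU: "(\<lambda>t. g j t * U j c t) \<in> l2_space N \<and> l2_norm N (\<lambda>t. g j t * U j c t) \<le> L * B j" for j
  proof -
    note U = U_l2(1)[OF c, of j]
    have meas: "(\<lambda>t. g j t * U j c t) \<in> borel_measurable N"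
      by (intro borel_measurable_times measurable_g l2_spaceD(1)[OF U])
    have "(\<integral>\<^sup>+t. ennreal ((g j t * U j c t)\<^sup>2) \<partial>N) \<le> (\<integral>\<^sup>+t. ennreal ((L * U j c t)\<^sup>2) \<partial>N)"
    proof (rule nn_integral_mono)
      fix t assume "t \<in> space N"
      then have "\<bar>g j t\<bar> \<le> L" using g_le by simp
      then have "(g j t)\<^sup>2 \<le> L\<^sup>2" using power_mono[of "\<bar>g j t\<bar>" L 2] by simp
      then show "ennreal ((g j t * U j c t)\<^sup>2) \<le> ennreal ((L * U j c t)\<^sup>2)"
        by (intro ennreal_leI) (simp add: power_mult_distrib mult_right_mono)
    qed
    also have "\<dots> = ennreal ((l2_norm N (\<lambda>t. L * U j c t))\<^sup>2)"
      by (rule l2_norm_nn_integral[OF l2_scale[OF U]])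
    also have "\<dots> = ennreal ((L * l2_norm N (U j c))\<^sup>2)"
      using L_nonneg by (simp add: l2_norm_scale)
    finally have "(\<lambda>t. g j t * U j c t) \<in> l2_space N"
      "l2_norm N (\<lambda>t. g j t * U j c t) \<le> L * l2_norm N (U j c)"
      using l2_space_nn_integral[OF meas] L_nonneg by auto
    then show ?thesis using mult_left_mono[OF B[of j] L_nonneg] by auto
  qed
  have sum: "l2_norm N (\<lambda>t. \<Sum>j\<in>J. g j t * U j c t) \<le> (\<Sum>j\<in>J. L * B j)" if "finite J" for J
    using that
  proof (induction J rule: finite_induct)
    case empty
    then show ?case by (simp add: l2_norm_eq_sqrt)
  next
    case (insert j J)
    have "l2_norm N (\<lambda>t. g j t * U j c t + (\<Sum>j\<in>J. g j t * U j c t))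
        \<le> l2_norm N (\<lambda>t. g j t * U j c t) + l2_norm N (\<lambda>t. \<Sum>j\<in>J. g j t * U j c t)"
      using gU by (intro l2_norm_triangle l2_sum) auto
    then show ?case using insert gU[of j] by simp
  qed
  have S: "(\<lambda>t. \<Sum>j\<in>UNIV. g j t * U j c t) \<in> l2_space N" using gU by (intro l2_sum) auto
  show "A c \<in> l2_space N"
  proof -
    have "integrable N (\<lambda>t. (A c t)\<^sup>2) \<longleftrightarrow> integrable N (\<lambda>t. (\<Sum>j\<in>UNIV. g j t * U j c t)\<^sup>2)"
      using AE A_measurable[OF c] l2_spaceD(1)[OF S] by (intro integrable_cong_AE) auto
    then show ?thesis using l2_spaceD(2)[OF S] A_measurable[OF c] by (simp add: l2_space_def)
  qed
  have "l2_norm N (A c) = l2_norm N (\<lambda>t. \<Sum>j\<in>UNIV. g j t * U j c t)"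
    by (rule l2_norm_cong_AE[OF AE A_measurable[OF c] l2_spaceD(1)[OF S]])
  also have "\<dots> \<le> L * (\<Sum>j\<in>UNIV. B j)" using sum[of UNIV] by (simp add: sum_distrib_left)
  finally show "l2_norm N (A c) \<le> L * (\<Sum>j\<in>UNIV. B j)" .
qed

lemma AE_integrable:
  assumes "c \<in> l2_space M"
  shows "AE t in N. integrable M (\<lambda>x. c x * (\<Sum>j\<in>UNIV. g j t * \<kappa> j x t))"
  using AE_good[OF assms] by eventually_elim (rule good_integrable_total(1)[OF assms])

lemma A_lincomb:
  assumes "f \<in> l2_space M" "h \<in> l2_space M"
  shows "AE t in N. A (\<lambda>x. a * f x + b * h x) t = a * A f t + b * A h t"
  using AE_good[OF assms(1)] AE_good[OF assms(2)] AE_good[OF l2_lincomb[OF assms, of a b]]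
proof eventually_elim
  case (elim t)
  then show ?case using assms l2_lincomb[OF assms, of a b]
    by (simp add: good_integrable_total U_lincomb sum.distrib sum_distrib_left algebra_simps)
qed

text \<open>The functionals are the integrals of \<open>U j f\<close> over the subintervals, one for
  each pair of an index \<open>j\<close> and a subinterval; the bijection \<open>b\<close> lists
  these pairs.\<close>

lemma approximation_by_means:
  assumes n: "1 \<le> n"
  shows "\<exists>l B. 0 \<le> B \<and>
      (\<forall>i<CARD('n)*n. \<forall>f\<in>l2_space M. \<forall>h\<in>l2_space M. \<forall>a b.
          l i (\<lambda>x. a * f x + b * h x) = a * l i f + b * l i h) \<and>
      (\<forall>i<CARD('n)*n. \<forall>f\<in>l2_space M. \<bar>l i f\<bar> \<le> B * l2_norm M f) \<and>
      (\<forall>f\<in>l2_space M. l2_norm N (A f) \<le>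
          (L * real CARD('n) * (3 * T powr \<theta> * W)) * real n powr (-\<theta>) * l2_norm M f
          + B * (\<Sum>i<CARD('n)*n. \<bar>l i f\<bar>))"
proof -
  define m where "m k j f = (LINT t|N. indicator (subint T n k) t * U j f t)" for k j f
  have J: "subint T n k \<inter> {0<..<T} \<in> sets N" for k by (auto simp: sets_restrict_space_iff)
  have ind: "indicator (subint T n k) \<in> l2_space N" for k
  proof -
    \<comment> \<open>As \<open>k\<close> is unrestricted, \<open>subint T n k\<close> may leave the
      interval and fail to be a set of \<open>N\<close>, so its trace on \<open>{0<..<T}\<close> is
      treated first.\<close>
    have "indicator (subint T n k \<inter> {0<..<T}) \<in> l2_space N"
      by (rule l2_indicator[OF J]) (simp add: less_top[symmetric])
    moreover have "(indicator (subint T n k \<inter> {0<..<T}) :: real \<Rightarrow> real) \<in> borel_measurable N \<longleftrightarrow>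
        (indicator (subint T n k) :: real \<Rightarrow> real) \<in> borel_measurable N"
      by (intro measurable_cong) (auto split: split_indicator)
    moreover have "integrable N (\<lambda>t. (indicator (subint T n k \<inter> {0<..<T}) t :: real)\<^sup>2) \<longleftrightarrow>
        integrable N (\<lambda>t. (indicator (subint T n k) t :: real)\<^sup>2)"
      by (intro Bochner_Integration.integrable_cong) (auto split: split_indicator)
    ultimately show ?thesis unfolding l2_space_def by blast
  qed
  have m_lincomb: "m k j (\<lambda>x. a * f x + b * h x) = a * m k j f + b * m k j h"
    if "f \<in> l2_space M" "h \<in> l2_space M" for k j f h a b
  proof -
    let ?i = "indicator (subint T n k)"
    have i: "integrable N (\<lambda>t. ?i t * U j c t)" if "c \<in> l2_space M" for c
      by (rule l2_mult_integrable[OF ind U_l2(1)[OF that]])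
    have "m k j (\<lambda>x. a * f x + b * h x) = (LINT t|N. a * (?i t * U j f t) + b * (?i t * U j h t))"
      unfolding m_def
    proof (rule integral_cong_AE)
      show "AE t in N. ?i t * U j (\<lambda>x. a * f x + b * h x) t = a * (?i t * U j f t) + b * (?i t * U j h t)"
        using AE_good[OF that(1)] AE_good[OF that(2)]
        by eventually_elim (simp add: U_lincomb[OF that] algebra_simps)
      show "(\<lambda>t. ?i t * U j (\<lambda>x. a * f x + b * h x) t) \<in> borel_measurable N"
        by (rule borel_measurable_integrable[OF i[OF l2_lincomb[OF that]]])
      show "(\<lambda>t. a * (?i t * U j f t) + b * (?i t * U j h t)) \<in> borel_measurable N"
        by (rule borel_measurable_integrable) (use i[OF that(1)] i[OF that(2)] in simp)
    qed
    then show ?thesis using i[OF that(1)] i[OF that(2)] by (simp add: m_def)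
  qed
  define I where "I = (UNIV :: 'n set) \<times> {..<n}"
  have "finite I" "card {..<CARD('n) * n} = card I" by (simp_all add: I_def)
  then obtain b where b: "bij_betw b {..<CARD('n) * n} I"
    using finite_same_card_bij[of "{..<CARD('n) * n}" I] by auto
  define l where "l i f = m (snd (b i)) (fst (b i)) f" for i f
  have l_sum: "(\<Sum>i<CARD('n)*n. \<bar>l i f\<bar>) = (\<Sum>j\<in>UNIV. \<Sum>k<n. \<bar>m k j f\<bar>)" for f
    unfolding l_def sum.reindex_bij_betw[OF b, of "\<lambda>p. \<bar>m (snd p) (fst p) f\<bar>"] I_def
    by (simp add: sum.cartesian_product case_prod_unfold)
  define s where "s = sqrt (3 * real n / T)"
  define q where "q = (\<Sum>k<n. l2_norm N (indicator (subint T n k)))"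
  have q: "0 \<le> q" unfolding q_def by (intro sum_nonneg) simp
  have s: "0 \<le> s" unfolding s_def using T_pos by simp
  \<comment> \<open>A single constant has to bound the functionals, which takes
    \<open>q * W\<close>, and to multiply their sum, which takes \<open>L * s\<close>.\<close>
  define B where "B = L * s + q * W"
  have B: "0 \<le> B" using L_nonneg W_nonneg q s by (simp add: B_def)
  have l_le: "\<bar>l i f\<bar> \<le> B * l2_norm M f" if i: "i < CARD('n) * n" and f: "f \<in> l2_space M" for i f
  proof -
    have "b i \<in> I" using bij_betwE[OF b] i by blast
    then have k: "snd (b i) < n" by (simp add: I_def mem_Times_iff)
    let ?J = "indicator (subint T n (snd (b i)))"
    have "\<bar>l i f\<bar> \<le> l2_norm N ?J * l2_norm N (U (fst (b i)) f)"
      using l2_Cauchy_Schwarz[OF ind U_l2(1)[OF f]] by (simp add: l_def m_def l2_inner_def)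
    also have "\<dots> \<le> q * (W * l2_norm M f)"
    proof (intro mult_mono U_l2(2)[OF f])
      show "l2_norm N ?J \<le> q" unfolding q_def using k by (intro member_le_sum) auto
    qed (use q in auto)
    also have "\<dots> = (q * W) * l2_norm M f" by simp
    also have "\<dots> \<le> B * l2_norm M f"
      using L_nonneg s by (intro mult_right_mono) (auto simp: B_def)
    finally show ?thesis .
  qed
  have "l2_norm N (A f) \<le>
          (L * real CARD('n) * (3 * T powr \<theta> * W)) * real n powr (-\<theta>) * l2_norm M f
          + B * (\<Sum>i<CARD('n)*n. \<bar>l i f\<bar>)" if f: "f \<in> l2_space M" for f
  proof -
    let ?r = "3 * T powr \<theta> * W * real n powr (-\<theta>) * l2_norm M f"
    have U: "l2_norm N (U j f) \<le> ?r + s * (\<Sum>k<n. \<bar>m k j f\<bar>)" for j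
    proof -
      have "l2_norm N (U j f) \<le> 3 * (T / real n) powr \<theta> * l2_norm N (v f) + s * (\<Sum>k<n. \<bar>m k j f\<bar>)"
        unfolding s_def m_def
        by (rule l2_piecewise_mean_bound[where P = "good f"])
          (use T_pos n theta f in \<open>auto intro: U_l2 v_l2 v_nonneg AE_good U_diff_le\<close>)
      also have "3 * (T / real n) powr \<theta> * l2_norm N (v f) \<le> 3 * (T / real n) powr \<theta> * (W * l2_norm M f)"
        by (intro mult_left_mono v_l2 f) simp
      also have "\<dots> = ?r" using T_pos by (simp add: powr_divide powr_minus_divide)
      finally show ?thesis by simp
    qed
    have "l2_norm N (A f) \<le> L * (\<Sum>j\<in>UNIV. ?r + s * (\<Sum>k<n. \<bar>m k j f\<bar>))"
      by (rule A_bound(2)[OF f U])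
    also have "\<dots> = (L * real CARD('n) * (3 * T powr \<theta> * W)) * real n powr (-\<theta>) * l2_norm M f
        + (L * s) * (\<Sum>i<CARD('n)*n. \<bar>l i f\<bar>)"
      unfolding l_sum by (simp add: sum.distrib distrib_left mult_ac flip: sum_distrib_left)
    also have "(L * s) * (\<Sum>i<CARD('n)*n. \<bar>l i f\<bar>) \<le> B * (\<Sum>i<CARD('n)*n. \<bar>l i f\<bar>)"
      using q W_nonneg by (intro mult_right_mono) (auto simp: B_def sum_nonneg)
    finally show ?thesis by simp
  qed
  moreover have "l i (\<lambda>x. a * f x + b * h x) = a * l i f + b * l i h"
    if "f \<in> l2_space M" "h \<in> l2_space M" for i f h a b
    unfolding l_def by (rule m_lincomb[OF that])
  ultimately show ?thesis
    using B l_le by (intro exI[of _ l] exI[of _ B]) blast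
qed

lemma approximable:
  "approximable_operator M N A CARD('n) (L * real CARD('n) * (3 * T powr \<theta> * W)) \<theta>"
proof unfold_locales
  show "A f \<in> l2_space N" if "f \<in> l2_space M" for f
    by (rule A_bound(1)[OF that order_refl])
  show "0 \<le> L * real CARD('n) * (3 * T powr \<theta> * W)" using L_nonneg W_nonneg by simp
qed (use A_lincomb approximation_by_means theta in \<open>auto simp: Suc_le_eq\<close>)

end

section \<open>Smooth cutoff functions\<close>

text \<open>Peeling off the first derivative lets the closure properties go by induction with
  \<open>f\<close> arbitrary. The lemma \<open>smooth_iff_iterates\<close> translates to the
  iterated derivatives of \<open>test_function\<close>.\<close>

fun times_differentiable :: "nat \<Rightarrow> (real \<Rightarrow> real) \<Rightarrow> bool" where
  "times_differentiable 0 f \<longleftrightarrow> True"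
| "times_differentiable (Suc n) f \<longleftrightarrow>
     (\<forall>x. f field_differentiable at x) \<and> times_differentiable n (deriv f)"

definition smooth :: "(real \<Rightarrow> real) \<Rightarrow> bool" where
  "smooth f \<longleftrightarrow> (\<forall>n. times_differentiable n f)"

lemma times_differentiable_Suc_D: "times_differentiable (Suc n) f \<Longrightarrow> times_differentiable n f"
  by (induction n arbitrary: f) auto

lemma times_differentiable_SucI:
  assumes "\<And>x. (f has_real_derivative f' x) (at x)" "times_differentiable n f'"
  shows "times_differentiable (Suc n) f"
proof -
  have "deriv f = f'" using assms(1) by (auto intro!: DERIV_imp_deriv)
  then show ?thesis using assms by (auto simp: field_differentiable_def)
qed

lemma times_differentiable_SucE:
  assumes "times_differentiable (Suc n) f"
  shows "(f has_real_derivative deriv f x) (at x)" "times_differentiable n (deriv f)"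
  using assms by (auto simp: field_differentiable_derivI)

lemma times_differentiable_iterate: "(\<forall>k<n. \<forall>x. (deriv ^^ k) f field_differentiable at x) \<longleftrightarrow> times_differentiable n f"
proof (induction n arbitrary: f)
  case (Suc n)
  have "(\<forall>k<Suc n. \<forall>x. (deriv ^^ k) f field_differentiable at x)
      \<longleftrightarrow> (\<forall>x. f field_differentiable at x) \<and> (\<forall>k<n. \<forall>x. (deriv ^^ Suc k) f field_differentiable at x)"
    by (simp add: All_less_Suc2)
  also have "\<dots> \<longleftrightarrow> times_differentiable (Suc n) f"
    using Suc.IH[of "deriv f"] by (simp add: funpow_swap1)
  finally show ?case .
qed simp

lemma smooth_iff_iterates: "smooth f \<longleftrightarrow> (\<forall>k x. (deriv ^^ k) f field_differentiable at x)"
  unfolding smooth_def times_differentiable_iterate[symmetric] by blast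

lemma smooth_has_derivative:
  assumes "smooth f"
  shows "(f has_real_derivative deriv f x) (at x)"
  using assms times_differentiable_SucE(1) unfolding smooth_def by blast

lemma smooth_deriv: "smooth f \<Longrightarrow> smooth (deriv f)"
  unfolding smooth_def using times_differentiable_SucE(2) by blast

lemma smoothI_deriv:
  assumes "\<And>x. (f has_real_derivative f' x) (at x)" "smooth f'"
  shows "smooth f"
  unfolding smooth_def
proof
  show "times_differentiable n f" for n
    using times_differentiable_SucI[OF assms(1), of n] assms(2) times_differentiable_Suc_D
    unfolding smooth_def by blast
qed

lemma smooth_continuous: "smooth f \<Longrightarrow> continuous_on S f"
  by (meson DERIV_continuous_on has_field_derivative_at_within smooth_has_derivative)

section \<open>Closure properties of smooth functions\<close>

lemma times_differentiable_const: "times_differentiable n (\<lambda>x. c)"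
proof (induction n arbitrary: c)
  case (Suc n)
  show ?case by (rule times_differentiable_SucI[OF DERIV_const Suc.IH])
qed simp

lemma times_differentiable_add:
  "times_differentiable n f \<Longrightarrow> times_differentiable n g \<Longrightarrow> times_differentiable n (\<lambda>x. f x + g x)"
proof (induction n arbitrary: f g)
  case (Suc n)
  show ?case
    by (rule times_differentiable_SucI[OF DERIV_add[OF times_differentiable_SucE(1)[OF Suc.prems(1)]
      times_differentiable_SucE(1)[OF Suc.prems(2)]]])
     (intro Suc.IH times_differentiable_SucE(2) Suc.prems)
qed simp

lemma times_differentiable_mult:
  "times_differentiable n f \<Longrightarrow> times_differentiable n g \<Longrightarrow> times_differentiable n (\<lambda>x. f x * g x)"
proof (induction n arbitrary: f g)
  case (Suc n)
  show ?case
    by (rule times_differentiable_SucI[OF DERIV_mult[OF times_differentiable_SucE(1)[OF Suc.prems(1)]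
      times_differentiable_SucE(1)[OF Suc.prems(2)]]])
     (intro times_differentiable_add Suc.IH times_differentiable_SucE(2) Suc.prems
        times_differentiable_Suc_D[OF Suc.prems(1)] times_differentiable_Suc_D[OF Suc.prems(2)])
qed simp

lemma times_differentiable_inverse:
  "times_differentiable n f \<Longrightarrow> (\<And>x. f x \<noteq> 0) \<Longrightarrow> times_differentiable n (\<lambda>x. inverse (f x))"
proof (induction n arbitrary: f)
  case (Suc n)
  have "((\<lambda>x. inverse (f x)) has_real_derivative (- 1) * (deriv f x * (inverse (f x) * inverse (f x)))) (at x)" for x
    using DERIV_inverse_fun[OF times_differentiable_SucE(1)[OF Suc.prems(1)] Suc.prems(2), of x]
    by (simp add: power2_eq_square mult_ac)
  moreover have "times_differentiable n (\<lambda>x. (- 1) * (deriv f x * (inverse (f x) * inverse (f x))))"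
    by (intro times_differentiable_mult times_differentiable_const Suc.IH Suc.prems(2)
      times_differentiable_SucE(2)[OF Suc.prems(1)] times_differentiable_Suc_D[OF Suc.prems(1)])
  ultimately show ?case by (rule times_differentiable_SucI)
qed simp

lemma times_differentiable_affine:
  "times_differentiable n f \<Longrightarrow> times_differentiable n (\<lambda>x. f (a * x + b))"
proof (induction n arbitrary: f)
  case (Suc n)
  have "((\<lambda>x. a * x + b) has_real_derivative a) (at x)" for x
    by (auto intro!: derivative_eq_intros)
  from DERIV_chain2[OF times_differentiable_SucE(1)[OF Suc.prems] this]
  have "((\<lambda>x. f (a * x + b)) has_real_derivative deriv f (a * x + b) * a) (at x)" for x .
  moreover have "times_differentiable n (\<lambda>x. deriv f (a * x + b) * a)"
    by (intro times_differentiable_mult times_differentiable_const Suc.IH times_differentiable_SucE(2)[OF Suc.prems])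
  ultimately show ?case by (rule times_differentiable_SucI)
qed simp

lemma smooth_const: "smooth (\<lambda>x. c)"
  and smooth_add: "smooth f \<Longrightarrow> smooth g \<Longrightarrow> smooth (\<lambda>x. f x + g x)"
  and smooth_mult: "smooth f \<Longrightarrow> smooth g \<Longrightarrow> smooth (\<lambda>x. f x * g x)"
  and smooth_inverse: "smooth f \<Longrightarrow> (\<And>x. f x \<noteq> 0) \<Longrightarrow> smooth (\<lambda>x. inverse (f x))"
  and smooth_affine: "smooth f \<Longrightarrow> smooth (\<lambda>x. f (a * x + b))"
  unfolding smooth_def
  by (simp_all add: times_differentiable_const times_differentiable_add times_differentiable_mult
      times_differentiable_inverse times_differentiable_affine)

lemma smooth_diff: "smooth f \<Longrightarrow> smooth g \<Longrightarrow> smooth (\<lambda>x. f x - g x)"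
  using smooth_add[OF _ smooth_mult[OF smooth_const[of "-1"]], of f g] by simp

text \<open>The classical flat function \<open>exp (- 1 / x)\<close> with a polynomial factor in
  \<open>1 / x\<close>: the family is closed under differentiation, so smoothness of all members
  follows by one induction.\<close>

definition flat :: "real poly \<Rightarrow> real \<Rightarrow> real" where
  "flat p x = (if x \<le> 0 then 0 else poly p (1 / x) * exp (- (1 / x)))"

lemma poly_times_exp_decay: "((\<lambda>y. poly p y * exp (- y)) \<longlongrightarrow> 0) at_top" for p :: "real poly"
proof -
  have "((\<lambda>y. \<Sum>i\<le>degree p. coeff p i * (y ^ i / exp y)) \<longlongrightarrow> (\<Sum>i\<le>degree p. coeff p i * 0)) at_top"
    by (intro tendsto_intros tendsto_power_div_exp_0)
  then show ?thesis by (simp add: poly_altdef sum_distrib_right exp_minus divide_inverse mult.assoc)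
qed

text \<open>With \<open>y = 1 / x\<close> the derivative of \<open>y\<close> is
  \<open>- y * y\<close>, which produces the factor \<open>[:0, 0, 1:]\<close>. At 0 the difference
  quotient from the right is \<open>y * poly p y * exp (- y)\<close>, and the exponential wins as
  \<open>y\<close> tends to infinity.\<close>

lemma flat_has_derivative:
  "(flat p has_real_derivative flat ([:0, 0, 1:] * (p - pderiv p)) x) (at x)"
proof (cases x "0 :: real" rule: linorder_cases)
  case less
  have "eventually (\<lambda>y. flat p y = 0) (nhds x)"
    using eventually_nhds_in_open[of "{..<0}" x] less by (auto simp: flat_def elim!: eventually_mono)
  then have "(flat p has_real_derivative 0) (at x)"
    by (subst DERIV_cong_ev[of x x _ "\<lambda>_. 0"]) auto
  then show ?thesis using less by (simp add: flat_def)
next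
  case equal
  have "((\<lambda>y. (flat p y - flat p 0) / (y - 0)) \<longlongrightarrow> 0) (at 0)"
  proof (rule filterlim_split_at)
    have "eventually (\<lambda>y. (flat p y - flat p 0) / (y - 0) = 0) (at_left (0::real))"
      by (intro eventually_at_leftI[of "-1"]) (auto simp: flat_def)
    then show "((\<lambda>y. (flat p y - flat p 0) / (y - 0)) \<longlongrightarrow> 0) (at_left 0)"
      by (rule tendsto_eventually)
    have "((\<lambda>y. poly ([:0, 1:] * p) (inverse y) * exp (- inverse y)) \<longlongrightarrow> 0) (at_right (0::real))"
      by (rule filterlim_compose[OF poly_times_exp_decay filterlim_inverse_at_top_right])
    moreover have "eventually (\<lambda>y. poly ([:0, 1:] * p) (inverse y) * exp (- inverse y)
        = (flat p y - flat p 0) / (y - 0)) (at_right (0::real))"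
      by (intro eventually_at_rightI[of _ 1]) (auto simp: flat_def field_simps)
    ultimately show "((\<lambda>y. (flat p y - flat p 0) / (y - 0)) \<longlongrightarrow> 0) (at_right 0)"
      by (rule Lim_transform_eventually)
  qed
  then show ?thesis using equal by (simp add: has_field_derivative_iff flat_def)
next
  case greater
  have "eventually (\<lambda>y. flat p y = poly p (1 / y) * exp (- (1 / y))) (nhds x)"
    using eventually_nhds_in_open[of "{0<..}" x] greater by (auto simp: flat_def elim!: eventually_mono)
  moreover have "((\<lambda>y. poly p (1 / y) * exp (- (1 / y))) has_real_derivative
      flat ([:0, 0, 1:] * (p - pderiv p)) x) (at x)"
  proof -
    have inv: "((\<lambda>y. 1 / y) has_real_derivative - (1 / (x * x))) (at x)"
      using greater by (auto intro!: derivative_eq_intros)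
    show ?thesis
      by (rule DERIV_cong[OF DERIV_mult[OF DERIV_chain2[OF poly_DERIV inv] DERIV_chain2[OF DERIV_exp DERIV_minus[OF inv]]]])
        (use greater in \<open>simp add: flat_def algebra_simps\<close>)
  qed
  ultimately show ?thesis by (subst DERIV_cong_ev[OF refl _ refl]) auto
qed

lemma smooth_flat: "smooth (flat p)"
proof -
  have "times_differentiable n (flat p)" for n
  proof (induction n arbitrary: p)
    case (Suc n)
    show ?case by (rule times_differentiable_SucI[OF flat_has_derivative Suc.IH])
  qed simp
  then show ?thesis by (simp add: smooth_def)
qed

text \<open>The denominator is positive because \<open>x\<close> and \<open>1 - x\<close> are never
  both nonpositive. The argument \<open>1 - x\<close> is written in the shape of
  \<open>smooth_affine\<close>.\<close>

definition smooth_step :: "real \<Rightarrow> real" where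
  "smooth_step x = flat 1 x * inverse (flat 1 x + flat 1 ((- 1) * x + 1))"

lemma flat_1_nonneg: "0 \<le> flat 1 x"
  by (simp add: flat_def)

lemma flat_1_sum_pos: "0 < flat 1 x + flat 1 ((- 1) * x + 1)"
  by (auto simp: flat_def add_pos_pos)

lemma smooth_smooth_step: "smooth smooth_step"
  unfolding smooth_step_def[abs_def]
  by (intro smooth_mult smooth_inverse smooth_add smooth_flat smooth_affine) (metis flat_1_sum_pos less_irrefl)

lemma smooth_step_eq_0: "x \<le> 0 \<Longrightarrow> smooth_step x = 0"
  by (simp add: smooth_step_def flat_def)

lemma smooth_step_eq_1: "1 \<le> x \<Longrightarrow> smooth_step x = 1"
  by (simp add: smooth_step_def flat_def)

lemma smooth_step_bounds: "0 \<le> smooth_step x" "smooth_step x \<le> 1"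
proof -
  have f: "0 \<le> flat 1 x" "0 \<le> flat 1 ((- 1) * x + 1)" by (rule flat_1_nonneg)+
  then show "0 \<le> smooth_step x" unfolding smooth_step_def by (intro mult_nonneg_nonneg) auto
  show "smooth_step x \<le> 1" using f flat_1_sum_pos[of x]
    unfolding smooth_step_def by (simp add: field_simps)
qed

lemma deriv_smooth_step_outside:
  assumes "x < 0 \<or> 1 < x"
  shows "deriv smooth_step x = 0"
proof -
  have "\<exists>c. eventually (\<lambda>y. smooth_step y = c) (nhds x)"
  proof (cases "x < 0")
    case True
    then show ?thesis using eventually_nhds_in_open[of "{..<0}" x]
      by (intro exI[of _ 0]) (auto simp: smooth_step_eq_0 elim!: eventually_mono)
  next
    case False
    then show ?thesis using eventually_nhds_in_open[of "{1<..}" x] assms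
      by (intro exI[of _ 1]) (auto simp: smooth_step_eq_1 elim!: eventually_mono)
  qed
  then obtain c where "eventually (\<lambda>y. smooth_step y = c) (nhds x)" by blast
  then have "(smooth_step has_real_derivative 0) (at x)"
    by (subst DERIV_cong_ev[of x x _ "\<lambda>_. c"]) auto
  then show ?thesis by (rule DERIV_imp_deriv)
qed

lemma deriv_smooth_step_bounded:
  obtains C where "0 \<le> C" "\<And>x. \<bar>deriv smooth_step x\<bar> \<le> C"
proof -
  have "compact (deriv smooth_step ` {0..1})"
    by (intro compact_continuous_image smooth_continuous smooth_deriv smooth_smooth_step) simp
  then obtain C where C: "\<And>y. y \<in> deriv smooth_step ` {0..1} \<Longrightarrow> norm y \<le> C"
    using compact_imp_bounded bounded_iff by metis
  have "\<bar>deriv smooth_step x\<bar> \<le> max C 0" for x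
    using C[of "deriv smooth_step x"] deriv_smooth_step_outside[of x]
    by (cases "x < 0 \<or> 1 < x") auto
  then show ?thesis using that[of "max C 0"] by simp
qed

text \<open>A smooth substitute for the positive part. The difference of two shifted ramps has the
  difference of two steps as its derivative, which is how hills are built from cutoffs.\<close>

definition smooth_ramp :: "real \<Rightarrow> real" where
  "smooth_ramp x = (LBINT y=0..x. smooth_step y)"

lemma smooth_ramp_has_derivative: "(smooth_ramp has_real_derivative smooth_step x) (at x)"
proof -
  have "((\<lambda>u. LBINT y=0..u. smooth_step y) has_vector_derivative smooth_step x)
      (at x within {min 0 x - 1..max 0 x + 1})"
    using interval_integral_FTC2[of "min 0 x - 1" 0 "max 0 x + 1" smooth_step x]
      smooth_continuous[OF smooth_smooth_step] by (simp add: zero_ereal_def)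
  moreover have "at x within {min 0 x - 1..max 0 x + 1} = at x"
    by (rule at_within_interior) auto
  ultimately show ?thesis
    by (simp add: smooth_ramp_def[abs_def] has_real_derivative_iff_has_vector_derivative)
qed

lemma smooth_ramp_diff:
  assumes "x \<le> y"
  shows "0 \<le> smooth_ramp y - smooth_ramp x" "smooth_ramp y - smooth_ramp x \<le> y - x"
    and "1 \<le> x \<Longrightarrow> smooth_ramp y - smooth_ramp x = y - x"
    and "y \<le> 0 \<Longrightarrow> smooth_ramp y - smooth_ramp x = 0"
proof -
  have "\<exists>z. x \<le> z \<and> z \<le> y \<and> smooth_ramp y - smooth_ramp x = (y - x) * smooth_step z"
  proof (cases "x = y")
    case False
    then show ?thesis using MVT2[of x y smooth_ramp smooth_step] smooth_ramp_has_derivative assms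
      by (metis less_le)
  qed auto
  then obtain z where z: "x \<le> z" "z \<le> y" "smooth_ramp y - smooth_ramp x = (y - x) * smooth_step z" by blast
  show "0 \<le> smooth_ramp y - smooth_ramp x" using z smooth_step_bounds[of z] assms by simp
  show "smooth_ramp y - smooth_ramp x \<le> y - x"
    using z smooth_step_bounds[of z] assms by (simp add: mult_left_le)
  show "1 \<le> x \<Longrightarrow> smooth_ramp y - smooth_ramp x = y - x" using z by (simp add: smooth_step_eq_1)
  show "y \<le> 0 \<Longrightarrow> smooth_ramp y - smooth_ramp x = 0" using z by (simp add: smooth_step_eq_0)
qed

section \<open>Sobolev functions on an interval\<close>

lemma test_functionI:
  assumes "smooth \<phi>" "\<And>x. x \<notin> {a..b} \<Longrightarrow> \<phi> x = 0" "{a..b} \<subseteq> U"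
  shows "test_function U \<phi>"
proof -
  have "closure {x. \<phi> x \<noteq> 0} \<subseteq> {a..b}" using assms(2) by (intro closure_minimal) (blast, simp)
  moreover have "compact ({a..b} \<inter> closure {x. \<phi> x \<noteq> 0})" by (intro compact_Int_closed) auto
  ultimately show ?thesis
    using assms(1,3) by (auto simp: test_function_def smooth_iff_iterates[symmetric] inf_absorb2)
qed

text \<open>For large \<open>m\<close> a smooth approximation of the indicator of
  \<open>{a<..b}\<close>. Its derivative is the difference of two bumps of integral 1, located
  within distance \<open>1 / m\<close> to the right of \<open>a\<close> and of
  \<open>b\<close>.\<close>

definition smooth_cutoff :: "real \<Rightarrow> real \<Rightarrow> real \<Rightarrow> real \<Rightarrow> real" where
  "smooth_cutoff m a b x = smooth_step (m * x + (- (m * a))) - smooth_step (m * x + (- (m * b)))"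

text \<open>For large \<open>m\<close> a smooth approximation of the function that is 0 up to
  \<open>a\<close>, affine on \<open>[a, b]\<close> and 1 afterwards. Its derivative is the cutoff
  divided by \<open>b - a\<close>, so pairing a weak derivative with it leads to a difference
  quotient.\<close>

definition smooth_hill :: "real \<Rightarrow> real \<Rightarrow> real \<Rightarrow> real \<Rightarrow> real" where
  "smooth_hill m a b x = (smooth_ramp (m * x + (- (m * a))) - smooth_ramp (m * x + (- (m * b)))) / (m * (b - a))"

lemma affine_has_derivative: "((\<lambda>x. m * x + c) has_real_derivative m) (at x)"
  by (auto intro!: derivative_eq_intros)

lemma smooth_cutoff_has_derivative:
  "(smooth_cutoff m a b has_real_derivative
     deriv smooth_step (m * x + (- (m * a))) * m - deriv smooth_step (m * x + (- (m * b))) * m) (at x)"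
  unfolding smooth_cutoff_def[abs_def]
  by (intro DERIV_diff DERIV_chain2[OF smooth_has_derivative[OF smooth_smooth_step] affine_has_derivative])

lemma smooth_smooth_cutoff: "smooth (smooth_cutoff m a b)"
  unfolding smooth_cutoff_def[abs_def] by (intro smooth_diff smooth_affine smooth_smooth_step)

lemma smooth_cutoff_outside:
  assumes "0 < m" "a \<le> b" "x \<notin> {a..b + 1 / m}"
  shows "smooth_cutoff m a b x = 0"
proof -
  consider "x < a" | "x > b + 1 / m" using assms by fastforce
  then show ?thesis
  proof cases
    case 1
    then have "m * x + (- (m * a)) \<le> 0" "m * x + (- (m * b)) \<le> 0"
      using assms by (simp_all add: mult_left_mono)
    then show ?thesis by (simp only: smooth_cutoff_def smooth_step_eq_0)
  next
    case 2
    then have "m * b + 1 \<le> m * x" using assms by (simp add: field_simps)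
    moreover have "m * a \<le> m * b" using assms by (simp add: mult_left_mono)
    ultimately have "1 \<le> m * x + (- (m * a))" "1 \<le> m * x + (- (m * b))" by linarith+
    then show ?thesis by (simp only: smooth_cutoff_def smooth_step_eq_1)
  qed
qed

lemma smooth_cutoff_bound: "\<bar>smooth_cutoff m a b x\<bar> \<le> 1"
  using smooth_step_bounds[of "m * x + (- (m * a))"] smooth_step_bounds[of "m * x + (- (m * b))"]
  unfolding smooth_cutoff_def by linarith

lemma smooth_hill_has_derivative:
  assumes "0 < m"
  shows "(smooth_hill m a b has_real_derivative smooth_cutoff m a b x / (b - a)) (at x)"
proof -
  have "((\<lambda>x. smooth_ramp (m * x + (- (m * a))) - smooth_ramp (m * x + (- (m * b))))
      has_real_derivative smooth_step (m * x + (- (m * a))) * m - smooth_step (m * x + (- (m * b))) * m) (at x)"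
    by (intro DERIV_diff DERIV_chain2[OF smooth_ramp_has_derivative affine_has_derivative])
  from DERIV_cdivide[OF this, of "m * (b - a)"] show ?thesis
    using assms unfolding smooth_hill_def[abs_def] smooth_cutoff_def
    by (simp flip: left_diff_distrib)
qed

lemma smooth_smooth_hill: "0 < m \<Longrightarrow> smooth (smooth_hill m a b)"
proof (rule smoothI_deriv[OF smooth_hill_has_derivative])
  show "smooth (\<lambda>x. smooth_cutoff m a b x / (b - a))"
    unfolding divide_inverse by (intro smooth_mult smooth_smooth_cutoff smooth_const)
qed

lemma smooth_hill_eq:
  assumes "0 < m" "a < b"
  shows "x \<le> a \<Longrightarrow> smooth_hill m a b x = 0" "b + 1 / m \<le> x \<Longrightarrow> smooth_hill m a b x = 1"
    and "0 \<le> smooth_hill m a b x" "smooth_hill m a b x \<le> 1"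
proof -
  have le: "m * x + (- (m * b)) \<le> m * x + (- (m * a))" using assms by simp
  note r = smooth_ramp_diff[OF le]
  have d: "m * x + (- (m * a)) - (m * x + (- (m * b))) = m * (b - a)" by (simp add: algebra_simps)
  have pos: "0 < m * (b - a)" using assms by simp
  show "smooth_hill m a b x = 0" if "x \<le> a"
    using r(4) that assms by (simp add: smooth_hill_def)
  show "smooth_hill m a b x = 1" if "b + 1 / m \<le> x"
  proof -
    have "1 \<le> m * x + (- (m * b))" using that assms by (simp add: field_simps)
    from r(3)[OF this] show ?thesis unfolding smooth_hill_def d using assms by simp
  qed
  show "0 \<le> smooth_hill m a b x" unfolding smooth_hill_def using r(1) pos by (intro divide_nonneg_pos) auto
  show "smooth_hill m a b x \<le> 1" unfolding smooth_hill_def using r(2) pos unfolding d by simp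
qed

text \<open>The weight is supported in \<open>[a, a + 1 / m]\<close> and has integral 1, so the
  integral is a weighted mean of \<open>h\<close> near \<open>a\<close>. The estimate works without
  the sign of the weight: its size is at most \<open>C * m\<close> on an interval of length
  \<open>1 / m\<close>.\<close>

lemma approximate_identity_limit:
  assumes h: "continuous_on {0..T} h" and a: "0 < a" "a < T"
  shows "(\<lambda>m. LINT x|lebesgue_on {0<..<T}.
      h x * (deriv smooth_step (real m * x + (- (real m * a))) * real m)) \<longlonglongrightarrow> h a"
proof (rule LIMSEQ_I)
  fix e :: real assume e: "e > 0"
  obtain C where C: "0 \<le> C" "\<And>x. \<bar>deriv smooth_step x\<bar> \<le> C" using deriv_smooth_step_bounded by blast
  define \<epsilon> where "\<epsilon> = e / (2 * (C + 1))"
  have \<epsilon>: "\<epsilon> > 0" using e C by (simp add: \<epsilon>_def)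
  have "continuous (at a within {0..T}) h" using h a by (auto simp: continuous_on_eq_continuous_within)
  then obtain d where d: "d > 0" "\<And>x. x \<in> {0..T} \<Longrightarrow> \<bar>x - a\<bar> < d \<Longrightarrow> \<bar>h x - h a\<bar> < \<epsilon>"
    unfolding continuous_within_eps_delta using \<epsilon> by (auto simp: dist_real_def)
  \<comment> \<open>For \<open>m \<ge> M\<close> the length \<open>1 / m\<close> is below
    \<open>d\<close>, where continuity of \<open>h\<close> applies, and below \<open>T - a\<close>,
    so that the support stays inside the interval.\<close>
  obtain M where M: "real M > 1 / min d (T - a)" using reals_Archimedean2 by blast
  have "norm ((LINT x|lebesgue_on {0<..<T}. h x * (deriv smooth_step (real m * x + (- (real m * a))) * real m)) - h a) < e"
    if m: "m \<ge> M" for m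
  proof -
    define k where "k x = deriv smooth_step (real m * x + (- (real m * a))) * real m" for x
    have "1 / min d (T - a) < real m" using M m by linarith
    moreover have mn: "0 < min d (T - a)" using d a by simp
    ultimately have m0: "0 < real m" using less_trans[of 0 "1 / min d (T - a)" "real m"] by simp
    have "1 / real m < c" if "1 / c < real m" "0 < c" for c
      using that m0 by (simp add: divide_less_eq mult.commute)
    from this[OF \<open>1 / min d (T - a) < real m\<close> mn]
    have md: "1 / real m < d" "1 / real m < T - a" by simp_all
    define S where "S = {a..a + 1 / real m}"
    have S: "S \<subseteq> {0<..<T}" using a md unfolding S_def by auto
    have k0: "k x = 0" if "x \<notin> S" for x
    proof -
      have "real m * x + (- (real m * a)) < 0 \<or> 1 < real m * x + (- (real m * a))"
        using that m0 unfolding S_def by (auto simp: field_simps not_le)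
      then show ?thesis using deriv_smooth_step_outside unfolding k_def by simp
    qed
    have contk: "continuous_on S k"
      unfolding k_def
      by (intro continuous_intros continuous_on_compose2[OF smooth_continuous[OF smooth_deriv[OF smooth_smooth_step], of UNIV]]) auto
    have conth: "continuous_on S h" using S by (intro continuous_on_subset[OF h]) auto
    have "(LINT x|lebesgue_on {0<..<T}. h x * k x) = (LINT x|lebesgue_on {0<..<T}. (if x \<in> S then h x * k x else 0))"
      by (rule Bochner_Integration.integral_cong) (auto simp: k0)
    also have "\<dots> = (LINT x|lebesgue_on S. h x * k x)"
      using S by (intro integral_restrict) (auto simp: S_def)
    also have "\<dots> = integral S (\<lambda>x. h x * k x)"
      by (intro lebesgue_integral_eq_integral)
        (auto simp: S_def intro!: continuous_imp_integrable_real continuous_on_mult contk[unfolded S_def] conth[unfolded S_def])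
    finally have eq: "(LINT x|lebesgue_on {0<..<T}. h x * k x) = integral S (\<lambda>x. h x * k x)" .
    have "(k has_integral (smooth_step (real m * (a + 1 / real m) + (- (real m * a)))
        - smooth_step (real m * a + (- (real m * a))))) S"
      unfolding S_def
    proof (rule fundamental_theorem_of_calculus)
      show "((\<lambda>x. smooth_step (real m * x + (- (real m * a)))) has_vector_derivative k x)
          (at x within {a..a + 1 / real m})" for x
        unfolding k_def has_real_derivative_iff_has_vector_derivative[symmetric]
        by (rule has_field_derivative_at_within[OF
          DERIV_chain2[OF smooth_has_derivative[OF smooth_smooth_step] affine_has_derivative]])
    qed (use m0 in simp)
    moreover have "smooth_step (real m * (a + 1 / real m) + (- (real m * a))) = 1"
      using m0 by (intro smooth_step_eq_1) (simp add: field_simps)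
    ultimately have k1: "(k has_integral 1) S" by (simp add: smooth_step_eq_0)
    have i1: "(\<lambda>x. h x * k x) integrable_on S"
      using contk conth unfolding S_def by (intro integrable_continuous_real continuous_on_mult)
    have "integral S (\<lambda>x. h x * k x) - h a = integral S (\<lambda>x. h x * k x) - integral S (\<lambda>x. h a * k x)"
      using integral_unique[OF has_integral_mult_right[OF k1, of "h a"]] by simp
    also have "\<dots> = integral S (\<lambda>x. h x * k x - h a * k x)"
      by (intro Henstock_Kurzweil_Integration.integral_diff[symmetric] i1)
        (use has_integral_mult_right[OF k1, of "h a"] in blast)
    also have "\<dots> = integral {a..a + 1 / real m} (\<lambda>x. (h x - h a) * k x)"
      unfolding S_def by (intro Henstock_Kurzweil_Integration.integral_cong) (simp only: left_diff_distrib)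
    also have "norm \<dots> \<le> (\<epsilon> * (C * real m)) * (a + 1 / real m - a)"
    proof (rule integral_bound)
      show "a \<le> a + 1 / real m" using m0 by simp
      show "continuous_on {a..a + 1 / real m} (\<lambda>x. (h x - h a) * k x)"
        using contk conth unfolding S_def by (intro continuous_intros)
      show "norm ((h x - h a) * k x) \<le> \<epsilon> * (C * real m)" if "x \<in> {a..a + 1 / real m}" for x
      proof -
        have "\<bar>h x - h a\<bar> < \<epsilon>" using that a md by (intro d(2)) auto
        moreover have "\<bar>k x\<bar> \<le> C * real m" using C(2) unfolding k_def by (simp add: abs_mult mult_right_mono)
        ultimately show ?thesis
          unfolding real_norm_def abs_mult[of "h x - h a"] using \<epsilon> by (intro mult_mono) auto
      qed
    qed
    also have "\<dots> = \<epsilon> * C" using m0 by simp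
    also have "\<dots> < e"
    proof -
      have "\<epsilon> * C \<le> \<epsilon> * (C + 1)" using \<epsilon> by simp
      also have "\<dots> = e / 2" using C by (simp add: \<epsilon>_def field_simps)
      finally show ?thesis using e by simp
    qed
    finally show ?thesis unfolding eq[unfolded k_def] unfolding k_def .
  qed
  then show "\<exists>M. \<forall>m\<ge>M. norm ((LINT x|lebesgue_on {0<..<T}.
      h x * (deriv smooth_step (real m * x + (- (real m * a))) * real m)) - h a) < e" by blast
qed

section \<open>Weak derivatives tested with cutoffs\<close>

lemma finite_measure_interval: "finite_measure (lebesgue_on {0<..<T :: real})"
  by (rule finite_measure_lebesgue_on) simp

lemma eventually_shift_less:
  fixes b T :: real
  assumes "b < T"
  shows "\<forall>\<^sub>F m in sequentially. 0 < real m \<and> b + 1 / real m < T"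
proof -
  have "(\<lambda>m. b + 1 / real m) \<longlonglongrightarrow> b + 0" by (intro tendsto_intros lim_1_over_n)
  then have "\<forall>\<^sub>F m in sequentially. b + 1 / real m < T" using assms by (intro order_tendstoD(2)) auto
  with eventually_gt_at_top[of 0] show ?thesis by eventually_elim auto
qed

text \<open>The cutoff is a test function once \<open>b + 1 / m < T\<close>. Moving the derivative
  onto it leaves the difference of two approximate identities applied to \<open>h\<close>.\<close>

lemma weak_derivative_cutoff_limit:
  assumes h: "continuous_on {0..T} h" and w: "weak_derivative {0<..<T} 1 h g"
    and ab: "0 < a" "a < b" "b < T"
  shows "(\<lambda>m. LINT x|lebesgue_on {0<..<T}. g x * smooth_cutoff (real m) a b x) \<longlonglongrightarrow> h b - h a"
proof -
  let ?N = "lebesgue_on {0<..<T}"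
  interpret N: finite_measure ?N by (rule finite_measure_interval)
  let ?k = "\<lambda>m a x. deriv smooth_step (real m * x + (- (real m * a))) * real m"
  obtain C where C: "\<And>x. \<bar>deriv smooth_step x\<bar> \<le> C" using deriv_smooth_step_bounded by blast
  have "bounded (h ` {0..T})" using compact_continuous_image[OF h] by (simp add: compact_imp_bounded)
  then obtain D where "\<forall>y\<in>h ` {0..T}. norm y \<le> D" unfolding bounded_iff by blast
  then have D: "\<bar>h x\<bar> \<le> D" if "x \<in> {0..T}" for x using that by simp
  have i: "integrable ?N (\<lambda>x. h x * ?k m c x)" for m c
  proof (rule N.integrable_const_bound)
    show "AE x in ?N. norm (h x * ?k m c x) \<le> D * (C * real m)"
    proof (rule AE_I2)
      fix x assume "x \<in> space ?N"
      then have "\<bar>h x\<bar> \<le> D" using D by auto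
      moreover have "\<bar>?k m c x\<bar> \<le> C * real m" using C by (simp add: abs_mult mult_right_mono)
      ultimately show "norm (h x * ?k m c x) \<le> D * (C * real m)"
        unfolding real_norm_def abs_mult[of "h x"] by (intro mult_mono) auto
    qed
    have "continuous_on {0<..<T} (\<lambda>x. h x * ?k m c x)"
      by (intro continuous_intros continuous_on_subset[OF h]
        continuous_on_compose2[OF smooth_continuous[OF smooth_deriv[OF smooth_smooth_step], of UNIV]]) auto
    then show "(\<lambda>x. h x * ?k m c x) \<in> borel_measurable ?N"
      by (rule continuous_imp_measurable_on_sets_lebesgue) simp
  qed
  have "(\<lambda>m. (LINT x|?N. h x * ?k m b x) - (LINT x|?N. h x * ?k m a x)) \<longlonglongrightarrow> h b - h a"
    using ab by (intro tendsto_diff approximate_identity_limit h) auto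
  moreover have "\<forall>\<^sub>F m in sequentially. (LINT x|?N. h x * ?k m b x) - (LINT x|?N. h x * ?k m a x)
      = (LINT x|?N. g x * smooth_cutoff (real m) a b x)"
    using eventually_shift_less[OF ab(3)]
  proof eventually_elim
    case (elim m)
    have "test_function {0<..<T} (smooth_cutoff (real m) a b)"
      using elim ab by (intro test_functionI[of _ a "b + 1 / real m"] smooth_smooth_cutoff smooth_cutoff_outside) auto
    then have "(LINT x|?N. h x * (deriv ^^ 1) (smooth_cutoff (real m) a b) x)
        = (-1) ^ 1 * (LINT x|?N. g x * smooth_cutoff (real m) a b x)"
      using w unfolding weak_derivative_def by blast
    moreover have "(deriv ^^ 1) (smooth_cutoff (real m) a b) x = ?k m a x - ?k m b x" for x
      using DERIV_imp_deriv[OF smooth_cutoff_has_derivative] by simp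
    ultimately have "(LINT x|?N. h x * ?k m a x - h x * ?k m b x) = - (LINT x|?N. g x * smooth_cutoff (real m) a b x)"
      by (simp only: right_diff_distrib power_one_right mult_minus1)
    then show ?case using i[of m a] i[of m b] by simp
  qed
  ultimately show ?thesis by (rule Lim_transform_eventually)
qed

abbreviation quot :: "(real \<Rightarrow> 'a::real_vector) \<Rightarrow> real \<Rightarrow> real \<Rightarrow> 'a" where
  "quot h a b \<equiv> (h b - h a) /\<^sub>R (b - a)"

text \<open>The difference of the quotients is the limit of \<open>\<integral> g X' = - \<integral> w X\<close> for test functions \<open>X\<close>
  with \<open>|X| \<le> 1\<close> that vanish outside a neighbourhood of \<open>[a, b]\<close>.\<close>

lemma sobolev2_quotient_bound:
  assumes h: "continuous_on {0..T} h"
    and g: "weak_derivative {0<..<T} 1 h g" "g \<in> l2_space (lebesgue_on {0<..<T})"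
    and w: "weak_derivative {0<..<T} 2 h w" "w \<in> l2_space (lebesgue_on {0<..<T})"
    and ab: "0 < a" "a \<le> a'" "a' < b'" "b' \<le> b" "b < T"
  shows "\<bar>quot h a' b' - quot h a b\<bar> \<le> l2_norm (lebesgue_on {0<..<T}) w * sqrt (b - a)"
proof -
  let ?N = "lebesgue_on {0<..<T}"
  interpret N: finite_measure ?N by (rule finite_measure_interval)
  let ?X = "\<lambda>m x. smooth_hill m a' b' x - smooth_hill m a b x"
  let ?Y = "\<lambda>m x. smooth_cutoff m a' b' x / (b' - a') - smooth_cutoff m a b x / (b - a)"
  let ?I = "\<lambda>m. (LINT x|?N. g x * smooth_cutoff (real m) a' b' x) / (b' - a')
      - (LINT x|?N. g x * smooth_cutoff (real m) a b x) / (b - a)"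
  have cutoff_l2: "smooth_cutoff m c d \<in> l2_space ?N" for m c d
  proof -
    have "smooth_cutoff m c d \<in> borel_measurable ?N"
      by (intro continuous_imp_measurable_on_sets_lebesgue smooth_continuous smooth_smooth_cutoff) simp
    moreover have "(smooth_cutoff m c d x)\<^sup>2 \<le> 1" for x
      using smooth_cutoff_bound[of m c d x] by (simp add: abs_square_le_1)
    ultimately show ?thesis
      unfolding l2_space_def by (auto intro!: N.integrable_const_bound[of _ 1])
  qed
  have ie: "integrable ?N (\<lambda>x. g x * smooth_cutoff m c d x)" for m c d
    by (rule l2_mult_integrable[OF g(2) cutoff_l2])
  have "?I \<longlonglongrightarrow> (h b' - h a') / (b' - a') - (h b - h a) / (b - a)"
    using ab by (intro tendsto_intros weak_derivative_cutoff_limit[OF h g(1)]) auto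
  then have lim: "(\<lambda>m. \<bar>?I m\<bar>) \<longlonglongrightarrow> \<bar>quot h a' b' - quot h a b\<bar>"
    using tendsto_rabs by (auto simp: divide_inverse mult.commute)
  have "(\<lambda>m. l2_norm ?N w * sqrt (b - a + 1 / real m)) \<longlonglongrightarrow> l2_norm ?N w * sqrt (b - a + 0)"
    by (intro tendsto_intros lim_1_over_n)
  then have lim2: "(\<lambda>m. l2_norm ?N w * sqrt (b - a + 1 / real m)) \<longlonglongrightarrow> l2_norm ?N w * sqrt (b - a)"
    by simp
  have "\<forall>\<^sub>F m in sequentially. \<bar>?I m\<bar> \<le> l2_norm ?N w * sqrt (b - a + 1 / real m)"
    using eventually_shift_less[OF ab(5)]
  proof eventually_elim
    case (elim m)
    let ?m = "real m"
    have m: "0 < ?m" using elim by simp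
    have dX: "(?X ?m has_real_derivative ?Y ?m x) (at x)" for x
      by (intro DERIV_diff smooth_hill_has_derivative m)
    have X: "smooth (?X ?m)" by (intro smooth_diff smooth_smooth_hill m)
    have Y: "smooth (?Y ?m)"
      unfolding divide_inverse by (intro smooth_diff smooth_mult smooth_smooth_cutoff smooth_const)
    have X0: "?X ?m x = 0" if "x \<notin> {a..b + 1 / ?m}" for x
    proof (cases "x < a")
      case True
      then show ?thesis using smooth_hill_eq(1)[OF m, of a b x] smooth_hill_eq(1)[OF m, of a' b' x] ab by simp
    next
      case False
      then show ?thesis using smooth_hill_eq(2)[OF m, of a b x] smooth_hill_eq(2)[OF m, of a' b' x] ab that by simp
    qed
    have Y0: "?Y ?m x = 0" if x: "x \<notin> {a..b + 1 / ?m}" for x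
    proof -
      have "x \<notin> {a'..b' + 1 / ?m}" using x ab by auto
      then show ?thesis using smooth_cutoff_outside[OF m, of a b x] smooth_cutoff_outside[OF m, of a' b' x] x ab by simp
    qed
    have sub: "{a..b + 1 / ?m} \<subseteq> {0<..<T}" using elim ab by auto
    have tX: "test_function {0<..<T} (?X ?m)" by (rule test_functionI[OF X X0 sub])
    have tY: "test_function {0<..<T} (?Y ?m)" by (rule test_functionI[OF Y Y0 sub])
    have derivX: "deriv (?X ?m) = ?Y ?m" using DERIV_imp_deriv[OF dX] by (simp add: fun_eq_iff)
    have "(LINT x|?N. h x * (deriv ^^ 2) (?X ?m) x) = (-1) ^ 2 * (LINT x|?N. w x * ?X ?m x)"
      using w(1) tX unfolding weak_derivative_def by blast
    moreover have "(LINT x|?N. h x * (deriv ^^ 1) (?Y ?m) x) = (-1) ^ 1 * (LINT x|?N. g x * ?Y ?m x)"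
      using g(1) tY unfolding weak_derivative_def by blast
    \<comment> \<open>The two weak derivatives meet here: the second one tested with
      \<open>?X\<close> and the first one tested with the derivative \<open>?Y\<close> of
      \<open>?X\<close> have the same left-hand side.\<close>
    moreover have "(deriv ^^ 2) (?X ?m) = (deriv ^^ 1) (?Y ?m)"
      by (simp add: numeral_2_eq_2 derivX)
    ultimately have "(LINT x|?N. g x * ?Y ?m x) = - (LINT x|?N. w x * ?X ?m x)" by simp
    moreover have "(LINT x|?N. g x * ?Y ?m x) = ?I m"
    proof -
      have "(LINT x|?N. g x * ?Y ?m x) = (LINT x|?N. g x * smooth_cutoff ?m a' b' x / (b' - a')
          - g x * smooth_cutoff ?m a b x / (b - a))"
        by (simp add: right_diff_distrib)
      then show ?thesis using ie by simp
    qed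
    ultimately have I: "?I m = - (LINT x|?N. w x * ?X ?m x)" by simp
    have Xb: "(?X ?m x)\<^sup>2 \<le> indicator {a..b + 1 / ?m} x" for x
    proof (cases "x \<in> {a..b + 1 / ?m}")
      case True
      have "\<bar>?X ?m x\<bar> \<le> 1"
        using smooth_hill_eq(3,4)[OF m, of a b x] smooth_hill_eq(3,4)[OF m, of a' b' x] ab by simp
      then show ?thesis using True by (simp add: abs_square_le_1)
    qed (simp add: X0)
    have Xm: "?X ?m \<in> borel_measurable ?N"
      by (intro continuous_imp_measurable_on_sets_lebesgue smooth_continuous X) simp
    have "(\<integral>\<^sup>+x. ennreal ((?X ?m x)\<^sup>2) \<partial>?N) \<le> (\<integral>\<^sup>+x. indicator {a..b + 1 / ?m} x \<partial>?N)"
    proof (rule nn_integral_mono)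
      show "ennreal ((?X ?m x)\<^sup>2) \<le> indicator {a..b + 1 / ?m} x" for x
        using ennreal_leI[OF Xb[of x]] by (simp add: ennreal_indicator)
    qed
    also have "\<dots> = emeasure ?N {a..b + 1 / ?m}"
      using sub by (intro nn_integral_indicator) (auto simp: sets_restrict_space_iff)
    also have "\<dots> = emeasure lebesgue {a..b + 1 / ?m}"
      using sub by (intro emeasure_restrict_space) auto
    also have "\<dots> = ennreal (b + 1 / ?m - a)"
      using ab m by (simp add: add_increasing2)
    also have "b + 1 / ?m - a = (sqrt (b - a + 1 / ?m))\<^sup>2"
      using ab m by simp
    finally have le: "(\<integral>\<^sup>+x. ennreal ((?X ?m x)\<^sup>2) \<partial>?N) \<le> ennreal ((sqrt (b - a + 1 / ?m))\<^sup>2)" .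
    have nn: "0 \<le> sqrt (b - a + 1 / ?m)" using ab m by simp
    note X2 = l2_space_nn_integral[OF Xm le nn]
    have "\<bar>?I m\<bar> \<le> l2_norm ?N w * l2_norm ?N (?X ?m)"
      using l2_Cauchy_Schwarz[OF w(2) X2(1)] unfolding I by (simp add: l2_inner_def)
    also have "\<dots> \<le> l2_norm ?N w * sqrt (b - a + 1 / ?m)" by (intro mult_left_mono X2) simp
    finally show ?case .
  qed
  then show ?thesis by (intro tendsto_le[OF trivial_limit_sequentially lim2 lim])
qed

text \<open>A second evaluation of the cutoff limit, by dominated convergence with majorant
  \<open>\<bar>g x\<bar>\<close>. Since \<open>smooth_step 0 = 0\<close>, the cutoffs converge at
  every point to the indicator of the half-open interval.\<close>

lemma weak_derivative_integral:
  assumes h: "continuous_on {0..T} h"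
    and g: "weak_derivative {0<..<T} 1 h g" "g \<in> l2_space (lebesgue_on {0<..<T})"
    and ab: "0 < a" "a < b" "b < T"
  shows "(LINT x|lebesgue_on {0<..<T}. indicator {a<..b} x * g x) = h b - h a"
proof -
  let ?N = "lebesgue_on {0<..<T}"
  interpret N: finite_measure ?N by (rule finite_measure_interval)
  have conv: "(\<lambda>m. smooth_cutoff (real m) a b x) \<longlonglongrightarrow> indicator {a<..b} x" for x
  proof -
    have step: "(\<lambda>m. smooth_step (real m * x + (- (real m * c)))) \<longlonglongrightarrow> (if x > c then 1 else 0)" for c
    proof (cases "x > c")
      case True
      obtain M where M: "1 / (x - c) < real M" using reals_Archimedean2 by blast
      have "smooth_step (real m * x + (- (real m * c))) = 1" if "m \<ge> M" for m
      proof (rule smooth_step_eq_1)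
        have "1 / (x - c) \<le> real m" using M that by linarith
        then show "1 \<le> real m * x + (- (real m * c))" using True by (simp add: field_simps)
      qed
      then show ?thesis using True by (intro tendsto_eventually) (auto simp: eventually_sequentially)
    next
      case False
      then have "smooth_step (real m * x + (- (real m * c))) = 0" for m
        by (intro smooth_step_eq_0) (simp add: mult_left_mono)
      then show ?thesis using False by simp
    qed
    have "(if x > a then 1 else 0) - (if x > b then 1 else 0) = (indicator {a<..b} x :: real)"
      using ab by (auto split: split_indicator)
    then show ?thesis unfolding smooth_cutoff_def using tendsto_diff[OF step[of a] step[of b]] by simp
  qed
  have "(\<lambda>m. LINT x|?N. g x * smooth_cutoff (real m) a b x) \<longlonglongrightarrow> (LINT x|?N. g x * indicator {a<..b} x)"
  proof (rule integral_dominated_convergence)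
    show "integrable ?N (\<lambda>x. \<bar>g x\<bar>)"
      by (intro integrable_abs N.integral_abs_le_l2_norm g)
    show "(\<lambda>x. g x * indicator {a<..b} x) \<in> borel_measurable ?N"
      using l2_spaceD(1)[OF g(2)] ab
      by (intro borel_measurable_times borel_measurable_indicator) (auto simp: sets_restrict_space_iff)
    show "(\<lambda>x. g x * smooth_cutoff (real m) a b x) \<in> borel_measurable ?N" for m
      by (intro borel_measurable_times[OF l2_spaceD(1)[OF g(2)]]
          continuous_imp_measurable_on_sets_lebesgue smooth_continuous smooth_smooth_cutoff) auto
    show "AE x in ?N. (\<lambda>m. g x * smooth_cutoff (real m) a b x) \<longlonglongrightarrow> g x * indicator {a<..b} x"
      by (intro AE_I2 tendsto_intros conv)
    show "AE x in ?N. norm (g x * smooth_cutoff (real m) a b x) \<le> \<bar>g x\<bar>" for m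
      using smooth_cutoff_bound by (intro AE_I2) (simp add: abs_mult mult_left_le)
  qed
  with weak_derivative_cutoff_limit[OF h g(1) ab]
  have "(LINT x|?N. g x * indicator {a<..b} x) = h b - h a" using LIMSEQ_unique by blast
  then show ?thesis by (simp add: mult.commute)
qed

text \<open>Jensen's inequality for the square, obtained from Cauchy-Schwarz against the indicator
  of \<open>J\<close>. The right-hand side is an extended integral because it will be compared with
  the Slobodeckij seminorm, which has that form.\<close>

lemma (in finite_measure) square_deviation_from_mean:
  assumes f: "f \<in> l2_space M" and J: "J \<in> sets M" "measure M J = \<delta>" "\<delta> > 0"
  shows "ennreal (\<delta> * (c - (LINT x|M. indicator J x * f x) / \<delta>)\<^sup>2)
    \<le> (\<integral>\<^sup>+x. indicator J x * ennreal ((c - f x)\<^sup>2) \<partial>M)"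
proof -
  have ind: "(indicator J :: _ \<Rightarrow> real) \<in> l2_space M"
    by (rule l2_indicator[OF J(1)]) (simp add: less_top[symmetric])
  have d: "(\<lambda>x. c - f x) \<in> l2_space M" by (intro l2_diff l2_const f)
  have sq: "(indicator J x * z)\<^sup>2 = indicator J x * z\<^sup>2" for x and z :: real by (simp split: split_indicator)
  have i1: "integrable M (\<lambda>x. indicator J x * (c - f x)\<^sup>2)"
    using integrable_mult_indicator[OF J(1) l2_spaceD(2)[OF d]] by simp
  have dJ: "(\<lambda>x. indicator J x * (c - f x)) \<in> l2_space M"
    using i1 l2_mult_integrable[OF ind d] by (auto simp: l2_space_def sq)
  have "l2_inner M (indicator J) (\<lambda>x. indicator J x * (c - f x)) = (LINT x|M. indicator J x * c - indicator J x * f x)"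
    unfolding l2_inner_def by (rule Bochner_Integration.integral_cong) (auto split: split_indicator)
  also have "\<dots> = \<delta> * c - (LINT x|M. indicator J x * f x)"
    using J l2_mult_integrable[OF ind f] by (simp add: emeasure_eq_measure)
  finally have inner: "l2_inner M (indicator J) (\<lambda>x. indicator J x * (c - f x))
      = \<delta> * (c - (LINT x|M. indicator J x * f x) / \<delta>)" (is "_ = \<delta> * ?q")
    using J(3) by (simp add: right_diff_distrib)
  have nJ: "(l2_norm M (indicator J))\<^sup>2 = \<delta>"
  proof -
    have "(\<lambda>x. (indicator J x :: real)\<^sup>2) = indicator J" by (auto split: split_indicator)
    then show ?thesis unfolding l2_norm_square using J by simp
  qed
  have "(\<delta> * ?q)\<^sup>2 \<le> (l2_norm M (indicator J) * l2_norm M (\<lambda>x. indicator J x * (c - f x)))\<^sup>2"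
    using power_mono[OF l2_Cauchy_Schwarz[OF ind dJ], of 2] unfolding inner by simp
  also have "\<dots> = \<delta> * (LINT x|M. indicator J x * (c - f x)\<^sup>2)"
    unfolding power_mult_distrib nJ unfolding l2_norm_square sq ..
  finally have "\<delta> * ?q\<^sup>2 \<le> (LINT x|M. indicator J x * (c - f x)\<^sup>2)"
    using J(3) by (simp add: power2_eq_square mult_ac)
  then have "ennreal (\<delta> * ?q\<^sup>2) \<le> ennreal (LINT x|M. indicator J x * (c - f x)\<^sup>2)" by (rule ennreal_leI)
  also have "\<dots> = (\<integral>\<^sup>+x. ennreal (indicator J x * (c - f x)\<^sup>2) \<partial>M)"
    using i1 by (intro nn_integral_eq_integral[symmetric]) auto
  also have "\<dots> = (\<integral>\<^sup>+x. indicator J x * ennreal ((c - f x)\<^sup>2) \<partial>M)"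
    by (intro nn_integral_cong) (auto split: split_indicator)
  finally show ?thesis .
qed

text \<open>The quotients of \<open>h\<close> are means of \<open>g\<close>, so Jensen's inequality in each variable bounds their
  squared difference by the mean of \<open>(g x - g y)\<^sup>2\<close> over the two intervals.\<close>

lemma slobodeckij_quotient_bound:
  assumes h: "continuous_on {0..T} h"
    and g: "weak_derivative {0<..<T} 1 h g" "g \<in> l2_space (lebesgue_on {0<..<T})"
    and S: "(\<integral>\<^sup>+x. (\<integral>\<^sup>+y. ennreal ((g x - g y)\<^sup>2 / \<bar>x - y\<bar> powr (1 + 2 * r))
        \<partial>lebesgue_on {0<..<T}) \<partial>lebesgue_on {0<..<T}) = ennreal S" "0 \<le> S" and r: "0 < r"
    and ab: "0 < a" "a \<le> a'" "a' < b'" "b' \<le> b" "b < T" "b - a \<le> 2 * (b' - a')"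
  shows "\<bar>quot h a' b' - quot h a b\<bar> \<le> sqrt (2 * S) * (b - a) powr (r - 1/2)"
proof -
  let ?N = "lebesgue_on {0<..<T}"
  interpret N: finite_measure ?N by (rule finite_measure_interval)
  define J where "J = {a<..b}"
  define J' where "J' = {a'<..b'}"
  define l where "l = b - a"
  define l' where "l' = b' - a'"
  have l: "0 < l" "0 < l'" "l \<le> 2 * l'" using ab by (auto simp: l_def l'_def)
  have Js: "J \<in> sets ?N" "J' \<in> sets ?N" using ab by (auto simp: sets_restrict_space_iff J_def J'_def)
  have meas: "measure ?N {c<..d} = d - c" if "0 < c" "c < d" "d < T" for c d
  proof -
    have "measure ?N {c<..d} = measure lebesgue {c<..d}"
      using that by (intro measure_restrict_space) auto
    then show ?thesis using that by simp
  qed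
  have mJ: "measure ?N J = l" "measure ?N J' = l'" using ab by (auto simp: J_def J'_def l_def l'_def intro!: meas)
  have int: "(LINT x|?N. indicator J x * g x) = h b - h a" "(LINT x|?N. indicator J' x * g x) = h b' - h a'"
    unfolding J_def J'_def using ab by (auto intro!: weak_derivative_integral[OF h g])
  define q where "q = (h b - h a) / l"
  define q' where "q' = (h b' - h a') / l'"
  let ?p = "1 + 2 * r"
  have "ennreal (l * (l' * (q - q')\<^sup>2)) = ennreal l * ennreal (l' * (q - q')\<^sup>2)"
    using l by (simp add: ennreal_mult)
  also have "\<dots> \<le> ennreal l * (\<integral>\<^sup>+x. indicator J' x * ennreal ((q - g x)\<^sup>2) \<partial>?N)"
    using N.square_deviation_from_mean[OF g(2) Js(2) mJ(2) l(2), of q] unfolding int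
    by (intro mult_left_mono) (auto simp: q'_def)
  also have "\<dots> = (\<integral>\<^sup>+x. ennreal l * (indicator J' x * ennreal ((q - g x)\<^sup>2)) \<partial>?N)"
  proof (rule nn_integral_cmult[symmetric])
    have "(\<lambda>x. q - g x) \<in> borel_measurable ?N" using l2_spaceD(1)[OF g(2)] by measurable
    then show "(\<lambda>x. indicator J' x * ennreal ((q - g x)\<^sup>2)) \<in> borel_measurable ?N"
      using Js(2) by measurable
  qed
  also have "\<dots> \<le> (\<integral>\<^sup>+x. indicator J' x * (\<integral>\<^sup>+y. indicator J y * ennreal ((g x - g y)\<^sup>2) \<partial>?N) \<partial>?N)"
  proof (rule nn_integral_mono)
    fix x
    have "ennreal l * ennreal ((q - g x)\<^sup>2) = ennreal (l * (g x - q)\<^sup>2)"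
      using l by (simp add: ennreal_mult power2_commute)
    also have "\<dots> \<le> (\<integral>\<^sup>+y. indicator J y * ennreal ((g x - g y)\<^sup>2) \<partial>?N)"
      using N.square_deviation_from_mean[OF g(2) Js(1) mJ(1) l(1), of "g x"] unfolding int by (simp add: q_def)
    finally show "ennreal l * (indicator J' x * ennreal ((q - g x)\<^sup>2))
        \<le> indicator J' x * (\<integral>\<^sup>+y. indicator J y * ennreal ((g x - g y)\<^sup>2) \<partial>?N)"
      by (auto split: split_indicator)
  qed
  also have "\<dots> \<le> (\<integral>\<^sup>+x. ennreal (l powr ?p) * (\<integral>\<^sup>+y. ennreal ((g x - g y)\<^sup>2 / \<bar>x - y\<bar> powr ?p) \<partial>?N) \<partial>?N)"
  proof (rule nn_integral_mono)
    fix x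
    have gm: "(\<lambda>y. ennreal ((g x - g y)\<^sup>2 / \<bar>x - y\<bar> powr ?p)) \<in> borel_measurable ?N"
    proof -
      have "(\<lambda>y. y) \<in> borel_measurable ?N"
        by (intro continuous_imp_measurable_on_sets_lebesgue) (auto intro: continuous_intros)
      then show ?thesis using l2_spaceD(1)[OF g(2)] by measurable
    qed
    have "(\<integral>\<^sup>+y. indicator J y * ennreal ((g x - g y)\<^sup>2) \<partial>?N)
        \<le> (\<integral>\<^sup>+y. ennreal (l powr ?p) * ennreal ((g x - g y)\<^sup>2 / \<bar>x - y\<bar> powr ?p) \<partial>?N)" if x: "x \<in> J'"
    proof (rule nn_integral_mono)
      fix y
      have "(g x - g y)\<^sup>2 \<le> l powr ?p * ((g x - g y)\<^sup>2 / \<bar>x - y\<bar> powr ?p)" if y: "y \<in> J"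
      \<comment> \<open>On the diagonal the quotient is \<open>0 / 0 = 0\<close>, but then the
        left-hand side vanishes too.\<close>
      proof (cases "x = y")
        case False
        have "\<bar>x - y\<bar> \<le> l" using x y ab by (auto simp: J_def J'_def l_def)
        then have "\<bar>x - y\<bar> powr ?p \<le> l powr ?p" using r by (intro powr_mono2) auto
        then have "(g x - g y)\<^sup>2 * \<bar>x - y\<bar> powr ?p \<le> (g x - g y)\<^sup>2 * l powr ?p" by (intro mult_left_mono) auto
        moreover have "0 < \<bar>x - y\<bar> powr ?p" using False by simp
        ultimately show ?thesis by (simp add: pos_le_divide_eq mult.commute)
      qed simp
      then have "indicator J y * ennreal ((g x - g y)\<^sup>2)
          \<le> ennreal (l powr ?p * ((g x - g y)\<^sup>2 / \<bar>x - y\<bar> powr ?p))"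
        by (auto split: split_indicator intro: ennreal_leI)
      then show "indicator J y * ennreal ((g x - g y)\<^sup>2)
          \<le> ennreal (l powr ?p) * ennreal ((g x - g y)\<^sup>2 / \<bar>x - y\<bar> powr ?p)"
        by (subst ennreal_mult[symmetric]) auto
    qed
    then show "indicator J' x * (\<integral>\<^sup>+y. indicator J y * ennreal ((g x - g y)\<^sup>2) \<partial>?N)
        \<le> ennreal (l powr ?p) * (\<integral>\<^sup>+y. ennreal ((g x - g y)\<^sup>2 / \<bar>x - y\<bar> powr ?p) \<partial>?N)"
      unfolding nn_integral_cmult[OF gm] by (auto split: split_indicator)
  qed
  also have "\<dots> = ennreal (l powr ?p) * ennreal S"
    unfolding S(1)[symmetric]
  proof (rule nn_integral_cmult)
    have id: "(\<lambda>y. y) \<in> borel_measurable ?N"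
      by (intro continuous_imp_measurable_on_sets_lebesgue) (auto intro: continuous_intros)
    note [measurable] = measurable_compose[OF measurable_fst id] measurable_compose[OF measurable_snd id]
      measurable_compose[OF measurable_fst l2_spaceD(1)[OF g(2)]] measurable_compose[OF measurable_snd l2_spaceD(1)[OF g(2)]]
    have "(\<lambda>z. ennreal ((g (fst z) - g (snd z))\<^sup>2 / \<bar>fst z - snd z\<bar> powr ?p)) \<in> borel_measurable (?N \<Otimes>\<^sub>M ?N)"
      by measurable
    then show "(\<lambda>x. \<integral>\<^sup>+y. ennreal ((g x - g y)\<^sup>2 / \<bar>x - y\<bar> powr ?p) \<partial>?N) \<in> borel_measurable ?N"
      by (intro N.borel_measurable_nn_integral) (simp add: case_prod_unfold)
  qed
  also have "\<dots> = ennreal (l powr ?p * S)" using S(2) by (simp add: ennreal_mult)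
  finally have main: "l * (l' * (q - q')\<^sup>2) \<le> l powr ?p * S" using S(2) by (simp add: ennreal_le_iff)
  \<comment> \<open>Comparable lengths turn \<open>l * l'\<close> into \<open>l * l\<close> at the
    cost of a factor 2. Dividing by \<open>l * l\<close> leaves the exponent
    \<open>1 + 2 * r - 2\<close>, half of which is \<open>r - 1/2\<close>.\<close>
  have "l * (l * (q - q')\<^sup>2) \<le> l * (2 * l' * (q - q')\<^sup>2)"
    using l by (intro mult_left_mono mult_right_mono) auto
  with main have "l * l * (q - q')\<^sup>2 \<le> l powr ?p * (2 * S)" by (simp add: mult_ac)
  moreover have "l powr ?p = l * l * (l powr (r - 1/2))\<^sup>2"
  proof -
    have "l powr ?p = l powr (1 + 1 + ((r - 1/2) + (r - 1/2)))" by (simp add: algebra_simps)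
    also have "\<dots> = l * l * (l powr (r - 1/2) * l powr (r - 1/2))"
      using l(1) unfolding powr_add by simp
    finally show ?thesis by (simp add: power2_eq_square)
  qed
  ultimately have "(q - q')\<^sup>2 \<le> (l powr (r - 1/2))\<^sup>2 * (2 * S)"
    using l(1) by (simp add: mult.assoc)
  then have "sqrt ((q - q')\<^sup>2) \<le> sqrt ((l powr (r - 1/2))\<^sup>2 * (2 * S))" by (rule real_sqrt_le_mono)
  moreover have "sqrt ((l powr (r - 1/2))\<^sup>2 * (2 * S)) = sqrt (2 * S) * l powr (r - 1/2)"
    by (simp add: real_sqrt_mult)
  ultimately have "\<bar>q - q'\<bar> \<le> sqrt (2 * S) * l powr (r - 1/2)" by simp
  moreover have "quot h a' b' = q'" "quot h a b = q"
    by (simp_all add: q_def q'_def l_def l'_def divide_inverse_commute)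
  ultimately show ?thesis by (simp only: abs_minus_commute[of q'] l_def)
qed

text \<open>For \<open>s < 2\<close> the derivative \<open>D 1\<close> has a finite seminorm of
  order \<open>s - 1\<close>, giving the exponent \<open>s - 1 - 1/2\<close>, which is positive
  because \<open>s > 3/2\<close>. For \<open>s \<ge> 2\<close> the square integrable second
  derivative gives 1/2.\<close>

lemma sobolev_quotient_bound:
  assumes f: "f \<in> sobolev_space s {0<..<T}" and s: "s > 3 / 2" and h: "continuous_on {0..T} f"
  shows "\<exists>C\<ge>0. \<forall>a a' b' b. 0 < a \<longrightarrow> a \<le> a' \<longrightarrow> a' < b' \<longrightarrow> b' \<le> b \<longrightarrow> b < T \<longrightarrow> b - a \<le> 2 * (b' - a') \<longrightarrow>
    \<bar>quot f a' b' - quot f a b\<bar> \<le> C * (b - a) powr (if s < 2 then s - 3/2 else 1/2)"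
proof -
  let ?N = "lebesgue_on {0<..<T}"
  obtain D where D: "\<And>j. j \<le> nat \<lfloor>s\<rfloor> \<Longrightarrow> D j \<in> l2_space ?N \<and> weak_derivative {0<..<T} j f (D j)"
    and slo: "frac s > 0 \<Longrightarrow>
           (\<integral>\<^sup>+ x. (\<integral>\<^sup>+ y. ennreal ((D (nat \<lfloor>s\<rfloor>) x - D (nat \<lfloor>s\<rfloor>) y)\<^sup>2
                                / \<bar>x - y\<bar> powr (1 + 2 * frac s)) \<partial>?N) \<partial>?N) < \<infinity>"
    using f unfolding sobolev_space_def by blast
  show ?thesis
  proof (cases "s < 2")
    case True
    have fl: "\<lfloor>s\<rfloor> = 1" using s True by linarith
    then have fr: "frac s = s - 1" by (simp add: frac_def)
    define S where "S = enn2real (\<integral>\<^sup>+ x. (\<integral>\<^sup>+ y. ennreal ((D 1 x - D 1 y)\<^sup>2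
                                / \<bar>x - y\<bar> powr (1 + 2 * (s - 1))) \<partial>?N) \<partial>?N)"
    have S: "(\<integral>\<^sup>+ x. (\<integral>\<^sup>+ y. ennreal ((D 1 x - D 1 y)\<^sup>2
                                / \<bar>x - y\<bar> powr (1 + 2 * (s - 1))) \<partial>?N) \<partial>?N) = ennreal S"
      unfolding S_def using slo s fl fr by (intro ennreal_enn2real[symmetric]) simp
    have D1: "D 1 \<in> l2_space ?N" "weak_derivative {0<..<T} 1 f (D 1)" using D[of 1] fl by auto
    have "\<bar>quot f a' b' - quot f a b\<bar> \<le> sqrt (2 * S) * (b - a) powr (s - 1 - 1/2)"
      if "0 < a" "a \<le> a'" "a' < b'" "b' \<le> b" "b < T" "b - a \<le> 2 * (b' - a')" for a a' b' b
      by (rule slobodeckij_quotient_bound[OF h D1(2,1) S _ _ that]) (use s S_def in auto)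
    moreover have "s - 1 - 1/2 = s - 3/2" by simp
    ultimately show ?thesis using True S_def by (intro exI[of _ "sqrt (2 * S)"]) auto
  next
    case False
    then have "2 \<le> nat \<lfloor>s\<rfloor>" by linarith
    then have D12: "D 1 \<in> l2_space ?N" "weak_derivative {0<..<T} 1 f (D 1)"
      "D 2 \<in> l2_space ?N" "weak_derivative {0<..<T} 2 f (D 2)" using D by auto
    have "\<bar>quot f a' b' - quot f a b\<bar> \<le> l2_norm ?N (D 2) * (b - a) powr (1/2)"
      if "0 < a" "a \<le> a'" "a' < b'" "b' \<le> b" "b < T" for a a' b' b
      using sobolev2_quotient_bound[OF h D12(2,1,4,3) that] that by (simp add: powr_half_sqrt)
    then show ?thesis using False by (intro exI[of _ "l2_norm ?N (D 2)"]) auto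
  qed
qed

section \<open>From the comparison of quotients to a Hoelder continuous derivative\<close>

lemma sobolev_quotient_bound_vec:
  fixes h :: "real \<Rightarrow> real ^ 'n"
  assumes h: "\<And>i. (\<lambda>t. h t $ i) \<in> sobolev_space s {0<..<T}" and s: "s > 3 / 2"
    and cont: "continuous_on {0..T} h"
  obtains C where "0 \<le> C" "\<And>a a' b' b. 0 < a \<Longrightarrow> a \<le> a' \<Longrightarrow> a' < b' \<Longrightarrow> b' \<le> b \<Longrightarrow> b < T \<Longrightarrow> b - a \<le> 2 * (b' - a') \<Longrightarrow>
    norm (quot h a' b' - quot h a b) \<le> C * (b - a) powr (if s < 2 then s - 3/2 else 1/2)"
proof -
  let ?\<alpha> = "if s < 2 then s - 3/2 else 1/2"
  have "\<exists>C\<ge>0. \<forall>a a' b' b. 0 < a \<longrightarrow> a \<le> a' \<longrightarrow> a' < b' \<longrightarrow> b' \<le> b \<longrightarrow> b < T \<longrightarrow> b - a \<le> 2 * (b' - a') \<longrightarrow>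
    \<bar>quot (\<lambda>t. h t $ i) a' b' - quot (\<lambda>t. h t $ i) a b\<bar> \<le> C * (b - a) powr ?\<alpha>" for i
    by (intro sobolev_quotient_bound[OF h s] continuous_on_component cont)
  then obtain C where C: "\<And>i. 0 \<le> C i" "\<And>i a a' b' b. 0 < a \<Longrightarrow> a \<le> a' \<Longrightarrow> a' < b' \<Longrightarrow> b' \<le> b \<Longrightarrow> b < T \<Longrightarrow>
    b - a \<le> 2 * (b' - a') \<Longrightarrow>
    \<bar>quot (\<lambda>t. h t $ i) a' b' - quot (\<lambda>t. h t $ i) a b\<bar> \<le> C i * (b - a) powr ?\<alpha>"
    by metis
  have "norm (quot h a' b' - quot h a b) \<le> (\<Sum>i\<in>UNIV. C i) * (b - a) powr ?\<alpha>"
    if "0 < a" "a \<le> a'" "a' < b'" "b' \<le> b" "b < T" "b - a \<le> 2 * (b' - a')" for a a' b' b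
  proof -
    have "norm (quot h a' b' - quot h a b) \<le> (\<Sum>i\<in>UNIV. \<bar>(quot h a' b' - quot h a b) $ i\<bar>)"
      by (rule norm_le_l1_cart)
    also have "\<dots> \<le> (\<Sum>i\<in>UNIV. C i * (b - a) powr ?\<alpha>)"
      using C(2)[OF that] by (intro sum_mono) simp
    finally show ?thesis by (simp add: sum_distrib_right)
  qed
  moreover have "0 \<le> (\<Sum>i\<in>UNIV. C i)" using C(1) by (simp add: sum_nonneg)
  ultimately show ?thesis using that by blast
qed

text \<open>Test functions only see the interior. The end points are reached by contracting
  \<open>[0, T]\<close> towards its midpoint with the affine maps \<open>S k\<close>, which preserve
  the order and the ratio of lengths, and then letting the contraction tend to the identity.\<close>

lemma quotient_bound_closed:
  fixes h :: "real \<Rightarrow> 'a::real_normed_vector"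
  assumes cont: "continuous_on {0..T} h" and T: "0 < T" and C: "0 \<le> C" "0 < \<alpha>"
    and A: "\<And>a a' b' b. 0 < a \<Longrightarrow> a \<le> a' \<Longrightarrow> a' < b' \<Longrightarrow> b' \<le> b \<Longrightarrow> b < T \<Longrightarrow> b - a \<le> 2 * (b' - a') \<Longrightarrow>
      norm (quot h a' b' - quot h a b) \<le> C * (b - a) powr \<alpha>"
    and ab: "0 \<le> a" "a \<le> a'" "a' < b'" "b' \<le> b" "b \<le> T" "b - a \<le> 2 * (b' - a')"
  shows "norm (quot h a' b' - quot h a b) \<le> C * (b - a) powr \<alpha>"
proof -
  define e where "e k = 1 / real (k + 2)" for k
  have e: "0 < e k" "e k < 1" for k by (simp_all add: e_def)
  have e0: "e \<longlonglongrightarrow> 0"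
    using LIMSEQ_ignore_initial_segment[OF lim_1_over_n, of 2] by (simp add: e_def[abs_def])
  define S where "S k x = (1 - e k) * x + e k * (T / 2)" for k x
  have S_lim: "(\<lambda>k. S k x) \<longlonglongrightarrow> x" for x
  proof -
    have "(\<lambda>k. S k x) \<longlonglongrightarrow> (1 - 0) * x + 0 * (T / 2)" unfolding S_def by (intro tendsto_intros e0)
    then show ?thesis by simp
  qed
  have S_diff: "S k y - S k x = (1 - e k) * (y - x)" for k x y by (simp add: S_def algebra_simps)
  have S_in: "0 < S k x \<and> S k x < T" if "0 \<le> x" "x \<le> T" for k x
  proof
    show "0 < S k x" unfolding S_def using e[of k] T that by (intro add_nonneg_pos) auto
    have "(1 - e k) * x \<le> (1 - e k) * T" using e[of k] that by (intro mult_left_mono) auto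
    moreover have "e k * (T / 2) < e k * T" using e[of k] T by simp
    ultimately show "S k x < T" unfolding S_def by (simp add: algebra_simps)
  qed
  have h_lim: "(\<lambda>k. h (S k x)) \<longlonglongrightarrow> h x" if "0 \<le> x" "x \<le> T" for x
    using S_in that by (intro continuous_on_tendsto_compose[OF cont S_lim]) (auto intro!: always_eventually less_imp_le)
  have q_lim: "(\<lambda>k. quot h (S k x) (S k y)) \<longlonglongrightarrow> quot h x y" if "0 \<le> x" "x < y" "y \<le> T" for x y
    using that by (intro tendsto_intros h_lim S_lim) auto
  have bound: "norm (quot h (S k a') (S k b') - quot h (S k a) (S k b)) \<le> C * (S k b - S k a) powr \<alpha>" for k
  proof (rule A)
    have le: "S k x \<le> S k y" if "x \<le> y" for x y
    proof -
      have "0 \<le> (1 - e k) * (y - x)" using e[of k] that by (intro mult_nonneg_nonneg) auto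
      then show ?thesis unfolding S_diff[symmetric] by simp
    qed
    show "S k a \<le> S k a'" "S k b' \<le> S k b" using le ab by auto
    show "0 < S k a" "S k b < T" using S_in ab by auto
    have "0 < (1 - e k) * (b' - a')" using e[of k] ab by (intro mult_pos_pos) auto
    then show "S k a' < S k b'" unfolding S_diff[symmetric] by simp
    have "(1 - e k) * (b - a) \<le> (1 - e k) * (2 * (b' - a'))" using e[of k] ab by (intro mult_left_mono) auto
    then show "S k b - S k a \<le> 2 * (S k b' - S k a')" unfolding S_diff by (simp only: mult.left_commute)
  qed
  have "(\<lambda>k. norm (quot h (S k a') (S k b') - quot h (S k a) (S k b))) \<longlonglongrightarrow> norm (quot h a' b' - quot h a b)"
    using ab by (intro tendsto_intros q_lim) auto
  moreover have "(\<lambda>k. C * (S k b - S k a) powr \<alpha>) \<longlonglongrightarrow> C * (b - a) powr \<alpha>"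
    using ab by (intro tendsto_intros S_lim) auto
  moreover have "\<exists>N. \<forall>k\<ge>N. norm (quot h (S k a') (S k b') - quot h (S k a) (S k b)) \<le> C * (S k b - S k a) powr \<alpha>"
    using bound by blast
  ultimately show ?thesis by (rule LIMSEQ_le)
qed

text \<open>Summing a geometric series over dyadically shrinking intervals removes the restriction on the
  ratio of lengths (Campanato's argument).\<close>

lemma quotient_bound_nested:
  fixes h :: "real \<Rightarrow> 'a::real_normed_vector"
  assumes C: "0 \<le> C" "0 < \<alpha>"
    and A: "\<And>a a' b' b. 0 \<le> a \<Longrightarrow> a \<le> a' \<Longrightarrow> a' < b' \<Longrightarrow> b' \<le> b \<Longrightarrow> b \<le> T \<Longrightarrow> b - a \<le> 2 * (b' - a') \<Longrightarrow>
      norm (quot h a' b' - quot h a b) \<le> C * (b - a) powr \<alpha>"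
    and ab: "0 \<le> a" "a \<le> a'" "a' < b'" "b' \<le> b" "b \<le> T"
  shows "norm (quot h a' b' - quot h a b) \<le> C / (1 - 2 powr (-\<alpha>)) * (b - a) powr \<alpha>"
proof -
  define r where "r = 2 powr (-\<alpha>)"
  have r: "0 < r" "r < 1" using C by (simp_all add: r_def powr_less_one)
  have step: "norm (quot h a' b' - quot h a b) \<le> C * (\<Sum>k<m. r ^ k) * (b - a) powr \<alpha>"
    if "b - a \<le> 2 ^ m * (b' - a')" "0 \<le> a" "a \<le> a'" "a' < b'" "b' \<le> b" "b \<le> T" for m a b
    using that
  proof (induction m arbitrary: a b)
    case 0
    then have "a = a'" "b = b'" by auto
    then show ?case by simp
  next
    case (Suc m)
    define l where "l = b - a"
    have l: "0 < l" using Suc.prems by (simp add: l_def)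
    show ?case
    proof (cases "b - a \<le> 2 * (b' - a')")
      case True
      have "1 \<le> (\<Sum>k<Suc m. r ^ k)" using r by (simp add: sum.lessThan_Suc_shift sum_nonneg del: sum.lessThan_Suc)
      then have "C * 1 * (b - a) powr \<alpha> \<le> C * (\<Sum>k<Suc m. r ^ k) * (b - a) powr \<alpha>"
        using C by (intro mult_right_mono mult_left_mono) auto
      then show ?thesis using A[OF Suc.prems(2-6) True] by simp
    next
      case False
      \<comment> \<open>\<open>[c, d]\<close> has half the length of \<open>[a, b]\<close> and lies
        between \<open>[a', b']\<close> and \<open>[a, b]\<close>: it ends at \<open>b'\<close>
        unless it would then start to the left of \<open>a\<close>.\<close>
      define c where "c = max a (b' - l / 2)"
      define d where "d = c + l / 2"
      have cd: "a \<le> c" "c \<le> a'" "b' \<le> d" "d \<le> b" "d - c = l / 2"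
      proof -
        have len: "2 * (b' - a') < l" "l = b - a" using False by (simp_all add: l_def)
        show "a \<le> c" by (simp add: c_def)
        have "b' - l / 2 \<le> a'" using len(1) by (simp add: field_simps)
        then show "c \<le> a'" unfolding c_def using Suc.prems by (intro max.boundedI)
        have "b' - l / 2 \<le> c" by (simp add: c_def)
        then show "b' \<le> d" unfolding d_def by linarith
        have "a \<le> b - l / 2" using l by (simp add: l_def field_simps)
        then have "c \<le> b - l / 2" unfolding c_def using Suc.prems by (intro max.boundedI) auto
        then show "d \<le> b" unfolding d_def by linarith
        show "d - c = l / 2" by (simp add: d_def)
      qed
      have "norm (quot h a' b' - quot h c d) \<le> C * (\<Sum>k<m. r ^ k) * (d - c) powr \<alpha>"
        using Suc.prems cd by (intro Suc.IH) (auto simp: l_def)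
      also have "(d - c) powr \<alpha> = r * l powr \<alpha>"
        unfolding cd(5) using l by (simp add: r_def powr_divide powr_minus_divide)
      finally have 1: "norm (quot h a' b' - quot h c d) \<le> C * (\<Sum>k<m. r ^ k) * (r * l powr \<alpha>)" .
      have 2: "norm (quot h c d - quot h a b) \<le> C * l powr \<alpha>"
        unfolding l_def using Suc.prems cd l by (intro A) (auto simp: l_def)
      have "norm (quot h a' b' - quot h a b) \<le> norm (quot h a' b' - quot h c d) + norm (quot h c d - quot h a b)"
        by (rule norm_diff_triangle_le[OF order_refl order_refl])
      also have "\<dots> \<le> C * (\<Sum>k<m. r ^ k) * (r * l powr \<alpha>) + C * l powr \<alpha>" using 1 2 by linarith
      also have "\<dots> = C * (\<Sum>k<Suc m. r ^ k) * l powr \<alpha>"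
        by (simp add: sum.lessThan_Suc_shift sum_distrib_left sum_distrib_right algebra_simps del: sum.lessThan_Suc)
      finally show ?thesis by (simp add: l_def)
    qed
  qed
  obtain m where "(b - a) / (b' - a') < 2 ^ m" using real_arch_pow[of 2 "(b - a) / (b' - a')"] by auto
  then have "b - a \<le> 2 ^ m * (b' - a')" using ab by (simp add: divide_less_eq)
  from step[OF this ab] have "norm (quot h a' b' - quot h a b) \<le> C * (\<Sum>k<m. r ^ k) * (b - a) powr \<alpha>" .
  also have "(\<Sum>k<m. r ^ k) \<le> 1 / (1 - r)"
  proof -
    have "(\<Sum>k<m. r ^ k) = (1 - r ^ m) / (1 - r)" using r by (simp add: sum_gp_strict)
    also have "\<dots> \<le> 1 / (1 - r)" using r by (intro divide_right_mono) auto
    finally show ?thesis .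
  qed
  then have "C * (\<Sum>k<m. r ^ k) * (b - a) powr \<alpha> \<le> C * (1 / (1 - r)) * (b - a) powr \<alpha>"
    using C by (intro mult_right_mono mult_left_mono) auto
  finally show ?thesis by (simp add: r_def)
qed

text \<open>The intervals \<open>[lo t k, hi t k]\<close> shrink to \<open>t\<close> inside
  \<open>[0, T]\<close>, so end points are treated with one-sided intervals. Their quotients form a
  Cauchy sequence, and the limit is close to the quotient over any interval containing
  \<open>t\<close>, in particular over those with end point \<open>t\<close>.\<close>

lemma quotient_bound_derivative:
  fixes h :: "real \<Rightarrow> 'a::banach"
  assumes T: "0 < T" and C: "0 \<le> C" "0 < \<alpha>"
    and A: "\<And>a a' b' b. 0 \<le> a \<Longrightarrow> a \<le> a' \<Longrightarrow> a' < b' \<Longrightarrow> b' \<le> b \<Longrightarrow> b \<le> T \<Longrightarrow>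
      norm (quot h a' b' - quot h a b) \<le> C * (b - a) powr \<alpha>"
  obtains h' where "\<And>t. t \<in> {0..T} \<Longrightarrow> (h has_vector_derivative h' t) (at t within {0..T})"
    and "\<And>a b t. 0 \<le> a \<Longrightarrow> a < b \<Longrightarrow> b \<le> T \<Longrightarrow> t \<in> {a..b} \<Longrightarrow> norm (quot h a b - h' t) \<le> 2 * C * (b - a) powr \<alpha>"
proof -
  define lo where "lo t k = max 0 (t - 1 / real (Suc k))" for t and k :: nat
  define hi where "hi t k = min T (t + 1 / real (Suc k))" for t and k :: nat
  define Q where "Q t k = quot h (lo t k) (hi t k)" for t k
  have lohi: "0 \<le> lo t k" "lo t k < hi t k" "hi t k \<le> T" "lo t k \<le> t" "t \<le> hi t k"
    "t - 1 / real (Suc k) \<le> lo t k" "hi t k \<le> t + 1 / real (Suc k)" if "t \<in> {0..T}" for t k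
  proof -
    define \<eta> where "\<eta> = 1 / real (Suc k)"
    have "0 < \<eta>" by (simp add: \<eta>_def)
    with that T show "0 \<le> lo t k" "lo t k < hi t k" "hi t k \<le> T" "lo t k \<le> t" "t \<le> hi t k"
    "t - 1 / real (Suc k) \<le> lo t k" "hi t k \<le> t + 1 / real (Suc k)"
      unfolding lo_def hi_def \<eta>_def[symmetric] by (auto simp: max_def min_def)
  qed
  \<comment> \<open>Two intervals that share \<open>t\<close> need not be nested. Both are compared
    with their hull \<open>[c, d]\<close>, which accounts for the factor 2.\<close>
  have hull: "norm (Q t k - quot h a b) \<le> 2 * C * (b - a + 2 / real (Suc k)) powr \<alpha>"
    if t: "t \<in> {a..b}" and ab: "0 \<le> a" "a < b" "b \<le> T" for t a b k
  proof -
    have tT: "t \<in> {0..T}" using t ab by auto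
    note L = lohi[OF tT, of k]
    define c where "c = min a (lo t k)"
    define d where "d = max b (hi t k)"
    have cd: "0 \<le> c" "c \<le> a" "c \<le> lo t k" "b \<le> d" "hi t k \<le> d" "d \<le> T"
      using ab L by (auto simp: c_def d_def)
    have len: "d - c \<le> b - a + 2 / real (Suc k)"
    proof -
      have "d \<le> b + 1 / real (Suc k)" "a - 1 / real (Suc k) \<le> c"
        using t L(6,7) by (auto simp: c_def d_def)
      then show ?thesis by simp
    qed
    have p: "(d - c) powr \<alpha> \<le> (b - a + 2 / real (Suc k)) powr \<alpha>"
      using len cd ab C by (intro powr_mono2) auto
    have "norm (Q t k - quot h c d) \<le> C * (d - c) powr \<alpha>"
      unfolding Q_def using cd L by (intro A) auto
    moreover have "norm (quot h c d - quot h a b) \<le> C * (d - c) powr \<alpha>"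
      using A[of c a b d] cd ab by (simp add: norm_minus_commute)
    moreover have "norm (Q t k - quot h a b) \<le> norm (Q t k - quot h c d) + norm (quot h c d - quot h a b)"
      by (rule norm_diff_triangle_le[OF order_refl order_refl])
    moreover have "C * (d - c) powr \<alpha> \<le> C * (b - a + 2 / real (Suc k)) powr \<alpha>"
      using p C by (intro mult_left_mono) auto
    ultimately show ?thesis by linarith
  qed
  have plim: "(\<lambda>k. 2 * C * (x + 2 / real (Suc k)) powr \<alpha>) \<longlonglongrightarrow> 2 * C * x powr \<alpha>" if "0 \<le> x" for x
  proof -
    have "(\<lambda>k. 2 * inverse (real (Suc k))) \<longlonglongrightarrow> 2 * 0" by (intro tendsto_intros LIMSEQ_inverse_real_of_nat)
    then have z: "(\<lambda>k. 2 / real (Suc k)) \<longlonglongrightarrow> 0" by (simp add: divide_inverse)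
    have "(\<lambda>k. 2 * C * (x + 2 / real (Suc k)) powr \<alpha>) \<longlonglongrightarrow> 2 * C * (x + 0) powr \<alpha>"
      using that C by (intro tendsto_mult tendsto_const tendsto_powr2 tendsto_add z)
        (auto intro!: always_eventually add_nonneg_nonneg)
    then show ?thesis by simp
  qed
  have "Cauchy (Q t)" if t: "t \<in> {0..T}" for t
  proof (rule metric_CauchyI)
    fix e :: real assume e: "e > 0"
    have "(\<lambda>k. 2 * C * (0 + 2 / real (Suc k)) powr \<alpha>) \<longlonglongrightarrow> 0"
      using plim[of 0] C by simp
    then have "\<forall>\<^sub>F k in sequentially. 2 * C * (0 + 2 / real (Suc k)) powr \<alpha> < e"
      using e by (intro order_tendstoD(2)) auto
    then obtain M where M: "\<And>k. k \<ge> M \<Longrightarrow> 2 * C * (2 / real (Suc k)) powr \<alpha> < e"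
      by (auto simp: eventually_sequentially)
    have le: "norm (Q t m - Q t k) < e" if "M \<le> k" "k \<le> m" for k m
    proof -
      have mk: "1 / real (Suc m) \<le> 1 / real (Suc k)" using that by (simp add: frac_le)
      have "norm (Q t m - Q t k) \<le> C * (hi t k - lo t k) powr \<alpha>"
        unfolding Q_def
      proof (rule A)
        show "lo t k \<le> lo t m" unfolding lo_def using mk by (intro max.mono) auto
        show "hi t m \<le> hi t k" unfolding hi_def using mk by (intro min.mono) auto
      qed (use lohi[OF t] in auto)
      also have "\<dots> \<le> C * (2 / real (Suc k)) powr \<alpha>"
      proof (intro mult_left_mono powr_mono2)
        have "2 / real (Suc k) = 1 / real (Suc k) + 1 / real (Suc k)" by simp
        then show "hi t k - lo t k \<le> 2 / real (Suc k)" using lohi(6,7)[OF t, of k] by linarith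
      qed (use C lohi[OF t, of k] in auto)
      also have "\<dots> \<le> 2 * C * (2 / real (Suc k)) powr \<alpha>" using C by (intro mult_right_mono) auto
      finally show ?thesis using M[OF that(1)] by linarith
    qed
    have "dist (Q t m) (Q t k) < e" if "M \<le> m" "M \<le> k" for m k
      using le[of k m] le[of m k] that by (cases "k \<le> m") (auto simp: dist_norm norm_minus_commute)
    then show "\<exists>M. \<forall>m\<ge>M. \<forall>n\<ge>M. dist (Q t m) (Q t n) < e" by blast
  qed
  then have Qlim: "Q t \<longlonglongrightarrow> lim (Q t)" if "t \<in> {0..T}" for t
    using that by (simp add: Cauchy_convergent_iff convergent_LIMSEQ_iff)
  define h' where "h' t = lim (Q t)" for t
  have bound: "norm (quot h a b - h' t) \<le> 2 * C * (b - a) powr \<alpha>"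
    if "0 \<le> a" "a < b" "b \<le> T" "t \<in> {a..b}" for a b t
  proof -
    have "(\<lambda>k. norm (Q t k - quot h a b)) \<longlonglongrightarrow> norm (h' t - quot h a b)"
      unfolding h'_def using that by (intro tendsto_intros Qlim) auto
    moreover have "(\<lambda>k. 2 * C * (b - a + 2 / real (Suc k)) powr \<alpha>) \<longlonglongrightarrow> 2 * C * (b - a) powr \<alpha>"
      using that by (intro plim) auto
    ultimately have "norm (h' t - quot h a b) \<le> 2 * C * (b - a) powr \<alpha>"
      by (rule LIMSEQ_le) (use hull that in blast)
    then show ?thesis by (simp add: norm_minus_commute)
  qed
  have "(h has_vector_derivative h' t) (at t within {0..T})" if t: "t \<in> {0..T}" for t
    unfolding has_vector_derivative_def has_derivative_within_alt
  proof (intro conjI allI impI bounded_linear_scaleR_left)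
    fix e :: real assume e: "e > 0"
    \<comment> \<open>Chosen so that \<open>2 * C * d powr \<alpha> \<le> e\<close>; the 1 added to
      \<open>2 * C\<close> covers \<open>C = 0\<close>.\<close>
    define d where "d = (e / (2 * C + 1)) powr (1 / \<alpha>)"
    have d: "d > 0" using e C by (simp add: d_def)
    have "norm (h y - h t - (y - t) *\<^sub>R h' t) \<le> e * norm (y - t)" if y: "y \<in> {0..T}" "norm (y - t) < d" for y
    proof (cases "y = t")
      case False
      define a where "a = min y t"
      define b where "b = max y t"
      have ab: "0 \<le> a" "a < b" "b \<le> T" "t \<in> {a..b}" "b - a = \<bar>y - t\<bar>"
        using y t False by (auto simp: a_def b_def)
      have q: "quot h a b = (h y - h t) /\<^sub>R (y - t)"
      proof (cases "y < t")
        case True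
        have "inverse (y - t) = - inverse (t - y)" by (metis inverse_minus_eq minus_diff_eq)
        then show ?thesis using True by (simp add: a_def b_def scaleR_diff_right)
      qed (use False in \<open>simp add: a_def b_def\<close>)
      have "(b - a) powr \<alpha> \<le> d powr \<alpha>" using ab y C by (intro powr_mono2) auto
      also have "\<dots> = e / (2 * C + 1)" using C e by (simp add: d_def powr_powr)
      finally have "2 * C * (b - a) powr \<alpha> \<le> 2 * C * (e / (2 * C + 1))" using C by (intro mult_left_mono) auto
      also have "\<dots> \<le> (2 * C + 1) * (e / (2 * C + 1))" using C e by (intro mult_right_mono) auto
      also have "\<dots> = e" using C by simp
      finally have "norm (quot h a b - h' t) \<le> e" using bound[OF ab(1-4)] by linarith
      then have "\<bar>y - t\<bar> * norm (quot h a b - h' t) \<le> \<bar>y - t\<bar> * e" by (intro mult_left_mono) auto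
      moreover have "h y - h t - (y - t) *\<^sub>R h' t = (y - t) *\<^sub>R (quot h a b - h' t)"
        unfolding q using False by (simp add: scaleR_diff_right)
      ultimately show ?thesis by (simp only: norm_scaleR real_norm_def mult.commute[of e])
    qed simp
    with d show "\<exists>d>0. \<forall>y\<in>{0..T}. norm (y - t) < d \<longrightarrow> norm (h y - h t - (y - t) *\<^sub>R h' t) \<le> e * norm (y - t)"
      by blast
  qed
  then show ?thesis using bound that by blast
qed

text \<open>The one-dimensional Sobolev embedding up to the boundary. Comparing quotients with
  \<open>h'\<close> at any point of the interval gives Lipschitz bounds for \<open>h\<close>,
  continuity of \<open>h'\<close> and lower bounds for increments by the triangle inequality
  alone.\<close>

theorem sobolev_imp_C1:
  fixes h :: "real \<Rightarrow> real ^ 'n"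
  assumes h: "\<And>i. (\<lambda>t. h t $ i) \<in> sobolev_space s {0<..<T}" and s: "s > 3 / 2" and T: "0 < T"
    and cont: "continuous_on {0..T} h"
  obtains h' C \<alpha> where "0 \<le> C" "0 < \<alpha>"
    and "\<And>t. t \<in> {0..T} \<Longrightarrow> (h has_vector_derivative h' t) (at t within {0..T})"
    and "\<And>a b t. 0 \<le> a \<Longrightarrow> a < b \<Longrightarrow> b \<le> T \<Longrightarrow> t \<in> {a..b} \<Longrightarrow> norm (quot h a b - h' t) \<le> C * (b - a) powr \<alpha>"
proof -
  define \<alpha> where "\<alpha> = (if s < 2 then s - 3/2 else 1/2)"
  have \<alpha>: "0 < \<alpha>" using s by (simp add: \<alpha>_def)
  obtain C where C: "0 \<le> C" "\<And>a a' b' b. 0 < a \<Longrightarrow> a \<le> a' \<Longrightarrow> a' < b' \<Longrightarrow> b' \<le> b \<Longrightarrow> b < T \<Longrightarrow> b - a \<le> 2 * (b' - a') \<Longrightarrow>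
    norm (quot h a' b' - quot h a b) \<le> C * (b - a) powr \<alpha>"
    using sobolev_quotient_bound_vec[OF h s cont] unfolding \<alpha>_def by blast
  define D where "D = C / (1 - 2 powr (-\<alpha>))"
  have "2 powr (-\<alpha>) < 1" using \<alpha> by (simp add: powr_less_one)
  then have D: "0 \<le> D" using C(1) by (simp add: D_def)
  have "norm (quot h a' b' - quot h a b) \<le> D * (b - a) powr \<alpha>"
    if "0 \<le> a" "a \<le> a'" "a' < b'" "b' \<le> b" "b \<le> T" for a a' b' b
    unfolding D_def
    by (rule quotient_bound_nested[OF C(1) \<alpha> quotient_bound_closed[OF cont T C(1) \<alpha> C(2)] that])
  from quotient_bound_derivative[OF T D \<alpha> this] obtain h'
    where "\<And>t. t \<in> {0..T} \<Longrightarrow> (h has_vector_derivative h' t) (at t within {0..T})"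
    "\<And>a b t. 0 \<le> a \<Longrightarrow> a < b \<Longrightarrow> b \<le> T \<Longrightarrow> t \<in> {a..b} \<Longrightarrow> norm (quot h a b - h' t) \<le> 2 * D * (b - a) powr \<alpha>"
    by blast
  then show ?thesis using that[of "2 * D" \<alpha> h'] D \<alpha> by simp
qed

section \<open>Sublevel sets and weakly singular integrals\<close>

text \<open>Dyadic decomposition: where \<open>f\<close> lies between \<open>R / 2^(k+1)\<close> and
  \<open>R / 2^k\<close>, the integrand is at most \<open>c k\<close>, and that shell has measure of
  order \<open>2^(-k*m)\<close>. The geometric series has the ratio \<open>2 powr (a - m)\<close>,
  below 1 because \<open>a < m\<close>.\<close>

lemma nn_integral_powr_le_of_sublevel:
  fixes f :: "'a \<Rightarrow> real"
  assumes f: "f \<in> borel_measurable M" "\<And>x. x \<in> space M \<Longrightarrow> 0 \<le> f x" "\<And>x. x \<in> space M \<Longrightarrow> f x \<le> R"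
    and R: "0 < R" and C: "0 \<le> C" and a: "0 < a" "a < m"
    and level: "\<And>r. 0 < r \<Longrightarrow> emeasure M {x \<in> space M. f x < r} \<le> ennreal (C * r powr m)"
  shows "(\<integral>\<^sup>+x. ennreal (f x powr (-a)) \<partial>M)
    \<le> ennreal (C * (R / 2) powr (-a) * (2 * R) powr m / (1 - 2 powr (a - m)))"
proof -
  define q where "q = 2 powr (a - m)"
  have q: "0 < q" "q < 1" using a by (simp_all add: q_def powr_less_one)
  define c where "c k = (R / 2 * (1/2) ^ k) powr (-a)" for k :: nat
  \<comment> \<open>The shell includes its upper value \<open>R * (1/2) ^ k\<close>, whereas
    \<open>level\<close> concerns strict sublevel sets; hence the factor 2.\<close>
  define S where "S k = {x \<in> space M. f x < 2 * R * (1/2) ^ k}" for k :: nat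
  have [measurable]: "S k \<in> sets M" for k unfolding S_def using f(1) by measurable
  have pw: "ennreal (f x powr (-a)) \<le> (\<Sum>k. ennreal (c k) * indicator (S k) x)" if x: "x \<in> space M" for x
  \<comment> \<open>At zeros of \<open>f\<close> the integrand is 0, as \<open>powr\<close> with
    base 0 has the value 0.\<close>
  proof (cases "f x = 0")
    case False
    then have fx: "0 < f x" using f(2)[OF x] by simp
    have "\<exists>n. R * (1/2) ^ Suc n < f x"
    proof -
      obtain n where "(1/2) ^ n < f x / R" using real_arch_pow_inv[of "f x / R" "1/2"] fx R by auto
      then have "R * (1/2) ^ n < f x" using R by (simp add: field_simps)
      moreover have "R * (1/2) ^ Suc n \<le> R * (1/2) ^ n" using R by simp
      ultimately show ?thesis by (intro exI[of _ n]) linarith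
    qed
    define k where "k = (LEAST n. R * (1/2) ^ Suc n < f x)"
    have k1: "R * (1/2) ^ Suc k < f x"
      unfolding k_def by (rule LeastI_ex) fact
    have k2: "f x \<le> R * (1/2) ^ k"
    proof (cases k)
      case 0
      then show ?thesis using f(3)[OF x] by simp
    next
      case (Suc j)
      then have "\<not> R * (1/2) ^ Suc j < f x" using not_less_Least[of j "\<lambda>n. R * (1/2) ^ Suc n < f x"] by (simp add: k_def)
      then show ?thesis using Suc by simp
    qed
    have "R * (1/2) ^ k < 2 * R * (1/2) ^ k" using R by simp
    with k2 have xS: "x \<in> S k" using x unfolding S_def by auto
    have "f x powr (-a) \<le> c k"
      unfolding c_def using k1 R a by (intro powr_mono2') auto
    then have "ennreal (f x powr (-a)) \<le> ennreal (c k) * indicator (S k) x" using xS by (simp add: ennreal_leI)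
    also have "\<dots> \<le> (\<Sum>k. ennreal (c k) * indicator (S k) x)"
    proof -
      have "t k \<le> (\<Sum>k. t k)" for t :: "nat \<Rightarrow> ennreal" using sum_le_suminf[of t "{k}"] by simp
      then show ?thesis .
    qed
    finally show ?thesis .
  qed simp
  have "(\<integral>\<^sup>+x. ennreal (f x powr (-a)) \<partial>M) \<le> (\<integral>\<^sup>+x. (\<Sum>k. ennreal (c k) * indicator (S k) x) \<partial>M)"
    by (rule nn_integral_mono) (rule pw)
  also have "\<dots> = (\<Sum>k. \<integral>\<^sup>+x. ennreal (c k) * indicator (S k) x \<partial>M)"
    by (rule nn_integral_suminf) measurable
  also have "\<dots> = (\<Sum>k. ennreal (c k) * emeasure M (S k))"
    by (simp add: nn_integral_cmult_indicator)
  also have "\<dots> \<le> (\<Sum>k. ennreal (C * (R / 2) powr (-a) * (2 * R) powr m * q ^ k))"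
  proof (rule suminf_le)
    fix k
    have half: "((1/2::real) ^ k) powr z = 2 powr (- (real k * z))" for z
    proof -
      have "((1/2::real) ^ k) = 2 powr (- real k)" by (simp add: powr_minus powr_realpow power_one_over inverse_eq_divide)
      then show ?thesis by (simp add: powr_powr)
    qed
    have qk: "q ^ k = 2 powr (real k * (a - m))"
    proof -
      have "q ^ k = q powr real k" using q by (simp add: powr_realpow)
      then show ?thesis by (simp add: q_def powr_powr mult.commute)
    qed
    have "ennreal (c k) * emeasure M (S k) \<le> ennreal (c k) * ennreal (C * (2 * R * (1/2) ^ k) powr m)"
      unfolding S_def using level R by (intro mult_left_mono) auto
    also have "\<dots> = ennreal (c k * (C * (2 * R * (1/2) ^ k) powr m))"
      using C by (intro ennreal_mult[symmetric]) (auto simp: c_def)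
    also have "c k * (C * (2 * R * (1/2) ^ k) powr m) = C * (R / 2) powr (-a) * (2 * R) powr m * q ^ k"
    proof -
      have 1: "c k = (R / 2) powr (-a) * 2 powr (real k * a)"
        unfolding c_def using R by (subst powr_mult) (auto simp: half)
      have 2: "(2 * R * (1/2) ^ k) powr m = (2 * R) powr m * 2 powr (- (real k * m))"
        using R by (subst powr_mult) (auto simp: half)
      have 3: "2 powr (real k * a) * 2 powr (- (real k * m)) = q ^ k"
        unfolding qk powr_add[symmetric] by (simp add: right_diff_distrib)
      show ?thesis unfolding 1 2 3[symmetric] by (simp only: mult_ac)
    qed
    finally show "ennreal (c k) * emeasure M (S k) \<le> ennreal (C * (R / 2) powr (-a) * (2 * R) powr m * q ^ k)" .
  qed auto
  also have "\<dots> = ennreal (\<Sum>k. C * (R / 2) powr (-a) * (2 * R) powr m * q ^ k)"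
    using q C by (intro suminf_ennreal2 summable_mult summable_geometric) auto
  also have "(\<Sum>k. C * (R / 2) powr (-a) * (2 * R) powr m * q ^ k) = C * (R / 2) powr (-a) * (2 * R) powr m / (1 - q)"
    using q by (subst suminf_mult) (auto simp: suminf_geometric summable_geometric)
  finally show ?thesis by (simp add: q_def)
qed

text \<open>The inverse \<open>B\<close> takes the ball of radius \<open>r\<close> about
  \<open>z\<close> into one of radius \<open>K * r\<close> about \<open>B *v z\<close>, so the
  volume bound is uniform in \<open>z\<close>.\<close>

lemma emeasure_affine_sublevel:
  fixes G :: "real ^ 'n ^ 'n"
  assumes G: "invertible G" and \<Omega>: "\<Omega> \<in> sets lebesgue"
  obtains C where "0 \<le> C" "\<And>z r. 0 < r \<Longrightarrow>
    emeasure (lebesgue_on \<Omega>) {x \<in> \<Omega>. norm (G *v x - z) < r} \<le> ennreal (C * r powr real CARD('n))"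
proof -
  obtain B where B: "B ** G = mat 1" using G by (auto simp: invertible_def)
  obtain K where K: "0 < K" "\<And>x. norm (B *v x) \<le> norm x * K"
    using bounded_linear.pos_bounded[OF matrix_vector_mul_bounded_linear[of B]] by blast
  have inv: "B *v (G *v x) = x" for x
    using B by (simp add: matrix_vector_mul_assoc)
  have "emeasure (lebesgue_on \<Omega>) {x \<in> \<Omega>. norm (G *v x - z) < r}
      \<le> ennreal (unit_ball_vol (real CARD('n)) * K ^ CARD('n) * r powr real CARD('n))" if r: "0 < r" for z r
  proof -
    let ?S = "{x \<in> \<Omega>. norm (G *v x - z) < r}"
    have "open {x. norm (G *v x - z) < r}"
      by (intro open_Collect_less continuous_intros linear_continuous_on matrix_vector_mul_bounded_linear)
    then have "{x. norm (G *v x - z) < r} \<in> sets lebesgue" by simp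
    then have S: "?S \<in> sets lebesgue" using sets.Int[OF \<Omega>] by (simp add: Collect_conj_eq)
    have sub: "?S \<subseteq> ball (B *v z) (K * r)"
    proof
      fix x assume "x \<in> ?S"
      then have x: "norm (G *v x - z) < r" by simp
      have "x - B *v z = B *v (G *v x - z)" by (simp add: inv matrix_vector_mult_diff_distrib)
      then have "norm (x - B *v z) \<le> norm (G *v x - z) * K" using K(2) by simp
      also have "\<dots> < r * K" using x K(1) by simp
      finally show "x \<in> ball (B *v z) (K * r)" by (simp add: dist_norm norm_minus_commute mult.commute)
    qed
    have "emeasure (lebesgue_on \<Omega>) ?S = emeasure lebesgue ?S"
      using \<Omega> by (intro emeasure_restrict_space) auto
    also have "\<dots> \<le> emeasure lebesgue (ball (B *v z) (K * r))"
      by (rule emeasure_mono[OF sub]) simp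
    also have "\<dots> = ennreal (unit_ball_vol (real CARD('n)) * (K * r) ^ CARD('n))"
      using K r by (simp add: emeasure_ball)
    also have "(K * r) ^ CARD('n) = K ^ CARD('n) * r powr real CARD('n)"
      using r by (simp add: power_mult_distrib powr_realpow)
    finally show ?thesis by (simp add: mult.assoc)
  qed
  moreover have "0 \<le> unit_ball_vol (real CARD('n)) * K ^ CARD('n)" using K by simp
  ultimately show ?thesis using that by blast
qed

text \<open>The time interval is cut into \<open>n\<close> pieces shorter than
  \<open>\<delta>\<close>, on which the curve expands distances: two times in the set and in one
  piece are at most \<open>2 * r / c\<close> apart, so each piece contributes at most
  \<open>4 * r / c\<close>. Distinct pieces may come close in space; this is paid for by the factor
  \<open>n\<close>.\<close>

lemma emeasure_curve_sublevel:
  fixes h :: "real \<Rightarrow> 'a::real_normed_vector"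
  assumes T: "0 < T" and c: "0 < c" "0 < \<delta>" and h: "continuous_on {0..T} h"
    and expand: "\<And>a b. 0 \<le> a \<Longrightarrow> a < b \<Longrightarrow> b \<le> T \<Longrightarrow> b - a \<le> \<delta> \<Longrightarrow> c * (b - a) \<le> norm (h b - h a)"
  obtains C where "0 \<le> C" "\<And>z r. 0 < r \<Longrightarrow>
    emeasure (lebesgue_on {0<..<T}) {t \<in> {0<..<T}. norm (z - h t) < r} \<le> ennreal (C * r)"
proof -
  obtain n where n: "T / \<delta> < real n" using reals_Archimedean2 by blast
  have n0: "0 < real n" using n T c by (metis divide_pos_pos less_trans)
  have Tn: "T / real n < \<delta>" using n n0 c by (simp add: field_simps)
  define J where "J k = {T * real k / real n .. T * real (Suc k) / real n}" for k
  have "emeasure (lebesgue_on {0<..<T}) {t \<in> {0<..<T}. norm (z - h t) < r} \<le> ennreal (real n * 4 / c * r)"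
    if r: "0 < r" for z r
  proof -
    let ?S = "{t \<in> {0<..<T}. norm (z - h t) < r}"
    have cont: "continuous_on {0<..<T} (\<lambda>t. norm (z - h t))"
      by (intro continuous_intros continuous_on_subset[OF h]) auto
    have "open ?S"
      using continuous_open_preimage[OF cont open_greaterThanLessThan open_lessThan[of r]]
      by (simp add: vimage_def Int_def)
    have S: "?S \<in> sets lebesgue" using \<open>open ?S\<close> by simp
    have SJ_sets: "?S \<inter> J k \<in> sets lebesgue" for k
      by (rule sets.Int[OF S]) (simp add: J_def)
    have SJ: "emeasure lebesgue (?S \<inter> J k) \<le> ennreal (4 * r / c)" for k
    proof (cases "?S \<inter> J k = {}")
      case False
      then obtain u where u: "u \<in> ?S" "u \<in> J k" by blast
      have step: "T * real (Suc k) / real n = T * real k / real n + T / real n"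
        by (simp add: distrib_left add_divide_distrib)
      have "?S \<inter> J k \<subseteq> {u - 2 * r / c .. u + 2 * r / c}"
      proof
        fix t assume t: "t \<in> ?S \<inter> J k"
        have ht: "norm (h t - h u) < 2 * r"
        proof -
          have "norm (h t - h u) \<le> norm (z - h u) + norm (z - h t)"
            using norm_triangle_ineq4[of "z - h u" "z - h t"] by simp
          then show ?thesis using t u by auto
        qed
        have ex: "c * \<bar>t - u\<bar> \<le> norm (h t - h u)"
        proof -
          have "\<bar>t - u\<bar> \<le> \<delta>" using t u(2) Tn step unfolding J_def by auto
          then show ?thesis using expand[of t u] expand[of u t] t u
            by (cases t u rule: linorder_cases) (auto simp: norm_minus_commute)
        qed
        then have "\<bar>t - u\<bar> \<le> 2 * r / c" using ht c by (simp add: field_simps)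
        then show "t \<in> {u - 2 * r / c .. u + 2 * r / c}" by auto
      qed
      then have "emeasure lebesgue (?S \<inter> J k) \<le> emeasure lebesgue {u - 2 * r / c .. u + 2 * r / c}"
        by (intro emeasure_mono) auto
      also have "\<dots> = ennreal (u + 2 * r / c - (u - 2 * r / c))" using r c by simp
      also have "u + 2 * r / c - (u - 2 * r / c) = 4 * r / c" by simp
      finally show ?thesis .
    qed simp
    have cover: "?S \<subseteq> (\<Union>k<n. ?S \<inter> J k)"
    proof
      fix t assume t: "t \<in> ?S"
      define k where "k = nat \<lfloor>t * real n / T\<rfloor>"
      have fl: "real k \<le> t * real n / T" "t * real n / T < real k + 1"
        using t T unfolding k_def by (simp_all add: of_nat_nat)
      have "t * real n / T < real n" using t T n0 by (simp add: field_simps)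
      with fl have "real k < real n" by linarith
      moreover have "t \<in> J k" unfolding J_def using fl T n0 by (simp add: field_simps)
      ultimately show "t \<in> (\<Union>k<n. ?S \<inter> J k)" using t by auto
    qed
    have "emeasure (lebesgue_on {0<..<T}) ?S = emeasure lebesgue ?S"
      by (intro emeasure_restrict_space) auto
    also have "\<dots> \<le> emeasure lebesgue (\<Union>k<n. ?S \<inter> J k)"
      by (rule emeasure_mono[OF cover]) (intro sets.finite_UN SJ_sets, simp)
    also have "\<dots> \<le> (\<Sum>k<n. emeasure lebesgue (?S \<inter> J k))"
      by (rule emeasure_subadditive_finite) (use SJ_sets in blast)+
    also have "\<dots> \<le> (\<Sum>k<n. ennreal (4 * r / c))" by (intro sum_mono SJ)
    also have "\<dots> = ennreal (real n * 4 / c * r)"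
      using r c by (simp add: ennreal_of_nat_eq_real_of_nat ennreal_mult[symmetric] mult_ac)
    finally show ?thesis .
  qed
  moreover have "0 \<le> real n * 4 / c" using c by simp
  ultimately show ?thesis using that by blast
qed

section \<open>The dipole kernel\<close>

text \<open>Schur's test: Cauchy-Schwarz in \<open>x\<close> separates
  \<open>\<rho> powr (- a / 2)\<close>, controlled by \<open>A\<close> at fixed \<open>t\<close>;
  after Tonelli the rest is controlled by \<open>B\<close> at fixed \<open>x\<close>. The uneven
  splitting of \<open>2 * p\<close> exploits that \<open>x\<close> has more dimensions than
  \<open>t\<close>.\<close>

lemma nn_integral_Schur_square:
  fixes \<rho> :: "'a \<Rightarrow> 'b \<Rightarrow> real"
  assumes fin: "finite_measure M" "finite_measure N"
    and \<rho>: "(\<lambda>(x, t). \<rho> x t) \<in> borel_measurable (M \<Otimes>\<^sub>M N)"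
    and A: "\<And>t. t \<in> space N \<Longrightarrow> (\<integral>\<^sup>+x. ennreal (\<rho> x t powr (-a)) \<partial>M) \<le> ennreal A" "0 \<le> A"
    and B: "\<And>x. x \<in> space M \<Longrightarrow> (\<integral>\<^sup>+t. ennreal (\<rho> x t powr (-b)) \<partial>N) \<le> ennreal B" "0 \<le> B"
    and ab: "a + b = 2 * p" and K: "0 \<le> K" and c: "c \<in> l2_space M"
  shows "(\<integral>\<^sup>+t. (\<integral>\<^sup>+x. ennreal (\<bar>c x\<bar> * (K * \<rho> x t powr (-p))) \<partial>M)\<^sup>2 \<partial>N)
    \<le> ennreal ((K * sqrt (A * B) * l2_norm M c)\<^sup>2)"
proof -
  interpret M: finite_measure M by fact
  interpret N: finite_measure N by fact
  interpret MN: pair_sigma_finite M N ..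
  note [measurable] = l2_spaceD(1)[OF c]
  have [measurable]: "(\<lambda>x. \<rho> x t) \<in> borel_measurable M" if "t \<in> space N" for t
  proof -
    have "(\<lambda>x. (x, t)) \<in> measurable M (M \<Otimes>\<^sub>M N)" using that by (intro measurable_Pair) auto
    from measurable_compose[OF this \<rho>] show ?thesis by simp
  qed
  have [measurable]: "(\<lambda>t. \<rho> x t) \<in> borel_measurable N" if "x \<in> space M" for x
  proof -
    have "(\<lambda>t. (x, t)) \<in> measurable N (M \<Otimes>\<^sub>M N)" using that by (intro measurable_Pair) auto
    from measurable_compose[OF this \<rho>] show ?thesis by simp
  qed
  have \<rho>'[measurable]: "(\<lambda>z. \<rho> (fst z) (snd z)) \<in> borel_measurable (M \<Otimes>\<^sub>M N)"
    using \<rho> by (simp add: case_prod_unfold)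
  have half: "(y powr (-z / 2))\<^sup>2 = y powr (-z)" for y z :: real
    unfolding power2_eq_square powr_add[symmetric] by simp
  have CS: "(\<integral>\<^sup>+x. ennreal (\<bar>c x\<bar> * (K * \<rho> x t powr (-p))) \<partial>M)\<^sup>2
      \<le> ennreal A * (\<integral>\<^sup>+x. ennreal (K\<^sup>2 * (c x)\<^sup>2 * \<rho> x t powr (-b)) \<partial>M)" if t: "t \<in> space N" for t
  proof -
    have p: "\<rho> x t powr (-p) = \<rho> x t powr (-a / 2) * \<rho> x t powr (-b / 2)" for x
    proof -
      have "-p = -a / 2 + -b / 2" using ab by simp
      then show ?thesis by (simp only: powr_add)
    qed
    have "(\<integral>\<^sup>+x. ennreal (\<bar>c x\<bar> * (K * \<rho> x t powr (-p))) \<partial>M)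
        = (\<integral>\<^sup>+x. ennreal (\<rho> x t powr (-a / 2)) * ennreal (K * \<bar>c x\<bar> * \<rho> x t powr (-b / 2)) \<partial>M)"
      unfolding p using K by (intro nn_integral_cong) (simp add: ennreal_mult[symmetric] mult_ac)
    also have "\<dots>\<^sup>2 \<le> (\<integral>\<^sup>+x. (ennreal (\<rho> x t powr (-a / 2)))\<^sup>2 \<partial>M)
        * (\<integral>\<^sup>+x. (ennreal (K * \<bar>c x\<bar> * \<rho> x t powr (-b / 2)))\<^sup>2 \<partial>M)"
      using t by (intro Cauchy_Schwarz_nn_integral) measurable
    also have "(\<integral>\<^sup>+x. (ennreal (\<rho> x t powr (-a / 2)))\<^sup>2 \<partial>M) = (\<integral>\<^sup>+x. ennreal (\<rho> x t powr (-a)) \<partial>M)"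
      by (simp only: ennreal_power powr_ge_zero half)
    also have "(\<integral>\<^sup>+x. (ennreal (K * \<bar>c x\<bar> * \<rho> x t powr (-b / 2)))\<^sup>2 \<partial>M)
        = (\<integral>\<^sup>+x. ennreal (K\<^sup>2 * (c x)\<^sup>2 * \<rho> x t powr (-b)) \<partial>M)"
    proof (rule nn_integral_cong)
      fix x
      show "(ennreal (K * \<bar>c x\<bar> * \<rho> x t powr (-b / 2)))\<^sup>2 = ennreal (K\<^sup>2 * (c x)\<^sup>2 * \<rho> x t powr (-b))"
        using K half[of "\<rho> x t" b] by (simp add: ennreal_power power_mult_distrib)
    qed
    also have "(\<integral>\<^sup>+x. ennreal (\<rho> x t powr (-a)) \<partial>M) * (\<integral>\<^sup>+x. ennreal (K\<^sup>2 * (c x)\<^sup>2 * \<rho> x t powr (-b)) \<partial>M)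
        \<le> ennreal A * (\<integral>\<^sup>+x. ennreal (K\<^sup>2 * (c x)\<^sup>2 * \<rho> x t powr (-b)) \<partial>M)"
      by (intro mult_right_mono A t) simp
    finally show ?thesis .
  qed
  have "(\<integral>\<^sup>+t. (\<integral>\<^sup>+x. ennreal (\<bar>c x\<bar> * (K * \<rho> x t powr (-p))) \<partial>M)\<^sup>2 \<partial>N)
      \<le> (\<integral>\<^sup>+t. ennreal A * (\<integral>\<^sup>+x. ennreal (K\<^sup>2 * (c x)\<^sup>2 * \<rho> x t powr (-b)) \<partial>M) \<partial>N)"
    by (rule nn_integral_mono) (rule CS)
  also have "\<dots> = ennreal A * (\<integral>\<^sup>+t. (\<integral>\<^sup>+x. ennreal (K\<^sup>2 * (c x)\<^sup>2 * \<rho> x t powr (-b)) \<partial>M) \<partial>N)"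
  proof (rule nn_integral_cmult)
    have "(\<lambda>z. ennreal (K\<^sup>2 * (c (snd z))\<^sup>2 * \<rho> (snd z) (fst z) powr (-b))) \<in> borel_measurable (N \<Otimes>\<^sub>M M)"
    proof -
      have "(\<lambda>z. \<rho> (snd z) (fst z)) \<in> borel_measurable (N \<Otimes>\<^sub>M M)"
        using measurable_compose[OF measurable_pair_swap' \<rho>'] by (simp add: case_prod_unfold)
      then show ?thesis by measurable
    qed
    then show "(\<lambda>t. \<integral>\<^sup>+x. ennreal (K\<^sup>2 * (c x)\<^sup>2 * \<rho> x t powr (-b)) \<partial>M) \<in> borel_measurable N"
      by (intro M.borel_measurable_nn_integral) (simp add: case_prod_unfold)
  qed
  also have "(\<integral>\<^sup>+t. (\<integral>\<^sup>+x. ennreal (K\<^sup>2 * (c x)\<^sup>2 * \<rho> x t powr (-b)) \<partial>M) \<partial>N)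
      = (\<integral>\<^sup>+x. (\<integral>\<^sup>+t. ennreal (K\<^sup>2 * (c x)\<^sup>2 * \<rho> x t powr (-b)) \<partial>N) \<partial>M)"
    by (rule MN.Fubini') (simp add: case_prod_unfold, measurable)
  also have "\<dots> \<le> (\<integral>\<^sup>+x. ennreal (K\<^sup>2 * B) * ennreal ((c x)\<^sup>2) \<partial>M)"
  proof (rule nn_integral_mono)
    fix x assume x: "x \<in> space M"
    have "(\<integral>\<^sup>+t. ennreal (K\<^sup>2 * (c x)\<^sup>2 * \<rho> x t powr (-b)) \<partial>N)
        = (\<integral>\<^sup>+t. ennreal (K\<^sup>2 * (c x)\<^sup>2) * ennreal (\<rho> x t powr (-b)) \<partial>N)"
      by (simp add: ennreal_mult)
    also have "\<dots> = ennreal (K\<^sup>2 * (c x)\<^sup>2) * (\<integral>\<^sup>+t. ennreal (\<rho> x t powr (-b)) \<partial>N)"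
      using x by (intro nn_integral_cmult) measurable
    also have "\<dots> \<le> ennreal (K\<^sup>2 * (c x)\<^sup>2) * ennreal B" by (intro mult_left_mono B x) simp
    also have "\<dots> = ennreal (K\<^sup>2 * B) * ennreal ((c x)\<^sup>2)"
      using B(2) by (simp add: ennreal_mult[symmetric] mult_ac)
    finally show "(\<integral>\<^sup>+t. ennreal (K\<^sup>2 * (c x)\<^sup>2 * \<rho> x t powr (-b)) \<partial>N) \<le> ennreal (K\<^sup>2 * B) * ennreal ((c x)\<^sup>2)" .
  qed
  also have "\<dots> = ennreal (K\<^sup>2 * B) * ennreal ((l2_norm M c)\<^sup>2)"
    by (subst nn_integral_cmult) (measurable, simp add: l2_norm_nn_integral[OF c])
  finally have "(\<integral>\<^sup>+t. (\<integral>\<^sup>+x. ennreal (\<bar>c x\<bar> * (K * \<rho> x t powr (-p))) \<partial>M)\<^sup>2 \<partial>N)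
      \<le> ennreal A * (ennreal (K\<^sup>2 * B) * ennreal ((l2_norm M c)\<^sup>2))"
    by (simp add: mult_left_mono)
  also have "\<dots> = ennreal ((K * sqrt (A * B) * l2_norm M c)\<^sup>2)"
    using A(2) B(2) by (simp add: ennreal_mult[symmetric] power_mult_distrib mult_ac)
  finally show ?thesis .
qed

text \<open>An entry of the orthogonal projection onto the complement of \<open>z\<close>, divided
  by \<open>norm z\<close>. At \<open>z = 0\<close> it is 0 by the convention for division, in
  agreement with \<open>limit_kernel\<close>.\<close>

definition dipole_kernel :: "'n \<Rightarrow> 'n \<Rightarrow> real ^ 'n \<Rightarrow> real" where
  "dipole_kernel i j z = (if i = j then 1 / norm z else 0) - z $ i * z $ j / norm z ^ 3"

section \<open>Size and Hoelder continuity of the dipole kernel\<close>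

lemma dipole_kernel_0: "dipole_kernel i j 0 = 0"
  by (simp add: dipole_kernel_def)

lemma dipole_kernel_unit:
  assumes "z \<noteq> 0"
  shows "dipole_kernel i j z = ((if i = j then 1 else 0) - sgn z $ i * sgn z $ j) / norm z"
  using assms by (simp add: dipole_kernel_def sgn_div_norm divide_inverse power3_eq_cube algebra_simps)

lemma sgn_component_le: "\<bar>sgn z $ i\<bar> \<le> 1" for z :: "real ^ 'n"
  using component_le_norm_cart[of "sgn z" i] by (simp add: norm_sgn split: if_splits)

lemma dipole_kernel_le: "\<bar>dipole_kernel i j z\<bar> \<le> 2 / norm z"
proof (cases "z = 0")
  case False
  have "\<bar>sgn z $ i * sgn z $ j\<bar> \<le> 1 * 1"
    unfolding abs_mult by (intro mult_mono sgn_component_le) auto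
  then have "\<bar>(if i = j then 1 else 0) - sgn z $ i * sgn z $ j\<bar> \<le> 2" by (auto simp: abs_le_iff)
  then show ?thesis using False by (simp add: dipole_kernel_unit abs_divide divide_right_mono)
qed (simp add: dipole_kernel_0)

text \<open>Multiplied by \<open>norm z\<close>, the difference splits into \<open>z - w\<close> and
  a change of length along \<open>sgn w\<close>, each of norm at most
  \<open>norm (z - w)\<close>.\<close>

lemma norm_sgn_diff_le:
  fixes z w :: "'a::real_normed_vector"
  assumes "z \<noteq> 0" "w \<noteq> 0"
  shows "norm (sgn z - sgn w) \<le> 2 * norm (z - w) / norm z"
proof -
  have "norm z *\<^sub>R (sgn z - sgn w) = (z - w) + (norm w - norm z) *\<^sub>R sgn w"
    using assms by (simp add: sgn_div_norm algebra_simps)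
  then have "norm (norm z *\<^sub>R (sgn z - sgn w)) \<le> norm (z - w) + \<bar>norm w - norm z\<bar>"
    using norm_triangle_ineq[of "z - w" "(norm w - norm z) *\<^sub>R sgn w"] assms
    by (simp add: norm_sgn)
  also have "\<dots> \<le> 2 * norm (z - w)" using norm_triangle_ineq3[of w z] by (simp add: norm_minus_commute)
  finally have "norm z * norm (sgn z - sgn w) \<le> 2 * norm (z - w)" by simp
  then show ?thesis using assms by (simp add: pos_le_divide_eq mult.commute)
qed

text \<open>The change of \<open>1 / norm z\<close> contributes 2, a crude bound for the entries of
  the projection, and the change of the two direction factors contributes 4. It matters for the
  interpolation that the denominator is the product of both norms.\<close>

lemma dipole_kernel_diff_le:
  assumes z: "z \<noteq> 0" and w: "w \<noteq> 0"
  shows "\<bar>dipole_kernel i j z - dipole_kernel i j w\<bar> \<le> 6 * norm (z - w) / (norm z * norm w)"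
proof -
  let ?d = "if i = j then 1 else 0 :: real"
  define e f where "e = sgn z" and "f = sgn w"
  have e1: "\<bar>e $ i\<bar> \<le> 1" "\<bar>f $ j\<bar> \<le> 1" "\<bar>e $ j\<bar> \<le> 1"
    by (simp_all add: e_def f_def sgn_component_le)
  have inv: "\<bar>1 / norm z - 1 / norm w\<bar> \<le> norm (z - w) / (norm z * norm w)"
  proof -
    have "1 / norm z - 1 / norm w = (norm w - norm z) / (norm z * norm w)"
      using z w by (simp add: field_simps)
    then show ?thesis using norm_triangle_ineq3[of w z]
      by (simp add: abs_divide abs_mult divide_right_mono norm_minus_commute)
  qed
  have "\<bar>e $ i * e $ j - f $ i * f $ j\<bar> = \<bar>e $ i * (e $ j - f $ j) + (e $ i - f $ i) * f $ j\<bar>"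
    by (simp add: algebra_simps)
  also have "\<dots> \<le> \<bar>e $ i\<bar> * \<bar>e $ j - f $ j\<bar> + \<bar>e $ i - f $ i\<bar> * \<bar>f $ j\<bar>"
    unfolding abs_mult[symmetric] by (rule abs_triangle_ineq)
  also have "\<dots> \<le> 1 * norm (e - f) + norm (e - f) * 1"
    using e1 component_le_norm_cart[of "e - f" i] component_le_norm_cart[of "e - f" j]
    by (intro add_mono mult_mono) auto
  also have "\<dots> \<le> 4 * norm (z - w) / norm z"
    using norm_sgn_diff_le[OF z w] by (simp add: e_def f_def)
  finally have ef: "\<bar>e $ i * e $ j - f $ i * f $ j\<bar> \<le> 4 * norm (z - w) / norm z" .
  have "\<bar>e $ i * e $ j\<bar> \<le> 1 * 1" unfolding abs_mult using e1 by (intro mult_mono) auto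
  then have de: "\<bar>?d - e $ i * e $ j\<bar> \<le> 2" by (auto simp: abs_le_iff)
  have "dipole_kernel i j z - dipole_kernel i j w
      = (?d - e $ i * e $ j) * (1 / norm z - 1 / norm w) - (e $ i * e $ j - f $ i * f $ j) / norm w"
    unfolding dipole_kernel_unit[OF z] dipole_kernel_unit[OF w] e_def[symmetric] f_def[symmetric]
    by (simp add: diff_divide_distrib left_diff_distrib right_diff_distrib)
  also have "\<bar>\<dots>\<bar> \<le> \<bar>(?d - e $ i * e $ j) * (1 / norm z - 1 / norm w)\<bar> + \<bar>(e $ i * e $ j - f $ i * f $ j) / norm w\<bar>"
    by (rule abs_triangle_ineq4)
  also have "\<dots> \<le> 2 * (norm (z - w) / (norm z * norm w)) + (4 * norm (z - w) / norm z) / norm w"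
  proof (rule add_mono)
    show "\<bar>(?d - e $ i * e $ j) * (1 / norm z - 1 / norm w)\<bar> \<le> 2 * (norm (z - w) / (norm z * norm w))"
      unfolding abs_mult by (rule mult_mono[OF de inv]) auto
    show "\<bar>(e $ i * e $ j - f $ i * f $ j) / norm w\<bar> \<le> (4 * norm (z - w) / norm z) / norm w"
      unfolding abs_divide abs_norm_cancel by (rule divide_right_mono[OF ef]) simp
  qed
  also have "\<dots> = 6 * norm (z - w) / (norm z * norm w)" by simp
  finally show ?thesis .
qed

text \<open>Since \<open>norm (z - w) \<le> 2 * norm w\<close>, the power
  \<open>1 - \<theta>\<close> of \<open>norm (z - w)\<close> is traded for that of
  \<open>norm w\<close>. A negative power of \<open>norm w\<close> is left, which is at most that of
  the smaller \<open>norm z\<close>.\<close>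

lemma interpolation_le:
  fixes z w :: "'a::real_normed_vector"
  assumes z: "z \<noteq> 0" and w: "w \<noteq> 0" and le: "norm z \<le> norm w" and \<theta>: "0 < \<theta>" "\<theta> \<le> 1"
  shows "norm (z - w) / (norm z * norm w) \<le> 2 * norm (z - w) powr \<theta> * norm z powr (- (1 + \<theta>))"
proof (cases "z = w")
  case False
  define D a b where "D = norm (z - w)" and "a = norm z" and "b = norm w"
  have pos: "0 < D" "0 < a" "0 < b" "a \<le> b" using z w le False by (auto simp: D_def a_def b_def)
  have "D \<le> 2 * b" using norm_triangle_ineq4[of z w] le by (simp add: D_def b_def)
  then have "D powr (1 - \<theta>) \<le> (2 * b) powr (1 - \<theta>)" using pos \<theta> by (intro powr_mono2) auto
  also have "\<dots> = 2 powr (1 - \<theta>) * b powr (1 - \<theta>)" using pos by (simp add: powr_mult)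
  also have "\<dots> \<le> 2 powr 1 * b powr (1 - \<theta>)" using \<theta> by (intro mult_right_mono powr_mono) auto
  finally have "D powr \<theta> * D powr (1 - \<theta>) \<le> D powr \<theta> * (2 * b powr (1 - \<theta>))"
    by (intro mult_left_mono) auto
  moreover have "D powr \<theta> * D powr (1 - \<theta>) = D" unfolding powr_add[symmetric] using pos by simp
  ultimately have "D \<le> D powr \<theta> * (2 * b powr (1 - \<theta>))" by simp
  then have "D / (a * b) \<le> D powr \<theta> * (2 * b powr (1 - \<theta>)) / (a * b)"
    using pos by (intro divide_right_mono) auto
  also have "\<dots> = 2 * D powr \<theta> * (b powr (- \<theta>) / a)"
  proof -
    have "b powr (1 - \<theta>) = b * b powr (- \<theta>)" using pos powr_add[of b 1 "-\<theta>"] by simp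
    then show ?thesis using pos by simp
  qed
  also have "\<dots> \<le> 2 * D powr \<theta> * (a powr (- \<theta>) / a)"
    using pos \<theta> by (intro mult_left_mono divide_right_mono powr_mono2') auto
  also have "a powr (- \<theta>) / a = a powr (- (1 + \<theta>))"
  proof -
    have "a powr (- (1 + \<theta>)) = a powr (- 1) * a powr (- \<theta>)" unfolding powr_add[symmetric] by simp
    then show ?thesis using pos by (simp add: powr_minus_divide)
  qed
  finally show ?thesis by (simp add: D_def a_def b_def)
qed simp

text \<open>The interpolation is applied with the smaller norm in the first place. If one argument
  is 0, the kernel and the negative power there are 0 by convention, \<open>norm (z - w)\<close> is
  the norm of the other argument, and the size bound suffices.\<close>

lemma dipole_kernel_hoelder:
  fixes z w :: "real ^ 'n"
  assumes \<theta>: "0 < \<theta>" "\<theta> \<le> 1"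
  shows "\<bar>dipole_kernel i j z - dipole_kernel i j w\<bar>
    \<le> 12 * norm (z - w) powr \<theta> * (norm z powr (- (1 + \<theta>)) + norm w powr (- (1 + \<theta>)))"
proof -
  have single: "\<bar>dipole_kernel i j z\<bar> \<le> 12 * norm z powr \<theta> * norm z powr (- (1 + \<theta>))" for z :: "real ^ 'n"
  proof (cases "z = 0")
    case False
    have "norm z powr \<theta> * norm z powr (- (1 + \<theta>)) = norm z powr (- 1)" unfolding powr_add[symmetric] by simp
    also have "\<dots> = 1 / norm z" using False by (simp add: powr_minus_divide)
    finally have "12 * norm z powr \<theta> * norm z powr (- (1 + \<theta>)) = 12 / norm z" by (simp add: mult.assoc)
    moreover have "2 / norm z \<le> 12 / norm z" by (intro divide_right_mono) auto
    ultimately show ?thesis using dipole_kernel_le[of i j z] by linarith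
  qed (simp add: dipole_kernel_0)
  consider "z = 0" | "w = 0" | "z \<noteq> 0" "w \<noteq> 0" by blast
  then show ?thesis
  proof cases
    case 1
    then show ?thesis using single[of w] by (simp add: dipole_kernel_0)
  next
    case 2
    then show ?thesis using single[of z] by (simp add: dipole_kernel_0)
  next
    case 3
    have "norm (z - w) / (norm z * norm w)
        \<le> 2 * norm (z - w) powr \<theta> * (norm z powr (- (1 + \<theta>)) + norm w powr (- (1 + \<theta>)))"
    proof (cases "norm z \<le> norm w")
      case True
      show ?thesis
        by (rule order_trans[OF interpolation_le[OF 3 True \<theta>]]) (intro mult_left_mono, auto)
    next
      case False
      then have "norm (w - z) / (norm w * norm z) \<le> 2 * norm (w - z) powr \<theta> * norm w powr (- (1 + \<theta>))"
        using 3 \<theta> by (intro interpolation_le) auto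
      also have "\<dots> \<le> 2 * norm (w - z) powr \<theta> * (norm z powr (- (1 + \<theta>)) + norm w powr (- (1 + \<theta>)))"
        by (intro mult_left_mono) auto
      finally show ?thesis by (simp only: norm_minus_commute[of w z] mult.commute[of "norm w"])
    qed
    then show ?thesis using dipole_kernel_diff_le[OF 3, of i j] by simp
  qed
qed

lemma borel_measurable_dipole_kernel: "dipole_kernel i j \<in> borel_measurable borel"
proof -
  have [measurable]: "(\<lambda>z :: real ^ 'n. z $ i) \<in> borel_measurable borel" for i
    by (intro borel_measurable_continuous_onI continuous_intros)
  show ?thesis unfolding dipole_kernel_def[abs_def] by measurable
qed

section \<open>The limit operator\<close>

context weakly_singular_kernels
begin

text \<open>The limit operator is known to have the form \<open>A\<close> only at times in the
  interval; norms over \<open>N\<close> do not see other times.\<close>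

lemma approximable_cong:
  assumes F: "\<And>c t. t \<in> {0<..<T} \<Longrightarrow> F c t = A c t"
  shows "approximable_operator M N F CARD('n) (L * real CARD('n) * (3 * T powr \<theta> * W)) \<theta>"
proof -
  interpret A: approximable_operator M N A "CARD('n)" "L * real CARD('n) * (3 * T powr \<theta> * W)" \<theta>
    by (rule approximable)
  have norm: "l2_norm N (F c) = l2_norm N (A c)" for c
    unfolding l2_norm_eq_sqrt by (intro arg_cong[of _ _ sqrt] Bochner_Integration.integral_cong) (auto simp: F)
  show ?thesis
  proof unfold_locales
    show "F f \<in> l2_space N" if "f \<in> l2_space M" for f
    proof -
      have "F f \<in> borel_measurable N \<longleftrightarrow> A f \<in> borel_measurable N"
        by (rule measurable_cong) (simp add: F)
      moreover have "integrable N (\<lambda>t. (F f t)\<^sup>2) \<longleftrightarrow> integrable N (\<lambda>t. (A f t)\<^sup>2)"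
        by (rule Bochner_Integration.integrable_cong) (simp_all add: F)
      ultimately show ?thesis using A.A_l2[OF that] by (simp add: l2_space_def)
    qed
    show "AE t in N. F (\<lambda>x. a * f x + b * h x) t = a * F f t + b * F h t"
      if fh: "f \<in> l2_space M" "h \<in> l2_space M" for f h a b
    proof -
      have "AE t in N. t \<in> {0<..<T}" by (rule AE_I2) simp
      with A.A_lincomb[OF fh, of a b] show ?thesis by eventually_elim (simp add: F)
    qed
  qed (use A.d_pos A.K_nonneg A.theta_pos A.approx in \<open>simp_all only: norm\<close>)
qed

end

text \<open>Each part is a triangle inequality with one quotient. The quotient over
  \<open>[0, T]\<close> bounds \<open>h'\<close>, the one over \<open>[a, b]\<close> compared with
  both end points gives a Hoelder bound for \<open>h'\<close>, and over short intervals it cannot be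
  smaller than half of \<open>c\<close>.\<close>

lemma hoelder_quotient_consequences:
  fixes h h' :: "real \<Rightarrow> real ^ 'n"
  assumes T: "0 < T" and C: "0 \<le> C" "0 < \<alpha>"
    and quot: "\<And>a b t. 0 \<le> a \<Longrightarrow> a < b \<Longrightarrow> b \<le> T \<Longrightarrow> t \<in> {a..b} \<Longrightarrow> norm (quot h a b - h' t) \<le> C * (b - a) powr \<alpha>"
  shows "\<exists>L\<ge>0. \<forall>t\<in>{0..T}. norm (h' t) \<le> L"
    and "\<exists>L\<ge>0. \<forall>t\<in>{0..T}. \<forall>u\<in>{0..T}. norm (h t - h u) \<le> L * \<bar>t - u\<bar>"
    and "continuous_on {0..T} h'"
    and "0 < c \<Longrightarrow> (\<And>t. t \<in> {0..T} \<Longrightarrow> c \<le> norm (h' t)) \<Longrightarrow>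
      \<exists>\<delta>>0. \<forall>a b. 0 \<le> a \<longrightarrow> a < b \<longrightarrow> b \<le> T \<longrightarrow> b - a \<le> \<delta> \<longrightarrow> c / 2 * (b - a) \<le> norm (h b - h a)"
proof -
  have diff: "norm (h b - h a) = (b - a) * norm (quot h a b)" if "a < b" for a b
    using that by simp
  define L where "L = norm (quot h 0 T) + C * T powr \<alpha>"
  have L0: "0 \<le> L" using C by (simp add: L_def)
  have L: "norm (h' t) \<le> L" if "t \<in> {0..T}" for t
    using quot[of 0 T t] that T norm_triangle_ineq2[of "h' t" "quot h 0 T"]
    by (simp add: L_def norm_minus_commute)
  then show "\<exists>L\<ge>0. \<forall>t\<in>{0..T}. norm (h' t) \<le> L" using L0 by blast
  define L1 where "L1 = L + C * T powr \<alpha>"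
  have lip: "norm (h b - h a) \<le> L1 * (b - a)" if "0 \<le> a" "a < b" "b \<le> T" for a b
  proof -
    have "norm (quot h a b) \<le> norm (h' a) + C * (b - a) powr \<alpha>"
      using quot[of a b a] that norm_triangle_ineq2[of "quot h a b" "h' a"] by simp
    also have "\<dots> \<le> L + C * T powr \<alpha>"
      using that C by (intro add_mono L mult_left_mono powr_mono2) auto
    finally show ?thesis unfolding diff[OF that(2)] L1_def using that by (simp add: mult.commute mult_left_mono)
  qed
  have "norm (h t - h u) \<le> L1 * \<bar>t - u\<bar>" if "t \<in> {0..T}" "u \<in> {0..T}" for t u
    using lip[of t u] lip[of u t] that by (cases t u rule: linorder_cases) (auto simp: norm_minus_commute)
  moreover have "0 \<le> L1" using L0 C by (simp add: L1_def)
  ultimately show "\<exists>L\<ge>0. \<forall>t\<in>{0..T}. \<forall>u\<in>{0..T}. norm (h t - h u) \<le> L * \<bar>t - u\<bar>" by blast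
  have hol: "norm (h' t - h' u) \<le> 2 * C * \<bar>t - u\<bar> powr \<alpha>" if tu: "t \<in> {0..T}" "u \<in> {0..T}" for t u
  proof -
    have *: "norm (h' b - h' a) \<le> 2 * C * \<bar>b - a\<bar> powr \<alpha>" if "0 \<le> a" "a < b" "b \<le> T" for a b
      using quot[of a b a] quot[of a b b] that norm_triangle_ineq4[of "quot h a b - h' a" "quot h a b - h' b"]
      by simp
    show ?thesis using *[of t u] *[of u t] tu
      by (cases t u rule: linorder_cases) (auto simp: norm_minus_commute abs_minus_commute)
  qed
  show "continuous_on {0..T} h'"
    unfolding continuous_on_def
  proof
    fix t assume t: "t \<in> {0..T}"
    have "((\<lambda>u. 2 * C * \<bar>u - t\<bar> powr \<alpha>) \<longlongrightarrow> 2 * C * \<bar>t - t\<bar> powr \<alpha>) (at t within {0..T})"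
      using C by (intro tendsto_mult tendsto_const tendsto_powr2 tendsto_rabs tendsto_diff tendsto_ident_at) auto
    then have "((\<lambda>u. 2 * C * \<bar>u - t\<bar> powr \<alpha>) \<longlongrightarrow> 0) (at t within {0..T})" using C by simp
    moreover have "\<forall>\<^sub>F u in at t within {0..T}. norm (h' u - h' t) \<le> 2 * C * \<bar>u - t\<bar> powr \<alpha>"
      using hol t by (auto simp: eventually_at_filter)
    ultimately have "((\<lambda>u. h' u - h' t) \<longlongrightarrow> 0) (at t within {0..T})"
      by (rule Lim_null_comparison[rotated])
    then show "(h' \<longlongrightarrow> h' t) (at t within {0..T})" by (rule LIM_zero_cancel)
  qed
  show "\<exists>\<delta>>0. \<forall>a b. 0 \<le> a \<longrightarrow> a < b \<longrightarrow> b \<le> T \<longrightarrow> b - a \<le> \<delta> \<longrightarrow> c / 2 * (b - a) \<le> norm (h b - h a)"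
    if c: "0 < c" "\<And>t. t \<in> {0..T} \<Longrightarrow> c \<le> norm (h' t)"
  proof -
    \<comment> \<open>Makes \<open>C * \<delta> powr \<alpha> \<le> c / 2\<close>, also when
      \<open>C = 0\<close>.\<close>
    define \<delta> where "\<delta> = (c / (2 * (C + 1))) powr (1 / \<alpha>)"
    have "c / 2 * (b - a) \<le> norm (h b - h a)" if ab: "0 \<le> a" "a < b" "b \<le> T" "b - a \<le> \<delta>" for a b
    proof -
      have "(b - a) powr \<alpha> \<le> \<delta> powr \<alpha>" using ab C by (intro powr_mono2) auto
      also have "\<dots> = c / (2 * (C + 1))" using C c by (simp add: \<delta>_def powr_powr)
      finally have "C * (b - a) powr \<alpha> \<le> (C + 1) * (c / (2 * (C + 1)))" using C by (intro mult_mono) auto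
      also have "\<dots> = c / 2"
      proof -
        have "D * (c / (2 * D)) = c / 2" if "0 < D" for D :: real using that by simp
        from this[of "C + 1"] show ?thesis using C by linarith
      qed
      finally have "norm (quot h a b - h' a) \<le> c / 2" using quot[of a b a] ab by simp
      moreover have "c \<le> norm (h' a)" using ab by (intro c) auto
      ultimately have "c / 2 \<le> norm (quot h a b)"
        using norm_triangle_ineq2[of "h' a" "quot h a b"] norm_minus_commute[of "h' a" "quot h a b"] by linarith
      then have "(b - a) * (c / 2) \<le> (b - a) * norm (quot h a b)" using ab by (intro mult_left_mono) auto
      then show ?thesis unfolding diff[OF ab(2)] by (simp add: mult.commute)
    qed
    moreover have "\<delta> > 0" using c C by (simp add: \<delta>_def)
    ultimately show ?thesis by blast
  qed
qed

text \<open>The sums are exchanged so that \<open>h' t $ j\<close>, which depends on time alone,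
  stands in front. The minus sign is that of the time derivative of
  \<open>G *v x - h t\<close>.\<close>

lemma limit_kernel_eq:
  fixes h h' :: "real \<Rightarrow> real ^ 'n"
  assumes "(h has_vector_derivative h' t) (at t within {0..T})" "t \<in> {0..T}" "0 < T"
  shows "limit_kernel T \<mu> m p G h x t
    = (\<Sum>j\<in>UNIV. - (\<mu> * m * h' t $ j) * (\<Sum>i\<in>UNIV. p x $ i * dipole_kernel i j (G *v x - h t)))"
proof -
  let ?H = "G *v x - h t"
  have "(mag_field G h x has_vector_derivative 0 - h' t) (at t within {0..T})"
    unfolding mag_field_def[abs_def] by (intro has_vector_derivative_diff has_vector_derivative_const assms)
  then have d: "time_deriv T (mag_field G h x) t = - h' t"
    unfolding time_deriv_def using vector_derivative_within_cbox[of 0 T t "mag_field G h x" "- h' t"] assms by simp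
  have "(- ((1 / norm ?H ^ 3) *\<^sub>R outer_prod ?H ?H) + (1 / norm ?H) *\<^sub>R mat 1) $ i $ j = dipole_kernel i j ?H" for i j
    by (simp add: dipole_kernel_def outer_prod_def mat_def)
  then have "p x \<bullet> ((- ((1 / norm ?H ^ 3) *\<^sub>R outer_prod ?H ?H) + (1 / norm ?H) *\<^sub>R mat 1) *v (- h' t))
      = (\<Sum>i\<in>UNIV. p x $ i * (\<Sum>j\<in>UNIV. dipole_kernel i j ?H * (- h' t $ j)))"
    unfolding inner_vec_def matrix_vector_mult_def by simp
  also have "\<dots> = (\<Sum>j\<in>UNIV. \<Sum>i\<in>UNIV. p x $ i * (dipole_kernel i j ?H * (- h' t $ j)))"
    unfolding sum_distrib_left by (rule sum.swap)
  also have "\<dots> = (\<Sum>j\<in>UNIV. - h' t $ j * (\<Sum>i\<in>UNIV. p x $ i * dipole_kernel i j ?H))"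
    by (simp add: sum_distrib_left mult_ac)
  finally show ?thesis
    unfolding limit_kernel_def Let_def d unfolding mag_field_def
    by (simp add: sum_distrib_left mult_ac sum_negf)
qed

lemma limit_operator_approximable:
  fixes \<Omega> :: "(real ^ 'n) set" and T \<mu>\<^sub>0 m\<^sub>0 s :: real
    and p :: "real ^ 'n \<Rightarrow> real ^ 'n" and G :: "real ^ 'n ^ 'n" and h :: "real \<Rightarrow> real ^ 'n"
  assumes \<Omega>: "open \<Omega>" "bounded \<Omega>" and T: "T > 0"
    and p: "\<And>i. (\<lambda>x. p x $ i) \<in> linfty_space (lebesgue_on \<Omega>)"
    and G: "invertible G"
    and s: "s > 3 / 2" and h: "\<And>i. (\<lambda>t. h t $ i) \<in> sobolev_space s {0<..<T}"
    and h_cont: "continuous_on {0..T} h"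
    and speed: "(SUP t\<in>{0..T}. 1 / ennreal (norm (time_deriv T h t))) < \<infinity>"
    and \<theta>: "0 < \<theta>" "\<theta> \<le> 1" and ab: "0 < a" "a < real CARD('n)" "0 < b" "b < 1" "a + b = 2 * (1 + \<theta>)"
  shows "\<exists>K. approximable_operator (lebesgue_on \<Omega>) (lebesgue_on {0<..<T})
      (limit_operator \<Omega> T \<mu>\<^sub>0 m\<^sub>0 p G h) CARD('n) K \<theta>"
    and "c \<in> l2_space (lebesgue_on \<Omega>) \<Longrightarrow> AE t in lebesgue_on {0<..<T}.
        integrable (lebesgue_on \<Omega>) (\<lambda>x. c x * limit_kernel T \<mu>\<^sub>0 m\<^sub>0 p G h x t)"
proof -
  let ?M = "lebesgue_on \<Omega>" and ?N = "lebesgue_on {0<..<T}"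
  have \<Omega>s: "\<Omega> \<in> sets lebesgue" using \<Omega>(1) by simp
  have fM: "finite_measure ?M"
    by (rule finite_measure_lebesgue_on) (use \<Omega> in \<open>simp add: lmeasurable_open\<close>)
  have fN: "finite_measure ?N" by (rule finite_measure_interval)
  obtain h' C \<alpha> where C: "0 \<le> C" "0 < \<alpha>"
    and der: "\<And>t. t \<in> {0..T} \<Longrightarrow> (h has_vector_derivative h' t) (at t within {0..T})"
    and quot: "\<And>a b t. 0 \<le> a \<Longrightarrow> a < b \<Longrightarrow> b \<le> T \<Longrightarrow> t \<in> {a..b} \<Longrightarrow> norm (quot h a b - h' t) \<le> C * (b - a) powr \<alpha>"
    by (rule sobolev_imp_C1[OF h s T h_cont]) (rule that)
  have "\<exists>L\<ge>0. \<forall>t\<in>{0..T}. norm (h' t) \<le> L"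
    by (rule hoelder_quotient_consequences(1)[OF T C quot])
  then obtain L where L: "0 \<le> L" "\<And>t. t \<in> {0..T} \<Longrightarrow> norm (h' t) \<le> L" by blast
  have "\<exists>L\<ge>0. \<forall>t\<in>{0..T}. \<forall>u\<in>{0..T}. norm (h t - h u) \<le> L * \<bar>t - u\<bar>"
    by (rule hoelder_quotient_consequences(2)[OF T C quot])
  then obtain L1 where L1: "0 \<le> L1" "\<And>t u. t \<in> {0..T} \<Longrightarrow> u \<in> {0..T} \<Longrightarrow> norm (h t - h u) \<le> L1 * \<bar>t - u\<bar>"
    by blast
  have h'_cont: "continuous_on {0..T} h'"
    by (rule hoelder_quotient_consequences(3)[OF T C quot])
  have td: "time_deriv T h t = h' t" if "t \<in> {0..T}" for t
    unfolding time_deriv_def using vector_derivative_within_cbox[of 0 T t h "h' t"] der[OF that] that T by simp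
  \<comment> \<open>In \<open>ennreal\<close> the reciprocal of 0 is infinite, so a finite supremum
    \<open>S\<close> excludes zero speed. The 1 added to \<open>S\<close> makes
    \<open>1 / (S + 1)\<close> positive in every case.\<close>
  obtain c0 where c0: "0 < c0" "\<And>t. t \<in> {0..T} \<Longrightarrow> c0 \<le> norm (h' t)"
  proof -
    define S where "S = (SUP t\<in>{0..T}. 1 / ennreal (norm (time_deriv T h t)))"
    have S: "S = ennreal (enn2real S)" using speed by (simp add: S_def)
    have "1 / (enn2real S + 1) \<le> norm (h' t)" if t: "t \<in> {0..T}" for t
    proof -
      have le: "1 / ennreal (norm (h' t)) \<le> ennreal (enn2real S)"
        using SUP_upper[OF t, of "\<lambda>t. 1 / ennreal (norm (time_deriv T h t))"] td[OF t] S by (simp add: S_def)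
      have n: "norm (h' t) > 0"
      proof (rule ccontr)
        assume "\<not> norm (h' t) > 0"
        then have "1 / ennreal (norm (h' t)) = top" by (simp add: divide_ennreal_def)
        with le show False by (simp add: top_unique)
      qed
      have "1 / ennreal (norm (h' t)) = ennreal (1 / norm (h' t))"
        using divide_ennreal[of 1 "norm (h' t)"] n by simp
      then have "1 / norm (h' t) \<le> enn2real S" using le by (simp add: ennreal_le_iff)
      then have "1 \<le> norm (h' t) * enn2real S" using n by (simp add: divide_le_eq mult.commute)
      also have "\<dots> \<le> norm (h' t) * (enn2real S + 1)" by (intro mult_left_mono) auto
      finally have "1 \<le> norm (h' t) * (enn2real S + 1)" .
      then show ?thesis by (simp add: divide_le_eq add_nonneg_pos mult.commute)
    qed
    then show ?thesis using that[of "1 / (enn2real S + 1)"] by (simp add: add_nonneg_pos)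
  qed
  have "\<exists>\<delta>>0. \<forall>a b. 0 \<le> a \<longrightarrow> a < b \<longrightarrow> b \<le> T \<longrightarrow> b - a \<le> \<delta> \<longrightarrow> c0 / 2 * (b - a) \<le> norm (h b - h a)"
    by (rule hoelder_quotient_consequences(4)[OF T C quot c0])
  then obtain \<delta> where \<delta>: "0 < \<delta>"
    "\<And>a b. 0 \<le> a \<Longrightarrow> a < b \<Longrightarrow> b \<le> T \<Longrightarrow> b - a \<le> \<delta> \<Longrightarrow> c0 / 2 * (b - a) \<le> norm (h b - h a)"
    by blast
  obtain CM where CM: "0 \<le> CM" "\<And>z r. 0 < r \<Longrightarrow>
    emeasure ?M {x \<in> \<Omega>. norm (G *v x - z) < r} \<le> ennreal (CM * r powr real CARD('n))"
    by (rule emeasure_affine_sublevel[OF G \<Omega>s]) (rule that)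
  obtain CN where CN: "0 \<le> CN" "\<And>z r. 0 < r \<Longrightarrow>
    emeasure ?N {t \<in> {0<..<T}. norm (z - h t) < r} \<le> ennreal (CN * r)"
    by (rule emeasure_curve_sublevel[OF T half_gt_zero[OF c0(1)] \<delta>(1) h_cont]) (erule (3) \<delta>(2), rule that)
  define \<rho> where "\<rho> x t = norm (G *v x - h t)" for x t
  have linG: "bounded_linear (\<lambda>x. G *v x)" by (rule matrix_vector_mul_bounded_linear)
  obtain R where R: "0 < R" "\<And>x t. x \<in> \<Omega> \<Longrightarrow> t \<in> {0..T} \<Longrightarrow> \<rho> x t \<le> R"
  proof -
    have "bounded ((\<lambda>x. G *v x) ` \<Omega>)" by (rule bounded_linear_image[OF \<Omega>(2) linG])
    then obtain R1 where R1: "\<And>x. x \<in> \<Omega> \<Longrightarrow> norm (G *v x) \<le> R1" unfolding bounded_iff by blast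
    have "bounded (h ` {0..T})" by (intro compact_imp_bounded compact_continuous_image h_cont) simp
    then obtain R2 where R2: "\<And>t. t \<in> {0..T} \<Longrightarrow> norm (h t) \<le> R2" unfolding bounded_iff by blast
    have "\<rho> x t \<le> \<bar>R1\<bar> + \<bar>R2\<bar> + 1" if "x \<in> \<Omega>" "t \<in> {0..T}" for x t
      using norm_triangle_ineq4[of "G *v x" "h t"] R1[OF that(1)] R2[OF that(2)] unfolding \<rho>_def by linarith
    then show ?thesis using that[of "\<bar>R1\<bar> + \<bar>R2\<bar> + 1"] by simp
  qed
  obtain P where P: "0 \<le> P" "AE x in ?M. \<forall>i. \<bar>p x $ i\<bar> \<le> P"
  proof -
    have "\<forall>i. \<exists>B. AE x in ?M. \<bar>p x $ i\<bar> \<le> B" using p by (simp add: linfty_space_def)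
    then obtain B where B: "\<And>i. AE x in ?M. \<bar>p x $ i\<bar> \<le> B i" by metis
    have "AE x in ?M. \<forall>i\<in>UNIV. \<bar>p x $ i\<bar> \<le> B i" by (rule AE_finite_allI) (auto simp: B)
    then have "AE x in ?M. \<forall>i. \<bar>p x $ i\<bar> \<le> (\<Sum>i\<in>UNIV. \<bar>B i\<bar>)"
    proof eventually_elim
      case (elim x)
      show ?case
      proof
        fix i
        have "\<bar>p x $ i\<bar> \<le> \<bar>B i\<bar>" using elim by (auto intro: order_trans abs_ge_self)
        also have "\<dots> \<le> (\<Sum>i\<in>UNIV. \<bar>B i\<bar>)" by (intro member_le_sum) auto
        finally show "\<bar>p x $ i\<bar> \<le> (\<Sum>i\<in>UNIV. \<bar>B i\<bar>)" .
      qed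
    qed
    then show ?thesis using that[of "\<Sum>i\<in>UNIV. \<bar>B i\<bar>"] by (simp add: sum_nonneg)
  qed
  have Hmeas: "(\<lambda>z. G *v fst z - h (snd z)) \<in> borel_measurable (?M \<Otimes>\<^sub>M ?N)"
  proof -
    have "(\<lambda>x. G *v x) \<in> borel_measurable ?M"
      by (intro continuous_imp_measurable_on_sets_lebesgue linear_continuous_on linG \<Omega>s)
    moreover have "h \<in> borel_measurable ?N"
      by (intro continuous_imp_measurable_on_sets_lebesgue continuous_on_subset[OF h_cont]) auto
    ultimately show ?thesis
      by (intro borel_measurable_diff measurable_compose[OF measurable_fst] measurable_compose[OF measurable_snd])
  qed
  have \<rho>_meas: "(\<lambda>(x, t). \<rho> x t) \<in> borel_measurable (?M \<Otimes>\<^sub>M ?N)"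
    using measurable_compose[OF Hmeas borel_measurable_norm] by (simp add: \<rho>_def case_prod_unfold)
  define \<kappa> where "\<kappa> j x t = (\<Sum>i\<in>UNIV. p x $ i * dipole_kernel i j (G *v x - h t))" for j x t
  define g where "g j t = - (\<mu>\<^sub>0 * m\<^sub>0 * h' t $ j)" for j t
  \<comment> \<open>The first summand turns \<open>1 / \<rho>\<close> into
    \<open>\<rho> powr (- (1 + \<theta>))\<close> by means of \<open>\<rho> \<le> R\<close>; the
    second comes from \<open>dipole_kernel_hoelder\<close> and the Lipschitz constant
    \<open>L1\<close> of \<open>h\<close>. The factor in front stems from the sum over the
    components of \<open>p\<close>.\<close>
  define Kw where "Kw = real CARD('n) * P * (2 * R powr \<theta> + 12 * L1 powr \<theta>)"
  have Kw: "0 \<le> Kw" using P by (simp add: Kw_def)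
  define w where "w x t = (if x \<in> \<Omega> \<and> t \<in> {0<..<T} then Kw * \<rho> x t powr (- (1 + \<theta>)) else 0)" for x t
  \<comment> \<open>These are the constants of the dyadic estimate, with \<open>m\<close> the
    dimension in space and \<open>m = 1\<close> in time.\<close>
  define IM where "IM = CM * (R / 2) powr (-a) * (2 * R) powr real CARD('n) / (1 - 2 powr (a - real CARD('n)))"
  define IN where "IN = CN * (R / 2) powr (-b) * (2 * R) powr 1 / (1 - 2 powr (b - 1))"
  have \<kappa>_le: "AE x in ?M. \<forall>t\<in>{0<..<T}. \<bar>\<kappa> j x t\<bar> \<le> w x t" for j
    using P(2) AE_space
  proof eventually_elim
    case (elim x)
    then have x: "x \<in> \<Omega>" by simp
    show ?case
    proof
      fix t assume t: "t \<in> {0<..<T}"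
      have z: "2 / \<rho> x t \<le> 2 * R powr \<theta> * \<rho> x t powr (- (1 + \<theta>))"
      proof (cases "\<rho> x t = 0")
        case False
        then have pos: "\<rho> x t > 0" by (simp add: \<rho>_def)
        have "1 / \<rho> x t = \<rho> x t powr \<theta> * \<rho> x t powr (- (1 + \<theta>))"
          unfolding powr_add[symmetric] using pos by (simp add: powr_minus_divide)
        also have "\<dots> \<le> R powr \<theta> * \<rho> x t powr (- (1 + \<theta>))"
          using pos R x t \<theta> by (intro mult_right_mono powr_mono2) auto
        finally show ?thesis by simp
      qed simp
      have "\<bar>\<kappa> j x t\<bar> \<le> (\<Sum>i\<in>UNIV. \<bar>p x $ i * dipole_kernel i j (G *v x - h t)\<bar>)"
        unfolding \<kappa>_def by (rule sum_abs)
      also have "\<dots> \<le> (\<Sum>i\<in>(UNIV :: 'n set). P * (2 / \<rho> x t))"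
        unfolding abs_mult \<rho>_def using elim P by (intro sum_mono mult_mono dipole_kernel_le) auto
      also have "\<dots> = real CARD('n) * (P * (2 / \<rho> x t))" by simp
      also have "\<dots> \<le> real CARD('n) * (P * (2 * R powr \<theta> * \<rho> x t powr (- (1 + \<theta>))))"
        by (intro mult_left_mono z P) simp
      also have "\<dots> \<le> w x t"
        using x t P unfolding w_def Kw_def by (auto simp: algebra_simps)
      finally show "\<bar>\<kappa> j x t\<bar> \<le> w x t" .
    qed
  qed
  have \<kappa>_diff: "AE x in ?M. \<forall>t\<in>{0<..<T}. \<forall>\<tau>\<in>{0<..<T}.
      \<bar>\<kappa> j x t - \<kappa> j x \<tau>\<bar> \<le> \<bar>t - \<tau>\<bar> powr \<theta> * (w x t + w x \<tau>)" for j
    using P(2) AE_space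
  proof eventually_elim
    case (elim x)
    then have x: "x \<in> \<Omega>" by simp
    show ?case
    proof (intro ballI)
      fix t \<tau> assume t: "t \<in> {0<..<T}" "\<tau> \<in> {0<..<T}"
      define V where "V = \<rho> x t powr (- (1 + \<theta>)) + \<rho> x \<tau> powr (- (1 + \<theta>))"
      have V: "0 \<le> V" by (simp add: V_def)
      let ?k = "\<lambda>i t. dipole_kernel i j (G *v x - h t)"
      have k: "\<bar>?k i t - ?k i \<tau>\<bar> \<le> 12 * (L1 powr \<theta> * \<bar>t - \<tau>\<bar> powr \<theta>) * V" for i
      proof -
        have "\<bar>?k i t - ?k i \<tau>\<bar> \<le> 12 * norm (G *v x - h t - (G *v x - h \<tau>)) powr \<theta> * V"
          unfolding V_def \<rho>_def by (rule dipole_kernel_hoelder[OF \<theta>])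
        also have "norm (G *v x - h t - (G *v x - h \<tau>)) = norm (h t - h \<tau>)"
          by (simp add: norm_minus_commute)
        also have "12 * norm (h t - h \<tau>) powr \<theta> * V \<le> 12 * (L1 * \<bar>t - \<tau>\<bar>) powr \<theta> * V"
          using L1 t \<theta> V by (intro mult_right_mono mult_left_mono powr_mono2) auto
        also have "(L1 * \<bar>t - \<tau>\<bar>) powr \<theta> = L1 powr \<theta> * \<bar>t - \<tau>\<bar> powr \<theta>"
          using L1 by (simp add: powr_mult)
        finally show ?thesis .
      qed
      have "\<bar>\<kappa> j x t - \<kappa> j x \<tau>\<bar> = \<bar>\<Sum>i\<in>UNIV. p x $ i * (?k i t - ?k i \<tau>)\<bar>"
        unfolding \<kappa>_def by (simp add: sum_subtractf right_diff_distrib)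
      also have "\<dots> \<le> (\<Sum>i\<in>UNIV. \<bar>p x $ i * (?k i t - ?k i \<tau>)\<bar>)" by (rule sum_abs)
      also have "\<dots> \<le> (\<Sum>i\<in>(UNIV :: 'n set). P * (12 * (L1 powr \<theta> * \<bar>t - \<tau>\<bar> powr \<theta>) * V))"
        unfolding abs_mult using elim P by (intro sum_mono mult_mono k) auto
      also have "\<dots> = \<bar>t - \<tau>\<bar> powr \<theta> * ((real CARD('n) * P * (12 * L1 powr \<theta>)) * V)" by simp
      also have "\<dots> \<le> \<bar>t - \<tau>\<bar> powr \<theta> * (Kw * V)"
        using P V by (intro mult_left_mono mult_right_mono) (auto simp: Kw_def distrib_left)
      also have "Kw * V = w x t + w x \<tau>" using x t by (simp add: w_def V_def distrib_left)
      finally show "\<bar>\<kappa> j x t - \<kappa> j x \<tau>\<bar> \<le> \<bar>t - \<tau>\<bar> powr \<theta> * (w x t + w x \<tau>)" .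
    qed
  qed
  have q: "0 \<le> 1 - 2 powr (a - real CARD('n))" "0 \<le> 1 - 2 powr (b - 1)"
    using ab by (simp_all add: powr_less_one less_imp_le)
  have IM: "(\<integral>\<^sup>+x. ennreal (\<rho> x t powr (-a)) \<partial>?M) \<le> ennreal IM" if t: "t \<in> space ?N" for t
    unfolding IM_def
  proof (rule nn_integral_powr_le_of_sublevel)
    show "(\<lambda>x. \<rho> x t) \<in> borel_measurable ?M"
    proof -
      have "(\<lambda>x. (x, t)) \<in> measurable ?M (?M \<Otimes>\<^sub>M ?N)" using t by (intro measurable_Pair) auto
      from measurable_compose[OF this \<rho>_meas] show ?thesis by simp
    qed
    show "emeasure ?M {x \<in> space ?M. \<rho> x t < r} \<le> ennreal (CM * r powr real CARD('n))" if "0 < r" for r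
      using CM(2)[OF that, of "h t"] by (simp add: \<rho>_def)
  qed (use R CM(1) ab t in \<open>auto simp: \<rho>_def\<close>)
  have IN: "(\<integral>\<^sup>+t. ennreal (\<rho> x t powr (-b)) \<partial>?N) \<le> ennreal IN" if x: "x \<in> space ?M" for x
    unfolding IN_def
  proof (rule nn_integral_powr_le_of_sublevel)
    show "(\<lambda>t. \<rho> x t) \<in> borel_measurable ?N"
    proof -
      have "(\<lambda>t. (x, t)) \<in> measurable ?N (?M \<Otimes>\<^sub>M ?N)" using x by (intro measurable_Pair) auto
      from measurable_compose[OF this \<rho>_meas] show ?thesis by simp
    qed
    show "emeasure ?N {t \<in> space ?N. \<rho> x t < r} \<le> ennreal (CN * r powr 1)" if "0 < r" for r
      using CN(2)[OF that, of "G *v x"] that by (simp add: \<rho>_def)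
  qed (use R CN(1) ab x in \<open>auto simp: \<rho>_def\<close>)
  have pos: "0 \<le> IM" "0 \<le> IN" using CM CN q by (simp_all add: IM_def IN_def)
  interpret weakly_singular_kernels ?M T \<theta> "Kw * sqrt (IM * IN)" "\<bar>\<mu>\<^sub>0 * m\<^sub>0\<bar> * L" \<kappa> w g
  proof (intro weakly_singular_kernels.intro weakly_singular_kernels_axioms.intro fM T \<theta>(1) \<kappa>_le \<kappa>_diff)
    show "0 \<le> Kw * sqrt (IM * IN)" using Kw pos by simp
    show "0 \<le> \<bar>\<mu>\<^sub>0 * m\<^sub>0\<bar> * L" using L by simp
    show "(\<lambda>(x, t). \<kappa> j x t) \<in> borel_measurable (?M \<Otimes>\<^sub>M ?N)" for j
    proof -
      have "(\<lambda>x. p x $ i) \<in> borel_measurable ?M" for i using p by (simp add: linfty_space_def)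
      then have "(\<lambda>z. \<Sum>i\<in>UNIV. p (fst z) $ i * dipole_kernel i j (G *v fst z - h (snd z))) \<in> borel_measurable (?M \<Otimes>\<^sub>M ?N)"
        by (intro borel_measurable_sum borel_measurable_times measurable_compose[OF Hmeas borel_measurable_dipole_kernel]
            measurable_compose[OF measurable_fst, of "\<lambda>x. p x $ _"])
      then show ?thesis by (simp add: \<kappa>_def case_prod_unfold)
    qed
    show "(\<lambda>(x, t). w x t) \<in> borel_measurable (?M \<Otimes>\<^sub>M ?N)"
    proof -
      have "(\<lambda>z. Kw * (case z of (x, t) \<Rightarrow> \<rho> x t) powr (- (1 + \<theta>))) \<in> borel_measurable (?M \<Otimes>\<^sub>M ?N)"
        using \<rho>_meas by measurable
      then show ?thesis
        by (rule measurable_cong[THEN iffD1, rotated]) (auto simp: w_def space_pair_measure)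
    qed
    show "0 \<le> w x t" for x t using Kw by (simp add: w_def)
    show "(\<integral>\<^sup>+t. (\<integral>\<^sup>+x. ennreal (\<bar>c x\<bar> * w x t) \<partial>?M)\<^sup>2 \<partial>?N) \<le> ennreal ((Kw * sqrt (IM * IN) * l2_norm ?M c)\<^sup>2)"
      if c: "c \<in> l2_space ?M" for c
    proof -
      have "(\<integral>\<^sup>+t. (\<integral>\<^sup>+x. ennreal (\<bar>c x\<bar> * w x t) \<partial>?M)\<^sup>2 \<partial>?N)
          = (\<integral>\<^sup>+t. (\<integral>\<^sup>+x. ennreal (\<bar>c x\<bar> * (Kw * \<rho> x t powr (- (1 + \<theta>)))) \<partial>?M)\<^sup>2 \<partial>?N)"
        by (intro nn_integral_cong arg_cong[of _ _ "\<lambda>x. x\<^sup>2"]) (auto simp: w_def)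
      then show ?thesis
        using nn_integral_Schur_square[OF fM fN \<rho>_meas IM pos(1) IN pos(2) ab(5) Kw c] by simp
    qed
    show "g j \<in> borel_measurable ?N" for j
      unfolding g_def
      by (intro continuous_imp_measurable_on_sets_lebesgue continuous_intros continuous_on_subset[OF h'_cont]) auto
    show "\<bar>g j t\<bar> \<le> \<bar>\<mu>\<^sub>0 * m\<^sub>0\<bar> * L" if t: "t \<in> {0<..<T}" for j t
    proof -
      have "\<bar>h' t $ j\<bar> \<le> norm (h' t)" by (rule component_le_norm_cart)
      also have "\<dots> \<le> L" using t by (intro L) auto
      finally show ?thesis unfolding g_def abs_minus_cancel abs_mult[of _ "h' t $ j"] by (intro mult_left_mono) auto
    qed
  qed
  have kernel: "limit_kernel T \<mu>\<^sub>0 m\<^sub>0 p G h x t = (\<Sum>j\<in>UNIV. g j t * \<kappa> j x t)" if "t \<in> {0<..<T}" for x t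
    unfolding g_def \<kappa>_def using that by (intro limit_kernel_eq der T) auto
  have "limit_operator \<Omega> T \<mu>\<^sub>0 m\<^sub>0 p G h c t = A c t" if "t \<in> {0<..<T}" for c t
    unfolding limit_operator_def A_def using kernel[OF that] by simp
  from approximable_cong[of "limit_operator \<Omega> T \<mu>\<^sub>0 m\<^sub>0 p G h", OF this]
  show "\<exists>K. approximable_operator ?M ?N (limit_operator \<Omega> T \<mu>\<^sub>0 m\<^sub>0 p G h) CARD('n) K \<theta>"
    by blast
  have "AE t in ?N. t \<in> {0<..<T}" by (rule AE_I2) simp
  then show "AE t in ?N. integrable ?M (\<lambda>x. c x * limit_kernel T \<mu>\<^sub>0 m\<^sub>0 p G h x t)" if "c \<in> l2_space ?M"
    using AE_integrable[OF that] by eventually_elim (simp add: kernel)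
qed

theorem theorem4p3:
  fixes \<Omega> :: "(real ^ 'n) set" and T \<mu>\<^sub>0 m\<^sub>0 s :: real
    and p :: "real ^ 'n \<Rightarrow> real ^ 'n" and G :: "real ^ 'n ^ 'n" and h :: "real \<Rightarrow> real ^ 'n"
  assumes dim: "CARD('n) \<in> {2, 3}"
    and dom: "bounded_lipschitz_domain \<Omega>"
    and pos: "T > 0" "\<mu>\<^sub>0 > 0" "m\<^sub>0 > 0"
    and p: "\<And>i. (\<lambda>x. p x $ i) \<in> linfty_space (lebesgue_on \<Omega>)"
    and G: "invertible G"
    and s: "s > 3 / 2"
    and h: "\<And>i. (\<lambda>t. h t $ i) \<in> sobolev_space s {0<..<T}"
    and h_cont: "continuous_on {0..T} h" (* h is the continuous representative of its class *)
    and i: "(SUP t\<in>{0..T}. 1 / ennreal (norm (time_deriv T h t))) < \<infinity>"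
    and ii: "\<And>t. t \<in> {0<..<T} \<Longrightarrow> matrix_inv G *v h t \<in> \<Omega>"
      "\<exists>N::nat. \<forall>x\<in>\<Omega>. finite {t \<in> {0<..<T}. h t = G *v x} \<and>
                         card {t \<in> {0<..<T}. h t = G *v x} \<le> N"
  defines "F \<equiv> limit_operator \<Omega> T \<mu>\<^sub>0 m\<^sub>0 p G h"
  shows
    "(\<forall>c\<in>l2_space (lebesgue_on \<Omega>). AE t in lebesgue_on {0<..<T}.
        integrable (lebesgue_on \<Omega>) (\<lambda>x. c x * limit_kernel T \<mu>\<^sub>0 m\<^sub>0 p G h x t)) \<and>
     l2_compact_operator (lebesgue_on \<Omega>) (lebesgue_on {0<..<T}) F \<and>
     (\<exists>\<sigma>. singular_value_sequence (lebesgue_on \<Omega>) (lebesgue_on {0<..<T}) F \<sigma>) \<and>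
     (\<forall>\<sigma>. singular_value_sequence (lebesgue_on \<Omega>) (lebesgue_on {0<..<T}) F \<sigma> \<longrightarrow>
        (\<forall>\<epsilon>\<in>{0<..<1/4}. \<exists>C. \<forall>n\<ge>1.
           \<sigma> n \<le> (if CARD('n) = 3 then C * real n powr (- 1 + \<epsilon>)
                  else C * real n powr (- (1 / 4) + \<epsilon>))))"
proof -
  have \<Omega>: "open \<Omega>" "bounded \<Omega>" using dom by (auto simp: bounded_lipschitz_domain_def)
  note main = limit_operator_approximable[OF \<Omega> pos(1) p G s h h_cont i]
  have card: "real CARD('n) \<ge> 2" using dim by auto
  \<comment> \<open>The exponents \<open>a = 7/4 < 2\<close> and \<open>b = 3/4\<close> add up to
    \<open>2 * (1 + 1/4)\<close>. This instance is valid in both dimensions and also supplies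
    compactness and the existence of the singular values.\<close>
  obtain K where "approximable_operator (lebesgue_on \<Omega>) (lebesgue_on {0<..<T}) F CARD('n) K (1/4)"
    using main(1)[of "1/4" "7/4" "3/4"] card unfolding F_def by auto
  then interpret A: approximable_operator "lebesgue_on \<Omega>" "lebesgue_on {0<..<T}" F "CARD('n)" K "1/4" .
  have integrable: "AE t in lebesgue_on {0<..<T}.
      integrable (lebesgue_on \<Omega>) (\<lambda>x. c x * limit_kernel T \<mu>\<^sub>0 m\<^sub>0 p G h x t)"
    if "c \<in> l2_space (lebesgue_on \<Omega>)" for c
    using main(2)[of "1/4" "7/4" "3/4" c] card that by auto
  have "\<exists>C. \<forall>n\<ge>1. \<sigma> n \<le> (if CARD('n) = 3 then C * real n powr (- 1 + \<epsilon>)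
                  else C * real n powr (- (1 / 4) + \<epsilon>))"
    if \<sigma>: "singular_value_sequence (lebesgue_on \<Omega>) (lebesgue_on {0<..<T}) F \<sigma>" and \<epsilon>: "\<epsilon> \<in> {0<..<1/4}" for \<sigma> \<epsilon>
  proof (cases "CARD('n) = 3")
    case True
    \<comment> \<open>With \<open>\<theta> = 1 - \<epsilon>\<close> the exponents
      \<open>a = 3 - \<epsilon>\<close> and \<open>b = 1 - \<epsilon>\<close> stay below 3 and 1 and
      add up to \<open>2 * (1 + \<theta>)\<close>.\<close>
    obtain K' where "approximable_operator (lebesgue_on \<Omega>) (lebesgue_on {0<..<T}) F CARD('n) K' (1 - \<epsilon>)"
      using main(1)[of "1 - \<epsilon>" "3 - \<epsilon>" "1 - \<epsilon>"] True \<epsilon> unfolding F_def by auto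
    then interpret B: approximable_operator "lebesgue_on \<Omega>" "lebesgue_on {0<..<T}" F "CARD('n)" K' "1 - \<epsilon>" .
    obtain C where "\<And>\<sigma> n. singular_value_sequence (lebesgue_on \<Omega>) (lebesgue_on {0<..<T}) F \<sigma> \<Longrightarrow> 1 \<le> n \<Longrightarrow>
        \<sigma> n \<le> C * real n powr (- (1 - \<epsilon>))" using B.singular_value_decay by blast
    then show ?thesis using \<sigma> True by (intro exI[of _ C]) simp
  next
    case False
    obtain C where C: "\<And>\<sigma> n. singular_value_sequence (lebesgue_on \<Omega>) (lebesgue_on {0<..<T}) F \<sigma> \<Longrightarrow> 1 \<le> n \<Longrightarrow>
        \<sigma> n \<le> C * real n powr (- (1 / 4))" using A.singular_value_decay by blast
    \<comment> \<open>The rate with exponent -1/4 is weakened to the stated one;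
      \<open>\<bar>C\<bar>\<close> supplies the sign that monotonicity of the product
      requires.\<close>
    have "\<sigma> n \<le> \<bar>C\<bar> * real n powr (- (1 / 4) + \<epsilon>)" if n: "1 \<le> n" for n
    proof -
      have "\<sigma> n \<le> C * real n powr (- (1 / 4))" by (rule C[OF \<sigma> n])
      also have "\<dots> \<le> \<bar>C\<bar> * real n powr (- (1 / 4) + \<epsilon>)"
        using n \<epsilon> by (intro mult_mono powr_mono) auto
      finally show ?thesis .
    qed
    then show ?thesis using False by (intro exI[of _ "\<bar>C\<bar>"]) simp
  qed
  then show ?thesis using integrable A.compact_operator A.ex_singular_value_sequence by blast
qed

end
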